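(* Let $\mu\in\mathbb R$ and let $(X_n)$ be a sequence of iid random variables drawn from some distribution in $\mathrm{DAN}(\mu)$. For $\lambda>0$ and $\alpha>0$ set $$A_{n,\alpha}(\lambda)=\frac{\log(2/\alpha)+\lambda^2/2}{\lambda\sqrt n}.$$ Fix any $\lambda>0$ (independent of $\alpha$). If $n>(\log(2/\alpha)/\lambda+\lambda/2)^2$, let $$\mathcal H_n^{\mathrm{IWR}}(\alpha;\lambda)=\big(\overline X_n- W_n,\ \overline X_n+W_n\big),\qquad W_n=W_n^{\mathrm{IWR}}(\alpha;\lambda)=\frac{A_{n,\alpha}(\lambda)\,\hat s_n}{(1-A_{n,\alpha}(\lambda)^2)^{1/2}},$$ and otherwise let $\mathcal H_n^{\mathrm{IWR}}(\alpha;\lambda)=\mathbb R$. Then $(\mathcal H_n^{\mathrm{IWR}}(\cdot;\lambda))_{n\ge1}$ is an asymptotic post-hoc confidence interval for $\mu$ (under $\mathrm{DAN}(\mu)$). Additionally, if $\mathcal P\subseteq\mathrm{DAN}(\mu)$ is a class for which $(X_n)$ has $\mathcal P$-uniformly bounded skew, then $(\mathcal H_n^{\mathrm{IWR}}(\cdot;\lambda))_{n\ge1}$ is a $\mathcal P$-uniform asymptotic post-hoc confidence interval for $\mu$.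
   Context: Under $P$, $X_1,X_2,\dots$ are iid with law $P$. $\overline X_n=n^{-1}\sum_{i\le n}X_i$ and $\hat s_n^2=n^{-1}\sum_{i\le n}(X_i-\overline X_n)^2$, $\hat s_n\ge0$. An interval $(a,b)$ with $a\ge b$ is the empty set. $\mathrm{DAN}(\mu)$ is the set of distributions $P$ on $\mathbb R$ with mean $\mu$ such that there exist real sequences $(a_n)$ (with $a_n>0$) and $(b_n)$ with $(\sum_{i\le n}X_i-b_n)/a_n\to N(0,1)$ in distribution under $P$. $\mathcal P$-uniformly bounded skew means $\sup_{P\in\mathcal P}\mathbb E_P|X_1-\mathbb E_PX_1|^3/\sigma_P^3<\infty$, with $\sigma_P^2$ the (finite, positive) variance of $X_1$ under $P$. For families of random sets $\mathcal H_n=\{\mathcal H_n(\alpha)\}_{\alpha>0}$, let $\mathbf R(\mathcal H_n;\mu,P)=\mathbb E_P\big[\sup_{\alpha>0}\mathbf 1\{\mu\notin\mathcal H_n(\alpha)\}/\alpha\big]$. $(\mathcal H_n)$ is an asymptotic post-hoc confidence interval for $\mu$ under a class $\mathcal Q$ if $\sup_{P\in\mathcal Q}\limsup_{n\to\infty}\mathbf R(\mathcal H_n;\mu,P)\le1$; it is a $\mathcal Q$-uniform one if $\limsup_{n\to\infty}\sup_{P\in\mathcal Q}\mathbf R(\mathcal H_n;\mu,P)\le1$. *)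

theory Defs
  imports "HOL-Probability.Probability"
begin

text \<open>Samples are indexed from 0: the first \<open>n\<close> observations are \<open>X 0, \<dots>, X (n - 1)\<close>.\<close>

definition iid_with_law :: "'w measure \<Rightarrow> (nat \<Rightarrow> 'w \<Rightarrow> real) \<Rightarrow> real measure \<Rightarrow> bool" where
  "iid_with_law M X P \<longleftrightarrow>
     prob_space M \<and>
     prob_space.indep_vars M (\<lambda>_. borel) X UNIV \<and>
     (\<forall>i. distr M borel (X i) = P)"

text \<open>The law of \<open>(\<Sum>i<n. X i - b n) / a n\<close> depends only on the law of the observations, so it is
  computed here on the canonical space of sequences, where the observations are the coordinates.\<close>

definition DAN :: "real \<Rightarrow> real measure set" where
  "DAN \<mu> = {P. real_distribution P \<and> integrable P (\<lambda>x. x) \<and> (\<integral>x. x \<partial>P) = \<mu> \<and>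
     (\<exists>a b :: nat \<Rightarrow> real. (\<forall>n. a n > 0) \<and>
        weak_conv_m
          (\<lambda>n. distr (\<Pi>\<^sub>M i\<in>(UNIV :: nat set). P) borel (\<lambda>x. ((\<Sum>i<n. x i) - b n) / a n))
          std_normal_distribution)}"

lemma iid_with_law_canonical:
  assumes "real_distribution P"
  shows "iid_with_law (\<Pi>\<^sub>M i\<in>(UNIV :: nat set). P) (\<lambda>i x. x i) P"
proof -
  interpret R: real_distribution P by fact
  interpret product_prob_space "\<lambda>_::nat. P" UNIV ..
  have component: "distr (\<Pi>\<^sub>M i\<in>(UNIV :: nat set). P) borel (\<lambda>x. x i) = P" for i
    using PiM_component[of i] R.events_eq_borel by (metis UNIV_I distr_cong)
  moreover have "indep_vars (\<lambda>_. borel) (\<lambda>i x. x i) UNIV"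
  proof (subst indep_vars_iff_distr_eq_PiM)
    show "distr (\<Pi>\<^sub>M i\<in>(UNIV :: nat set). P) (\<Pi>\<^sub>M i\<in>(UNIV :: nat set). borel) (\<lambda>x. \<lambda>i\<in>UNIV. x i)
      = (\<Pi>\<^sub>M i\<in>(UNIV :: nat set). distr (\<Pi>\<^sub>M i\<in>(UNIV :: nat set). P) borel (\<lambda>x. x i))"
      unfolding component
      by (simp add: restrict_UNIV distr_id2 sets_PiM_cong[OF refl R.events_eq_borel])
  qed auto
  ultimately show ?thesis
    using prob_space_axioms by (simp add: iid_with_law_def)
qed

text \<open>The third moment is an extended nonnegative integral, so that a law with infinite third moment
  violates the bound (the Bochner integral would be 0).\<close>

definition uniformly_bounded_skew :: "real measure set \<Rightarrow> bool" where
  "uniformly_bounded_skew \<P> \<longleftrightarrow>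
     (\<forall>P\<in>\<P>. integrable P (\<lambda>x. x) \<and> integrable P (\<lambda>x. x\<^sup>2) \<and> prob_space.variance P (\<lambda>x. x) > 0) \<and>
     (SUP P\<in>\<P>. (\<integral>\<^sup>+x. ennreal (\<bar>x - (\<integral>y. y \<partial>P)\<bar> ^ 3) \<partial>P) /
        ennreal (sqrt (prob_space.variance P (\<lambda>x. x)) ^ 3)) < \<infinity>"

definition posthoc_risk :: "'w measure \<Rightarrow> (real \<Rightarrow> 'w \<Rightarrow> real set) \<Rightarrow> real \<Rightarrow> ennreal" where
  "posthoc_risk M H \<mu> = (\<integral>\<^sup>+\<omega>. (SUP \<alpha>\<in>{0<..}. ennreal (of_bool (\<mu> \<notin> H \<alpha> \<omega>) / \<alpha>)) \<partial>M)"

text \<open>\<open>M P\<close> is the probability measure on the sample space under which the observations have law \<open>P\<close>.\<close>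

definition asymp_posthoc_ci ::
  "(real measure \<Rightarrow> 'w measure) \<Rightarrow> real measure set \<Rightarrow> (nat \<Rightarrow> real \<Rightarrow> 'w \<Rightarrow> real set) \<Rightarrow> real \<Rightarrow> bool" where
  "asymp_posthoc_ci M \<Q> H \<mu> \<longleftrightarrow>
     (SUP P\<in>\<Q>. limsup (\<lambda>n. posthoc_risk (M P) (H n) \<mu>)) \<le> 1"

definition uniform_asymp_posthoc_ci ::
  "(real measure \<Rightarrow> 'w measure) \<Rightarrow> real measure set \<Rightarrow> (nat \<Rightarrow> real \<Rightarrow> 'w \<Rightarrow> real set) \<Rightarrow> real \<Rightarrow> bool" where
  "uniform_asymp_posthoc_ci M \<Q> H \<mu> \<longleftrightarrow>
     limsup (\<lambda>n. SUP P\<in>\<Q>. posthoc_risk (M P) (H n) \<mu>) \<le> 1"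

definition sample_mean :: "(nat \<Rightarrow> 'w \<Rightarrow> real) \<Rightarrow> nat \<Rightarrow> 'w \<Rightarrow> real" where
  "sample_mean X n \<omega> = (\<Sum>i<n. X i \<omega>) / n"

definition sample_sd :: "(nat \<Rightarrow> 'w \<Rightarrow> real) \<Rightarrow> nat \<Rightarrow> 'w \<Rightarrow> real" where
  "sample_sd X n \<omega> = sqrt ((\<Sum>i<n. (X i \<omega> - sample_mean X n \<omega>)\<^sup>2) / n)"

definition A_IWR :: "nat \<Rightarrow> real \<Rightarrow> real \<Rightarrow> real" where
  "A_IWR n \<alpha> l = (ln (2 / \<alpha>) + l\<^sup>2 / 2) / (l * sqrt n)"

definition W_IWR :: "(nat \<Rightarrow> 'w \<Rightarrow> real) \<Rightarrow> real \<Rightarrow> nat \<Rightarrow> real \<Rightarrow> 'w \<Rightarrow> real" where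
  "W_IWR X l n \<alpha> \<omega> = A_IWR n \<alpha> l * sample_sd X n \<omega> / sqrt (1 - (A_IWR n \<alpha> l)\<^sup>2)"

text \<open>For large \<open>\<alpha>\<close> the half-width may be nonpositive; the interval is then empty.\<close>

definition H_IWR :: "(nat \<Rightarrow> 'w \<Rightarrow> real) \<Rightarrow> real \<Rightarrow> nat \<Rightarrow> real \<Rightarrow> 'w \<Rightarrow> real set" where
  "H_IWR X l n \<alpha> \<omega> =
     (if real n > (ln (2 / \<alpha>) / l + l / 2)\<^sup>2
      then {sample_mean X n \<omega> - W_IWR X l n \<alpha> \<omega> <..< sample_mean X n \<omega> + W_IWR X l n \<alpha> \<omega>}
      else UNIV)"

end

theory Submission
  imports Defs "HOL-Real_Asymp.Real_Asymp"
begin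

text \<open>
  Put \<open>Z i = (X i - \<mu>) / \<sigma>\<close> for some scale \<open>\<sigma> > 0\<close>, \<open>S = \<Sum>i<n. Z i\<close> and \<open>V\<^sup>2 = \<Sum>i<n. (Z i)\<^sup>2\<close>.  The
  half-width is built so that, when \<open>V > 0\<close>, the interval can miss \<open>\<mu>\<close> at level \<open>\<alpha>\<close> only if
  \<open>1/\<alpha> \<le> exp (l \<bar>S\<bar>/V - l\<^sup>2/2) / 2\<close>; the supremum over \<open>\<alpha>\<close> therefore costs nothing
  (\<open>inverse_level_le\<close>), and the claim becomes \<open>limsup E exp (l \<bar>S\<bar>/V) \<le> 2 exp (l\<^sup>2/2)\<close>, uniformly
  over the class.  If \<open>V = 0\<close>, which has positive probability when the law has an atom at \<open>\<mu>\<close>, the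
  inverse level is only bounded by a multiple of \<open>exp (l \<surd>n)\<close>; the convention in
  \<open>self_normalised_exp\<close> covers this case.

  Everything rests on one condition on the centred law: with \<open>L v\<close> the second moment truncated at
  \<open>v\<close> and \<open>J v\<close> the first absolute moment beyond \<open>v\<close>, \<open>v J v / L v \<rightarrow> 0\<close> as \<open>v \<rightarrow> \<infinity>\<close>, uniformly over
  the class, with \<open>L\<close> eventually bounded away from zero (\<open>uniformly_small_tails\<close>).  Under this
  condition \<open>self_normalised_exp_limit_le\<close> bounds the exponential moment directly, with no limit
  theorem for \<open>S/V\<close>.  Choose \<open>b\<close> with \<open>n L b = b\<^sup>2\<close> and split according to the size of \<open>V\<close>.

  \<^item> For \<open>V \<ge> b/r\<close>, with \<open>r\<close> slightly above 1, cut the observations at \<open>b\<close>.  By Cauchy-Schwarz the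
    \<open>m\<close> observations beyond \<open>b\<close> contribute at most \<open>\<surd>m \<le> m\<close> to \<open>\<bar>S\<bar>/V\<close>, and the
    exponential moments of \<open>m\<close> tend to one; the bounded ones contribute at most \<open>r/b\<close> times the absolute
    value of their sum, whose exponential moment, computed factor by factor, is close to \<open>exp (l\<^sup>2/2)\<close>
    for either sign.
  \<^item> On a dyadic shell \<open>v/2 < V \<le> v\<close> below \<open>b/r\<close>, no observation exceeds \<open>v\<close> in absolute value, so
    truncation is free, and a penalty \<open>exp (K (1 - V\<^sup>2/v\<^sup>2)) \<ge> 1\<close> may be inserted.  The factors then produce
    \<open>exp (K - (K - C - 1) n L v / v\<^sup>2)\<close>, where \<open>n L v / v\<^sup>2 \<ge> r > 1\<close> at least doubles from one
    shell to the next one inside it, so that the sum over the shells is as small as desired for \<open>K\<close>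
    large.
  \<^item> For \<open>V\<close> below a constant, the trivial bound \<open>\<bar>S\<bar>/V \<le> \<surd>n\<close> meets an exponentially small
    probability.

  The condition holds for a class with bounded skew, standardised to variance one, by Markov's
  inequality (\<open>bounded_skew_imp_small_tails\<close>).  For a single law in \<open>DAN \<mu>\<close> it is a converse to the
  central limit theorem (\<open>DAN_imp_small_tails\<close>).  With \<open>\<phi>\<close> the characteristic function of the
  centred law, convergence to the normal law gives \<open>\<bar>\<phi> (t / a n)\<bar> ^ n \<rightarrow> exp (- t\<^sup>2/2)\<close>, uniformly for
  bounded \<open>t\<close>.  Since the mean is zero, the imaginary part of \<open>\<phi>\<close> is negligible and
  \<open>n E (1 - cos (t X / a n)) \<rightarrow> t\<^sup>2/2\<close>.  The limit is exactly quadratic in \<open>t\<close>, so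
  \<open>n E (1 - cos (t X / a n))\<^sup>2 \<rightarrow> 0\<close>, which bounds the tail probability; comparing with
  \<open>U v = E min (v\<^sup>2) (X\<^sup>2)\<close> gives \<open>v\<^sup>2 P (\<bar>X\<bar> > v) / U v \<rightarrow> 0\<close>, first along the norming constants and
  then for all \<open>v\<close> because \<open>U v / v\<^sup>2\<close> is decreasing.  Doubling \<open>v\<close> repeatedly turns this into the
  condition on \<open>J\<close>.
\<close>

section \<open>Truncated moments of a centred law\<close>

definition truncated_second_moment :: "real measure \<Rightarrow> real \<Rightarrow> real" where
  "truncated_second_moment Q v = (\<integral>x. (if \<bar>x\<bar> \<le> v then x\<^sup>2 else 0) \<partial>Q)"

definition tail_first_moment :: "real measure \<Rightarrow> real \<Rightarrow> real" where
  "tail_first_moment Q v = (\<integral>x. (if \<bar>x\<bar> \<le> v then 0 else \<bar>x\<bar>) \<partial>Q)"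

locale centred_law = real_distribution Q for Q :: "real measure" +
  assumes integrable_id: "integrable Q (\<lambda>x. x)" and mean_zero: "(\<integral>x. x \<partial>Q) = 0"
begin

abbreviation "L \<equiv> truncated_second_moment Q"
abbreviation "J \<equiv> tail_first_moment Q"

lemma integrable_truncated_square: "integrable Q (\<lambda>x. if \<bar>x\<bar> \<le> v then x\<^sup>2 else 0)"
proof (rule integrable_const_bound[where B = "v\<^sup>2"])
  have "norm (if \<bar>x\<bar> \<le> v then x\<^sup>2 else 0) \<le> v\<^sup>2" for x :: real
    using abs_le_square_iff[of x v] by auto
  then show "AE x in Q. norm (if \<bar>x\<bar> \<le> v then x\<^sup>2 else 0) \<le> v\<^sup>2" by simp
qed simp

lemma integrable_tail_abs: "integrable Q (\<lambda>x. if \<bar>x\<bar> \<le> v then 0 else \<bar>x\<bar>)"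
  by (rule Bochner_Integration.integrable_bound[OF integrable_id]) (auto intro!: AE_I2)

lemma integrable_truncated_id: "integrable Q (\<lambda>x. if \<bar>x\<bar> \<le> v then x else 0)"
  by (rule Bochner_Integration.integrable_bound[OF integrable_id]) (auto intro!: AE_I2)

lemma integrable_tail_indicator: "integrable Q (\<lambda>x. if \<bar>x\<bar> \<le> v then 0 else 1 :: real)"
  by (rule integrable_const_bound[where B = 1]) (auto intro!: AE_I2)

lemma L_nonneg: "0 \<le> L v"
  unfolding truncated_second_moment_def by (rule integral_nonneg_AE) auto

lemma J_nonneg: "0 \<le> J v"
  unfolding tail_first_moment_def by (rule integral_nonneg_AE) auto

lemma L_mono: "u \<le> v \<Longrightarrow> L u \<le> L v"
  unfolding truncated_second_moment_def
  by (rule integral_mono[OF integrable_truncated_square integrable_truncated_square]) auto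

lemma L_le: "0 \<le> v \<Longrightarrow> L v \<le> v * (\<integral>x. \<bar>x\<bar> \<partial>Q)"
proof -
  assume v: "0 \<le> v"
  have "(if \<bar>x\<bar> \<le> v then x\<^sup>2 else 0) \<le> v * \<bar>x\<bar>" for x :: real
    using v mult_right_mono[of "\<bar>x\<bar>" v "\<bar>x\<bar>"] by (auto simp: power2_eq_square)
  then have "L v \<le> (\<integral>x. v * \<bar>x\<bar> \<partial>Q)"
    unfolding truncated_second_moment_def
    using integrable_id by (intro integral_mono[OF integrable_truncated_square]) auto
  then show ?thesis by simp
qed

lemma tail_prob_le: "0 < v \<Longrightarrow> (\<integral>x. (if \<bar>x\<bar> \<le> v then 0 else 1) \<partial>Q) \<le> J v / v"
proof -
  assume v: "0 < v"
  have "(\<integral>x. (if \<bar>x\<bar> \<le> v then 0 else 1) \<partial>Q) \<le> (\<integral>x. (if \<bar>x\<bar> \<le> v then 0 else \<bar>x\<bar>) / v \<partial>Q)"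
    using integrable_tail_abs v
    by (intro integral_mono[OF integrable_tail_indicator]) (auto simp: field_simps)
  then show ?thesis by (simp add: tail_first_moment_def)
qed

text \<open>Since the mean vanishes, the mean of the truncated variable is minus the mean of the removed tail.\<close>

lemma truncated_mean_le: "\<bar>\<integral>x. (if \<bar>x\<bar> \<le> v then x else 0) \<partial>Q\<bar> \<le> J v"
proof -
  have "(\<integral>x. (if \<bar>x\<bar> \<le> v then x else 0) \<partial>Q) = (\<integral>x. x - (if \<bar>x\<bar> \<le> v then 0 else x) \<partial>Q)"
    by (rule Bochner_Integration.integral_cong) auto
  also have "\<dots> = - (\<integral>x. (if \<bar>x\<bar> \<le> v then 0 else x) \<partial>Q)"
  proof -
    have "integrable Q (\<lambda>x. if \<bar>x\<bar> \<le> v then 0 else x)"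
      by (rule Bochner_Integration.integrable_bound[OF integrable_id]) (auto intro!: AE_I2)
    then show ?thesis using integrable_id mean_zero by simp
  qed
  finally have "\<bar>\<integral>x. (if \<bar>x\<bar> \<le> v then x else 0) \<partial>Q\<bar> = \<bar>\<integral>x. (if \<bar>x\<bar> \<le> v then 0 else x) \<partial>Q\<bar>" by simp
  also have "\<dots> \<le> (\<integral>x. \<bar>if \<bar>x\<bar> \<le> v then 0 else x\<bar> \<partial>Q)" by (rule integral_abs_bound)
  also have "\<dots> = J v" unfolding tail_first_moment_def
    by (rule Bochner_Integration.integral_cong) auto
  finally show ?thesis .
qed

lemma integrable_band_square: "integrable Q (\<lambda>x. if u < \<bar>x\<bar> \<and> \<bar>x\<bar> \<le> v then x\<^sup>2 else 0)"
  by (rule Bochner_Integration.integrable_bound[OF integrable_truncated_square[of v]]) (auto intro!: AE_I2)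

lemma band_square_le:
  assumes "0 \<le> v"
  shows "(\<integral>x. (if u < \<bar>x\<bar> \<and> \<bar>x\<bar> \<le> v then x\<^sup>2 else 0) \<partial>Q) \<le> v * J u"
proof -
  have "(if u < \<bar>x\<bar> \<and> \<bar>x\<bar> \<le> v then x\<^sup>2 else 0) \<le> v * (if \<bar>x\<bar> \<le> u then 0 else \<bar>x\<bar>)" for x :: real
    using assms mult_right_mono[of "\<bar>x\<bar>" v "\<bar>x\<bar>"] by (auto simp: power2_eq_square)
  then have "(\<integral>x. (if u < \<bar>x\<bar> \<and> \<bar>x\<bar> \<le> v then x\<^sup>2 else 0) \<partial>Q)
      \<le> (\<integral>x. v * (if \<bar>x\<bar> \<le> u then 0 else \<bar>x\<bar>) \<partial>Q)"
    using integrable_tail_abs by (intro integral_mono[OF integrable_band_square]) auto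
  then show ?thesis by (simp add: tail_first_moment_def)
qed

lemma L_diff_le:
  assumes "0 \<le> v" "u \<le> v"
  shows "L v - L u \<le> v * J u"
proof -
  have "L v - L u = (\<integral>x. (if \<bar>x\<bar> \<le> v then x\<^sup>2 else 0) - (if \<bar>x\<bar> \<le> u then x\<^sup>2 else 0) \<partial>Q)"
    unfolding truncated_second_moment_def
    by (rule Bochner_Integration.integral_diff[symmetric]) (rule integrable_truncated_square)+
  also have "\<dots> = (\<integral>x. (if u < \<bar>x\<bar> \<and> \<bar>x\<bar> \<le> v then x\<^sup>2 else 0) \<partial>Q)"
    using assms by (intro Bochner_Integration.integral_cong) auto
  finally show ?thesis using band_square_le[of v u] assms by simp
qed

text \<open>The largest \<open>b\<close> with \<open>b\<^sup>2 \<le> n L b\<close> works: it exists because \<open>L b\<close> grows at most linearly, and beyond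
  it the opposite inequality holds.  As \<open>L\<close> is monotone and may jump only upwards, both inequalities
  survive the passage to the limit, so equality holds although \<open>L\<close> need not be continuous.\<close>

lemma ex_norming_constant:
  assumes "0 < c" "c\<^sup>2 \<le> real n * L c"
  shows "\<exists>b\<ge>c. real n * L b = b\<^sup>2"
proof -
  define B where "B = {b. c \<le> b \<and> b\<^sup>2 \<le> real n * L b}"
  define m where "m = (\<integral>x. \<bar>x\<bar> \<partial>Q)"
  have bound: "b \<le> real n * m" if "b \<in> B" for b
  proof -
    have b: "0 < b" "b\<^sup>2 \<le> real n * L b" using that assms by (auto simp: B_def)
    have "real n * L b \<le> real n * (b * m)"
      using L_le[of b] b by (intro mult_left_mono) (auto simp: m_def)
    with b(2) have "b\<^sup>2 \<le> real n * (b * m)" by (rule order_trans)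
    then have "b * b \<le> b * (real n * m)" by (simp add: power2_eq_square mult.left_commute)
    with b(1) show ?thesis by (simp only: mult_le_cancel_left_pos)
  qed
  have cB: "c \<in> B" using assms by (auto simp: B_def)
  have bdd: "bdd_above B" using bound by (auto simp: bdd_above_def)
  define b where "b = Sup B"
  have cb: "c \<le> b" unfolding b_def using cB bdd by (rule cSup_upper)
  have "b\<^sup>2 \<le> real n * L b"
  proof (rule field_le_mult_one_interval)
    fix z :: real assume z: "0 < z" "z < 1"
    have "sqrt z * b < b" using z cb assms by simp
    then obtain y where y: "y \<in> B" "sqrt z * b < y"
      unfolding b_def using less_cSupD[of B] cB by blast
    have "y \<le> b" unfolding b_def using y(1) bdd by (rule cSup_upper)
    have "z * b\<^sup>2 = (sqrt z * b)\<^sup>2" using z by (simp add: power_mult_distrib)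
    also have "\<dots> \<le> y\<^sup>2" using y z cb assms by (intro power_mono) auto
    also have "\<dots> \<le> real n * L y" using y by (auto simp: B_def)
    also have "\<dots> \<le> real n * L b" using L_mono[OF \<open>y \<le> b\<close>] by (intro mult_left_mono) auto
    finally show "z * b\<^sup>2 \<le> real n * L b" .
  qed
  moreover have "real n * L b \<le> b\<^sup>2"
  proof (rule field_le_mult_one_interval)
    fix z :: real assume z: "0 < z" "z < 1"
    define y where "y = b / sqrt z"
    have "b < y" unfolding y_def using z cb assms by (simp add: field_simps)
    then have "y \<notin> B" using cSup_upper[of y B] bdd by (auto simp: b_def)
    then have "real n * L y < y\<^sup>2" using \<open>b < y\<close> cb by (auto simp: B_def)
    moreover have "real n * L b \<le> real n * L y" using L_mono[of b y] \<open>b < y\<close> by (intro mult_left_mono) auto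
    ultimately have "real n * L b \<le> b\<^sup>2 / z" using z by (simp add: y_def power_divide)
    then show "z * (real n * L b) \<le> b\<^sup>2" using z by (simp add: field_simps)
  qed
  ultimately show ?thesis using cb by auto
qed

end

section \<open>Exponential moments of independent sums\<close>

lemma exp_le_quadratic: "exp z \<le> 1 + z + z\<^sup>2 / 2 * exp \<bar>z\<bar>" for z :: real
proof -
  obtain t where t: "\<bar>t\<bar> \<le> \<bar>z\<bar>" "exp z = (\<Sum>m<2. z ^ m / fact m) + exp t / fact 2 * z ^ 2"
    using Maclaurin_exp_le[of z 2] by blast
  have "exp t * z\<^sup>2 \<le> exp \<bar>z\<bar> * z\<^sup>2" using t(1) by (intro mult_right_mono) auto
  then show ?thesis using t(2) by (simp add: numeral_2_eq_2 mult.commute mult.left_commute)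
qed

lemma iid_prod_nn_integral:
  assumes "iid_with_law M X Q" and [measurable]: "f \<in> borel_measurable borel"
  shows "(\<integral>\<^sup>+\<omega>. (\<Prod>i<n. ennreal (f (X i \<omega>))) \<partial>M) = (\<integral>\<^sup>+x. ennreal (f x) \<partial>Q) ^ n"
proof -
  interpret prob_space M using assms(1) by (simp add: iid_with_law_def)
  have ind: "indep_vars (\<lambda>_. borel) X UNIV" and law: "\<And>i. distr M borel (X i) = Q"
    using assms(1) by (auto simp: iid_with_law_def)
  have [measurable]: "X i \<in> borel_measurable M" for i
    using ind by (auto simp: indep_vars_def)
  have "indep_vars (\<lambda>_. borel) X {..<n}" by (rule indep_vars_subset[OF ind]) simp
  then have "indep_vars (\<lambda>_. borel) (\<lambda>i. (\<lambda>x. ennreal (f x)) \<circ> X i) {..<n}"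
    by (rule indep_vars_compose) simp
  then have "indep_vars (\<lambda>_. borel) (\<lambda>i \<omega>. ennreal (f (X i \<omega>))) {..<n}"
    by (simp add: comp_def)
  then have "(\<integral>\<^sup>+\<omega>. (\<Prod>i<n. ennreal (f (X i \<omega>))) \<partial>M) = (\<Prod>i<n. \<integral>\<^sup>+\<omega>. ennreal (f (X i \<omega>)) \<partial>M)"
    by (intro indep_vars_nn_integral) auto
  also have "\<dots> = (\<Prod>i<n. \<integral>\<^sup>+x. ennreal (f x) \<partial>Q)"
  proof (rule prod.cong[OF refl])
    show "(\<integral>\<^sup>+\<omega>. ennreal (f (X i \<omega>)) \<partial>M) = (\<integral>\<^sup>+x. ennreal (f x) \<partial>Q)" for i
      unfolding law[of i, symmetric] by (subst nn_integral_distr) auto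
  qed
  finally show ?thesis by simp
qed

lemma integral_combination:
  fixes f\<^sub>1 f\<^sub>2 f\<^sub>3 f\<^sub>4 :: "'a \<Rightarrow> real"
  assumes "integrable M f\<^sub>1" "integrable M f\<^sub>2" "integrable M f\<^sub>3" "integrable M f\<^sub>4"
  shows "(\<integral>x. c\<^sub>1 * f\<^sub>1 x + c\<^sub>2 * f\<^sub>2 x + c\<^sub>3 * f\<^sub>3 x + c\<^sub>4 * f\<^sub>4 x \<partial>M) =
    c\<^sub>1 * (\<integral>x. f\<^sub>1 x \<partial>M) + c\<^sub>2 * (\<integral>x. f\<^sub>2 x \<partial>M) + c\<^sub>3 * (\<integral>x. f\<^sub>3 x \<partial>M) + c\<^sub>4 * (\<integral>x. f\<^sub>4 x \<partial>M)"
  using assms by simp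

text \<open>The expectation factorises, and a factor \<open>1 + h\<close> integrates to at most \<open>exp (\<integral>h)\<close>.\<close>

lemma (in real_distribution) iid_exp_sum_le:
  assumes "iid_with_law N X M" and [measurable]: "f \<in> borel_measurable borel"
    and h: "integrable M h" and le: "\<And>x. exp (f x) \<le> 1 + h x"
  shows "(\<integral>\<^sup>+\<omega>. ennreal (exp (\<Sum>i<n. f (X i \<omega>))) \<partial>N) \<le> ennreal (exp (real n * (\<integral>x. h x \<partial>M)))"
proof -
  have nonneg: "0 \<le> 1 + h x" for x using le[of x] order_trans[OF exp_ge_zero] by blast
  have "(\<integral>\<^sup>+x. ennreal (exp (f x)) \<partial>M) \<le> (\<integral>\<^sup>+x. ennreal (1 + h x) \<partial>M)"
    using le by (intro nn_integral_mono ennreal_leI) auto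
  also have "\<dots> = ennreal (\<integral>x. 1 + h x \<partial>M)"
    using h nonneg by (intro nn_integral_eq_integral) auto
  also have "(\<integral>x. 1 + h x \<partial>M) = 1 + (\<integral>x. h x \<partial>M)" using h prob_space by simp
  also have "ennreal \<dots> \<le> ennreal (exp (\<integral>x. h x \<partial>M))" by (intro ennreal_leI exp_ge_add_one_self)
  finally have le1: "(\<integral>\<^sup>+x. ennreal (exp (f x)) \<partial>M) \<le> ennreal (exp (\<integral>x. h x \<partial>M))" .
  have "(\<integral>\<^sup>+\<omega>. ennreal (exp (\<Sum>i<n. f (X i \<omega>))) \<partial>N) = (\<integral>\<^sup>+\<omega>. (\<Prod>i<n. ennreal (exp (f (X i \<omega>)))) \<partial>N)"
    by (simp add: exp_sum prod_ennreal)
  also have "\<dots> = (\<integral>\<^sup>+x. ennreal (exp (f x)) \<partial>M) ^ n"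
    using assms(1) by (rule iid_prod_nn_integral) measurable
  also have "\<dots> \<le> ennreal (exp (\<integral>x. h x \<partial>M)) ^ n" by (intro power_mono le1) simp
  also have "\<dots> = ennreal (exp (real n * (\<integral>x. h x \<partial>M)))"
    by (simp add: ennreal_power exp_of_nat_mult[symmetric])
  finally show ?thesis .
qed

context centred_law begin

text \<open>All exponential moments below come from this estimate.  Up to \<open>v\<close> the exponential of \<open>f\<close> is compared
  with a quadratic polynomial in \<open>x / v\<close>, a coarser constant \<open>D\<close> being allowed on the band between
  \<open>\<tau> v\<close> and \<open>v\<close>, and a constant beyond \<open>v\<close>.  The small-tail hypotheses at \<open>v\<close> and \<open>\<tau> v\<close> make the linear
  term, the band and the outer part negligible against \<open>L v / v\<^sup>2\<close>, so that only the coefficient \<open>a\<close> of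
  the quadratic term remains in the limit.\<close>

lemma iid_truncated_mgf_le:
  assumes iid: "iid_with_law N X Q" and [measurable]: "f \<in> borel_measurable borel"
    and v: "0 < v" and D: "0 \<le> D" and d: "0 \<le> d" and \<tau>: "0 < \<tau>" "\<tau> \<le> 1"
    and inner: "\<And>x. \<bar>x\<bar> \<le> v \<Longrightarrow>
      exp (f x) \<le> 1 + \<theta> * (x / v) + a * (x / v)\<^sup>2 + (if \<tau> * v < \<bar>x\<bar> then D * (x / v)\<^sup>2 else 0)"
    and outer: "\<And>x. \<not> \<bar>x\<bar> \<le> v \<Longrightarrow> exp (f x) \<le> 1 + d"
    and small: "v * J v \<le> \<epsilon> * L v" "\<tau> * v * J (\<tau> * v) \<le> \<epsilon> * L (\<tau> * v)" and \<epsilon>: "0 \<le> \<epsilon>"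
  shows "(\<integral>\<^sup>+\<omega>. ennreal (exp (\<Sum>i<n. f (X i \<omega>))) \<partial>N)
    \<le> ennreal (exp (real n * L v / v\<^sup>2 * (a + \<epsilon> * (\<bar>\<theta>\<bar> + d + D / \<tau>))))"
proof -
  let ?i = "\<lambda>x. if \<bar>x\<bar> \<le> v then x else 0" and ?s = "\<lambda>x. if \<bar>x\<bar> \<le> v then x\<^sup>2 else 0"
    and ?b = "\<lambda>x. if \<tau> * v < \<bar>x\<bar> \<and> \<bar>x\<bar> \<le> v then x\<^sup>2 else 0" and ?t = "\<lambda>x. if \<bar>x\<bar> \<le> v then 0 else 1 :: real"
  define h where "h x = \<theta> / v * ?i x + a / v\<^sup>2 * ?s x + D / v\<^sup>2 * ?b x + d * ?t x" for x :: real
  note ints = integrable_truncated_id[of v] integrable_truncated_square[of v]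
    integrable_band_square[of "\<tau> * v" v] integrable_tail_indicator[of v]
  have h: "integrable Q h"
    unfolding h_def by (intro Bochner_Integration.integrable_add integrable_mult_right ints)
  have le: "exp (f x) \<le> 1 + h x" for x
    using inner[of x] outer[of x] by (auto simp: h_def power_divide)
  have "(\<integral>x. h x \<partial>Q) = \<theta> / v * (\<integral>x. ?i x \<partial>Q) + a / v\<^sup>2 * L v + D / v\<^sup>2 * (\<integral>x. ?b x \<partial>Q) + d * (\<integral>x. ?t x \<partial>Q)"
    unfolding h_def truncated_second_moment_def
    by (rule integral_combination[OF ints])
  also have "\<dots> \<le> \<bar>\<theta>\<bar> / v * J v + a / v\<^sup>2 * L v + D / v\<^sup>2 * (v * J (\<tau> * v)) + d * (J v / v)"
  proof (intro add_mono order_refl)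
    have "\<theta> / v * (\<integral>x. ?i x \<partial>Q) \<le> \<bar>\<theta> / v\<bar> * \<bar>\<integral>x. ?i x \<partial>Q\<bar>" by (rule order_trans[OF abs_ge_self]) (simp add: abs_mult)
    also have "\<dots> \<le> \<bar>\<theta>\<bar> / v * J v"
      using truncated_mean_le[of v] v by (intro mult_mono) auto
    finally show "\<theta> / v * (\<integral>x. ?i x \<partial>Q) \<le> \<bar>\<theta>\<bar> / v * J v" .
  next
    show "D / v\<^sup>2 * (\<integral>x. ?b x \<partial>Q) \<le> D / v\<^sup>2 * (v * J (\<tau> * v))"
      using v D by (intro mult_left_mono band_square_le) auto
    show "d * (\<integral>x. ?t x \<partial>Q) \<le> d * (J v / v)"
      using d v by (intro mult_left_mono tail_prob_le) auto
  qed
  also have "\<dots> \<le> L v / v\<^sup>2 * (a + \<epsilon> * (\<bar>\<theta>\<bar> + d + D / \<tau>))"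
  proof -
    have J: "J v / v \<le> \<epsilon> * L v / v\<^sup>2"
      using small(1) v by (simp add: field_simps power2_eq_square)
    have "\<tau> * v * J (\<tau> * v) \<le> \<epsilon> * L v"
      using small(2) mult_left_mono[OF L_mono[of "\<tau> * v" v] \<epsilon>] v \<tau> by simp
    then have J\<tau>: "J (\<tau> * v) / v \<le> \<epsilon> * L v / v\<^sup>2 / \<tau>"
      using v \<tau> by (simp add: field_simps power2_eq_square)
    have "\<bar>\<theta>\<bar> / v * J v + a / v\<^sup>2 * L v + D / v\<^sup>2 * (v * J (\<tau> * v)) + d * (J v / v)
      = (\<bar>\<theta>\<bar> + d) * (J v / v) + a * L v / v\<^sup>2 + D * (J (\<tau> * v) / v)"
    proof -
      have "D / v\<^sup>2 * (v * J (\<tau> * v)) = D * (J (\<tau> * v) / v)" using v by (simp add: power2_eq_square)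
      moreover have "\<bar>\<theta>\<bar> / v * J v = \<bar>\<theta>\<bar> * (J v / v)" by simp
      moreover have "a / v\<^sup>2 * L v = a * L v / v\<^sup>2" by simp
      ultimately show ?thesis by (simp only: distrib_right)
    qed
    also have "\<dots> \<le> (\<bar>\<theta>\<bar> + d) * (\<epsilon> * L v / v\<^sup>2) + a * L v / v\<^sup>2 + D * (\<epsilon> * L v / v\<^sup>2 / \<tau>)"
      using d D by (intro add_mono mult_left_mono J J\<tau> order_refl) auto
    also have "\<dots> = L v / v\<^sup>2 * (a + \<epsilon> * (\<bar>\<theta>\<bar> + d + D / \<tau>))"
      by (simp add: algebra_simps add_divide_distrib)
    finally show ?thesis .
  qed
  finally have "real n * (\<integral>x. h x \<partial>Q) \<le> real n * (L v / v\<^sup>2 * (a + \<epsilon> * (\<bar>\<theta>\<bar> + d + D / \<tau>)))"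
    by (intro mult_left_mono) auto
  then have "ennreal (exp (real n * (\<integral>x. h x \<partial>Q))) \<le> ennreal (exp (real n * L v / v\<^sup>2 * (a + \<epsilon> * (\<bar>\<theta>\<bar> + d + D / \<tau>))))"
    by (intro ennreal_leI) (simp add: mult.assoc)
  with iid_exp_sum_le[OF iid _ h le, of n] show ?thesis by (auto intro: order_trans)
qed

end

context centred_law begin

text \<open>At the norming constant the quadratic coefficient is \<open>\<theta>\<^sup>2/2\<close> up to the factor \<open>r\<close>, because
  \<open>exp \<bar>\<theta> y\<bar> \<le> r\<close> for \<open>\<bar>y\<bar> \<le> \<tau>\<close>: this is the exponential moment of a standard normal variable in the limit.\<close>

lemma typical_region_mgf_le:
  assumes iid: "iid_with_law N X Q" and b: "0 < b" "real n * L b = b\<^sup>2"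
    and \<tau>: "0 < \<tau>" "\<tau> \<le> 1" "exp (\<bar>\<theta>\<bar> * \<tau>) \<le> r"
    and small: "b * J b \<le> \<epsilon> * L b" "\<tau> * b * J (\<tau> * b) \<le> \<epsilon> * L (\<tau> * b)" and \<epsilon>: "0 \<le> \<epsilon>"
  shows "(\<integral>\<^sup>+\<omega>. ennreal (exp (\<Sum>i<n. if \<bar>X i \<omega>\<bar> \<le> b then \<theta> * (X i \<omega> / b) else l)) \<partial>N)
    \<le> ennreal (exp (\<theta>\<^sup>2 / 2 * r + \<epsilon> * (\<bar>\<theta>\<bar> + exp l + \<theta>\<^sup>2 / 2 * exp \<bar>\<theta>\<bar> / \<tau>)))"
proof -
  let ?f = "\<lambda>x. if \<bar>x\<bar> \<le> b then \<theta> * (x / b) else l"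
  have inner: "exp (?f x) \<le> 1 + \<theta> * (x / b) + \<theta>\<^sup>2 / 2 * r * (x / b)\<^sup>2
      + (if \<tau> * b < \<bar>x\<bar> then \<theta>\<^sup>2 / 2 * exp \<bar>\<theta>\<bar> * (x / b)\<^sup>2 else 0)" if x: "\<bar>x\<bar> \<le> b" for x
  proof -
    define y where "y = x / b"
    have y: "\<bar>y\<bar> \<le> 1" using x b by (simp add: y_def)
    have "1 \<le> r" using \<tau> by (smt (verit) mult_nonneg_nonneg one_le_exp_iff)
    have e: "exp (\<theta> * y) \<le> 1 + \<theta> * y + \<theta>\<^sup>2 / 2 * y\<^sup>2 * exp \<bar>\<theta> * y\<bar>"
      using exp_le_quadratic[of "\<theta> * y"] by (simp add: power_mult_distrib)
    show ?thesis
    proof (cases "\<tau> * b < \<bar>x\<bar>")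
      case True
      have "\<theta>\<^sup>2 / 2 * y\<^sup>2 * exp \<bar>\<theta> * y\<bar> \<le> \<theta>\<^sup>2 / 2 * y\<^sup>2 * exp \<bar>\<theta>\<bar>"
        using y mult_left_mono[of "\<bar>y\<bar>" 1 "\<bar>\<theta>\<bar>"] by (intro mult_left_mono) (auto simp: abs_mult)
      moreover have "0 \<le> \<theta>\<^sup>2 / 2 * r * y\<^sup>2" using \<open>1 \<le> r\<close> by simp
      ultimately show ?thesis using e x True by (simp add: y_def[symmetric] mult_ac)
    next
      case False
      then have "\<bar>y\<bar> \<le> \<tau>" using b by (simp add: y_def field_simps)
      then have "exp \<bar>\<theta> * y\<bar> \<le> exp (\<bar>\<theta>\<bar> * \<tau>)" by (auto simp: abs_mult intro: mult_left_mono)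
      then have "exp \<bar>\<theta> * y\<bar> \<le> r" using \<tau>(3) by (rule order_trans)
      then have "\<theta>\<^sup>2 / 2 * y\<^sup>2 * exp \<bar>\<theta> * y\<bar> \<le> \<theta>\<^sup>2 / 2 * y\<^sup>2 * r"
        by (intro mult_left_mono) auto
      then show ?thesis using e x False by (simp add: y_def[symmetric] mult_ac)
    qed
  qed
  have "(\<integral>\<^sup>+\<omega>. ennreal (exp (\<Sum>i<n. ?f (X i \<omega>))) \<partial>N)
    \<le> ennreal (exp (real n * L b / b\<^sup>2 * (\<theta>\<^sup>2 / 2 * r + \<epsilon> * (\<bar>\<theta>\<bar> + exp l + \<theta>\<^sup>2 / 2 * exp \<bar>\<theta>\<bar> / \<tau>))))"
    using iid _ b(1) _ _ \<tau>(1,2) inner _ small \<epsilon>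
    by (rule iid_truncated_mgf_le) auto
  then show ?thesis using b by simp
qed

text \<open>The penalty \<open>K y\<^sup>2\<close> turns the quadratic coefficient into \<open>C - K\<close> with \<open>C\<close> depending on \<open>\<theta>\<close> only.  This
  needs \<open>\<bar>y\<bar> \<le> 1/K\<close>, where the exponent stays bounded; for larger \<open>\<bar>y\<bar>\<close> the coefficient of the band,
  which grows with \<open>K\<close>, takes over.\<close>

lemma shell_mgf_le:
  fixes \<theta> K :: real
  defines "C \<equiv> (\<bar>\<theta>\<bar> + 1)\<^sup>2 / 2 * exp (\<bar>\<theta>\<bar> + 1)"
  assumes iid: "iid_with_law N X Q" and v: "0 < v" and K: "1 \<le> K"
    and small: "v * J v \<le> \<epsilon> * L v" "1 / K * v * J (1 / K * v) \<le> \<epsilon> * L (1 / K * v)" and \<epsilon>: "0 \<le> \<epsilon>"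
  shows "(\<integral>\<^sup>+\<omega>. ennreal (exp (\<Sum>i<n. if \<bar>X i \<omega>\<bar> \<le> v then \<theta> * (X i \<omega> / v) - K * (X i \<omega> / v)\<^sup>2 else 0)) \<partial>N)
    \<le> ennreal (exp (real n * L v / v\<^sup>2 * (C - K + \<epsilon> * (\<bar>\<theta>\<bar> + K ^ 3 * (exp \<bar>\<theta>\<bar> + \<bar>\<theta>\<bar> + K)))))"
proof -
  let ?f = "\<lambda>x. if \<bar>x\<bar> \<le> v then \<theta> * (x / v) - K * (x / v)\<^sup>2 else 0"
  let ?D = "K\<^sup>2 * (exp \<bar>\<theta>\<bar> + \<bar>\<theta>\<bar> + K)"
  have C: "0 \<le> C" by (simp add: C_def)
  have inner: "exp (?f x) \<le> 1 + \<theta> * (x / v) + (C - K) * (x / v)\<^sup>2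
      + (if 1 / K * v < \<bar>x\<bar> then ?D * (x / v)\<^sup>2 else 0)" if x: "\<bar>x\<bar> \<le> v" for x
  proof -
    define y where "y = x / v"
    have y: "\<bar>y\<bar> \<le> 1" using x v by (simp add: y_def)
    define z where "z = \<theta> * y - K * y\<^sup>2"
    show ?thesis
    proof (cases "1 / K * v < \<bar>x\<bar>")
      case True
      then have "1 / K \<le> \<bar>y\<bar>" using v by (simp add: y_def field_simps)
      then have "(1 / K)\<^sup>2 \<le> \<bar>y\<bar>\<^sup>2" using K by (intro power_mono) auto
      then have "1 \<le> K\<^sup>2 * y\<^sup>2" using K by (simp add: field_simps)
      then have "(exp \<bar>\<theta>\<bar> + \<bar>\<theta>\<bar> + K) * 1 \<le> (exp \<bar>\<theta>\<bar> + \<bar>\<theta>\<bar> + K) * (K\<^sup>2 * y\<^sup>2)"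
        using K by (intro mult_left_mono) (auto intro: add_nonneg_nonneg)
      then have D: "exp \<bar>\<theta>\<bar> + \<bar>\<theta>\<bar> + K \<le> ?D * y\<^sup>2" by (simp add: mult_ac)
      have "\<bar>\<theta> * y\<bar> \<le> \<bar>\<theta>\<bar>" using y mult_left_mono[of "\<bar>y\<bar>" 1 "\<bar>\<theta>\<bar>"] by (simp add: abs_mult)
      then have \<theta>y: "\<theta> * y \<le> \<bar>\<theta>\<bar>" "- \<bar>\<theta>\<bar> \<le> \<theta> * y" by (simp_all only: abs_le_iff) linarith+
      have Ky: "0 \<le> K * y\<^sup>2" "K * y\<^sup>2 \<le> K"
        using K y mult_left_mono[of "y\<^sup>2" 1 K] by (simp_all add: abs_square_le_1)
      have "z \<le> \<bar>\<theta>\<bar>" unfolding z_def using \<theta>y Ky by linarith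
      then have z: "exp z \<le> exp \<bar>\<theta>\<bar>" by simp
      have "0 \<le> C * y\<^sup>2" using C by simp
      with z \<theta>y Ky order_trans[OF z order_refl] have "exp \<bar>\<theta>\<bar> \<le> 1 + \<theta> * y + (C - K) * y\<^sup>2 + (exp \<bar>\<theta>\<bar> + \<bar>\<theta>\<bar> + K)"
        unfolding left_diff_distrib by linarith
      then have "exp z \<le> 1 + \<theta> * y + (C - K) * y\<^sup>2 + ?D * y\<^sup>2"
        using D z by (meson add_left_mono order_trans)
      then show ?thesis using x True by (simp add: y_def[symmetric] z_def)
    next
      case False
      then have "K * \<bar>y\<bar> \<le> 1" using v K by (simp add: y_def field_simps)
      have "\<bar>z\<bar> \<le> \<bar>\<theta> * y\<bar> + \<bar>K * y\<^sup>2\<bar>" unfolding z_def by (rule abs_triangle_ineq4)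
      also have "\<dots> = (\<bar>\<theta>\<bar> + K * \<bar>y\<bar>) * \<bar>y\<bar>" using K
        by (simp add: abs_mult distrib_right power2_eq_square)
      also have "\<dots> \<le> (\<bar>\<theta>\<bar> + 1) * \<bar>y\<bar>" using \<open>K * \<bar>y\<bar> \<le> 1\<close> by (intro mult_right_mono) auto
      finally have z: "\<bar>z\<bar> \<le> (\<bar>\<theta>\<bar> + 1) * \<bar>y\<bar>" .
      then have z1: "\<bar>z\<bar> \<le> \<bar>\<theta>\<bar> + 1" using y mult_left_mono[of "\<bar>y\<bar>" 1 "\<bar>\<theta>\<bar> + 1"] by simp
      have "z\<^sup>2 \<le> (\<bar>\<theta>\<bar> + 1)\<^sup>2 * y\<^sup>2" using power_mono[OF z, of 2] by (simp add: power_mult_distrib)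
      then have "z\<^sup>2 / 2 * exp \<bar>z\<bar> \<le> ((\<bar>\<theta>\<bar> + 1)\<^sup>2 * y\<^sup>2) / 2 * exp (\<bar>\<theta>\<bar> + 1)"
        using z1 by (intro mult_mono) auto
      then have "exp z \<le> 1 + z + C * y\<^sup>2" using exp_le_quadratic[of z] by (simp add: C_def mult_ac)
      then show ?thesis using x False by (simp add: y_def[symmetric] z_def left_diff_distrib)
    qed
  qed
  have "(\<integral>\<^sup>+\<omega>. ennreal (exp (\<Sum>i<n. ?f (X i \<omega>))) \<partial>N)
    \<le> ennreal (exp (real n * L v / v\<^sup>2 * (C - K + \<epsilon> * (\<bar>\<theta>\<bar> + 0 + ?D / (1 / K)))))"
    using iid _ v _ _ _ _ inner _ small \<epsilon>
    by (rule iid_truncated_mgf_le) (use K in auto)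
  also have "\<bar>\<theta>\<bar> + 0 + ?D / (1 / K) = \<bar>\<theta>\<bar> + K ^ 3 * (exp \<bar>\<theta>\<bar> + \<bar>\<theta>\<bar> + K)"
    by (simp add: power2_eq_square power3_eq_cube)
  finally show ?thesis .
qed

text \<open>The inequality \<open>exp (- u) \<le> 1 - u/2\<close> on the unit interval gives a factor below one for each observation.\<close>

lemma small_region_mgf_le:
  assumes iid: "iid_with_law N X Q" and v: "0 < v"
  shows "(\<integral>\<^sup>+\<omega>. ennreal (exp (\<Sum>i<n. if \<bar>X i \<omega>\<bar> \<le> v then - (X i \<omega> / v)\<^sup>2 else 0)) \<partial>N)
    \<le> ennreal (exp (- (real n * (L v / (2 * v\<^sup>2)))))"
proof -
  let ?h = "\<lambda>x. (- (1 / (2 * v\<^sup>2))) * (if \<bar>x\<bar> \<le> v then x\<^sup>2 else 0)"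
  have h: "integrable Q ?h" by (intro integrable_mult_right integrable_truncated_square)
  have "exp (if \<bar>x\<bar> \<le> v then - (x / v)\<^sup>2 else 0) \<le> 1 + ?h x" for x
  proof (cases "\<bar>x\<bar> \<le> v")
    case True
    define u where "u = (x / v)\<^sup>2"
    have u: "0 \<le> u" "u \<le> 1" using True v by (auto simp: u_def abs_square_le_1)
    have "exp (- u) = 1 / exp u" by (simp add: exp_minus inverse_eq_divide)
    also have "\<dots> \<le> 1 / (1 + u)" using u exp_ge_add_one_self[of u] by (intro divide_left_mono) auto
    also have "\<dots> \<le> 1 - u / 2"
    proof -
      have "u * u \<le> u" using u mult_left_mono[of u 1 u] by simp
      then have "1 \<le> (1 - u / 2) * (1 + u)" by (simp add: algebra_simps)
      then show ?thesis using u by (simp add: pos_divide_le_eq)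
    qed
    finally show ?thesis using True by (simp add: u_def power_divide)
  qed simp
  then have "(\<integral>\<^sup>+\<omega>. ennreal (exp (\<Sum>i<n. if \<bar>X i \<omega>\<bar> \<le> v then - (X i \<omega> / v)\<^sup>2 else 0)) \<partial>N)
      \<le> ennreal (exp (real n * (\<integral>x. ?h x \<partial>Q)))"
    using iid h by (intro iid_exp_sum_le) auto
  also have "(\<integral>x. ?h x \<partial>Q) = - (1 / (2 * v\<^sup>2)) * L v"
    unfolding truncated_second_moment_def by (rule integral_mult_right_zero)
  finally show ?thesis by simp
qed

end

section \<open>Deterministic bounds for a self-normalised sum\<close>

definition root_sum_squares :: "nat \<Rightarrow> (nat \<Rightarrow> real) \<Rightarrow> real" where
  "root_sum_squares n x = sqrt (\<Sum>i<n. (x i)\<^sup>2)"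

text \<open>The value for a vanishing sum of squares is an upper bound for the other branch, since \<open>\<bar>S\<bar> / V \<le> \<surd>n\<close>:
  where all observations equal \<open>\<mu>\<close>, the interval is empty at every level at which it is not the whole line,
  and this bound is what is left of the risk.\<close>

definition self_normalised_exp :: "real \<Rightarrow> nat \<Rightarrow> (nat \<Rightarrow> real) \<Rightarrow> real" where
  "self_normalised_exp l n x =
     (if root_sum_squares n x = 0 then exp (l * sqrt n) else exp (l * \<bar>\<Sum>i<n. x i\<bar> / root_sum_squares n x))"

lemma root_sum_squares_nonneg: "0 \<le> root_sum_squares n x"
  by (simp add: root_sum_squares_def sum_nonneg)

lemma root_sum_squares_sq: "(root_sum_squares n x)\<^sup>2 = (\<Sum>i<n. (x i)\<^sup>2)"
  by (simp add: root_sum_squares_def sum_nonneg)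

lemma abs_le_root_sum_squares: "i < n \<Longrightarrow> \<bar>x i\<bar> \<le> root_sum_squares n x"
  unfolding root_sum_squares_def
  by (rule real_le_rsqrt) (use member_le_sum[of i "{..<n}" "\<lambda>i. (x i)\<^sup>2"] in auto)

lemma abs_sum_le_root_sum_squares:
  assumes "finite I" "I \<subseteq> {..<n}"
  shows "\<bar>\<Sum>i\<in>I. x i\<bar> \<le> sqrt (card I) * root_sum_squares n x"
proof -
  have "(\<Sum>i\<in>I. x i)\<^sup>2 \<le> (\<Sum>i\<in>I. (x i)\<^sup>2) * card I" by (rule sum_squared_le_sum_of_squares)
  also have "\<dots> \<le> (\<Sum>i<n. (x i)\<^sup>2) * card I"
    using assms by (intro mult_right_mono sum_mono2) auto
  finally have "sqrt ((\<Sum>i\<in>I. x i)\<^sup>2) \<le> sqrt ((\<Sum>i<n. (x i)\<^sup>2) * card I)" by (rule real_sqrt_le_mono)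
  then show ?thesis by (simp add: root_sum_squares_def real_sqrt_mult mult.commute)
qed

lemma self_normalised_exp_le_max:
  assumes "0 \<le> l"
  shows "self_normalised_exp l n x \<le> exp (l * sqrt n)"
proof (cases "root_sum_squares n x = 0")
  case False
  then have pos: "0 < root_sum_squares n x" using root_sum_squares_nonneg[of n x] by simp
  have "\<bar>\<Sum>i<n. x i\<bar> / root_sum_squares n x \<le> sqrt n"
    using abs_sum_le_root_sum_squares[of "{..<n}" n x] pos by (simp add: field_simps)
  then have "l * (\<bar>\<Sum>i<n. x i\<bar> / root_sum_squares n x) \<le> l * sqrt n"
    using assms by (rule mult_left_mono)
  then show ?thesis using False by (simp add: self_normalised_exp_def)
qed (simp add: self_normalised_exp_def)

lemma exp_abs_le: "exp \<bar>y\<bar> \<le> exp y + exp (- y)" for y :: real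
  by (cases "0 \<le> y") (auto simp: add_increasing)

text \<open>Cauchy-Schwarz bounds the contribution of the \<open>m\<close> terms beyond \<open>b\<close> by \<open>\<surd>m V \<le> m V\<close>, which accounts for
  the constant summand \<open>l\<close>.\<close>

lemma self_normalised_exp_typical:
  assumes l: "0 \<le> l" and b: "0 < b" and r: "0 < r" and V: "b / r \<le> root_sum_squares n x"
  shows "self_normalised_exp l n x \<le>
    exp (\<Sum>i<n. if \<bar>x i\<bar> \<le> b then l * r * (x i / b) else l) +
    exp (\<Sum>i<n. if \<bar>x i\<bar> \<le> b then - (l * r) * (x i / b) else l)"
proof -
  let ?V = "root_sum_squares n x"
  have Vpos: "0 < ?V" using V b r by (meson divide_pos_pos less_le_trans)
  define I where "I = {i. i < n \<and> \<not> \<bar>x i\<bar> \<le> b}"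
  define s where "s = (\<Sum>i<n. if \<bar>x i\<bar> \<le> b then x i / b else 0)"
  have I: "finite I" "I \<subseteq> {..<n}" by (auto simp: I_def)
  have split: "(\<Sum>i<n. if \<bar>x i\<bar> \<le> b then c * (x i / b) else e) = c * s + e * card I" for c e :: real
  proof -
    have "(\<Sum>i<n. if \<bar>x i\<bar> \<le> b then c * (x i / b) else e)
      = (\<Sum>i<n. c * (if \<bar>x i\<bar> \<le> b then x i / b else 0) + (if i \<in> I then e else 0))"
      by (intro sum.cong) (auto simp: I_def)
    also have "\<dots> = c * s + (\<Sum>i\<in>I. e)"
      using I by (simp add: sum.distrib s_def sum_distrib_left sum.inter_restrict[symmetric] Int_absorb1)
    finally show ?thesis by simp
  qed
  have "(\<Sum>i<n. x i) = (\<Sum>i<n. b * (if \<bar>x i\<bar> \<le> b then x i / b else 0) + (if i \<in> I then x i else 0))"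
    using b by (intro sum.cong) (auto simp: I_def)
  also have "\<dots> = b * s + (\<Sum>i\<in>I. x i)"
    using I by (simp add: sum.distrib s_def sum_distrib_left sum.inter_restrict[symmetric] Int_absorb1)
  finally have "\<bar>\<Sum>i<n. x i\<bar> \<le> b * \<bar>s\<bar> + sqrt (card I) * ?V"
    using abs_sum_le_root_sum_squares[OF I, of x] b abs_triangle_ineq[of "b * s" "\<Sum>i\<in>I. x i"] by (simp add: abs_mult)
  also have "\<dots> \<le> r * ?V * \<bar>s\<bar> + card I * ?V"
  proof (intro add_mono mult_right_mono)
    show "b \<le> r * ?V" using V r by (simp add: field_simps)
    show "sqrt (card I) \<le> card I"
      by (rule real_le_lsqrt) (simp_all add: power2_eq_square flip: of_nat_mult)
  qed (use Vpos in auto)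
  finally have "\<bar>\<Sum>i<n. x i\<bar> / ?V \<le> r * \<bar>s\<bar> + card I" using Vpos by (simp add: field_simps)
  then have "l * (\<bar>\<Sum>i<n. x i\<bar> / ?V) \<le> l * (r * \<bar>s\<bar> + card I)" using l by (rule mult_left_mono)
  then have "self_normalised_exp l n x \<le> exp (\<bar>l * r * s\<bar> + l * card I)"
    using Vpos l r by (simp add: self_normalised_exp_def abs_mult algebra_simps)
  also have "\<dots> = exp \<bar>l * r * s\<bar> * exp (l * card I)" by (rule exp_add)
  also have "\<dots> \<le> (exp (l * r * s) + exp (- (l * r * s))) * exp (l * card I)"
    by (intro mult_right_mono exp_abs_le) auto
  also have "\<dots> = exp (l * r * s + l * card I) + exp (- (l * r) * s + l * card I)"
    by (simp add: exp_add[symmetric] algebra_simps)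
  finally show ?thesis by (simp only: split)
qed

text \<open>No term exceeds \<open>V \<le> v\<close>, so the condition in the sums always holds; it is written because the
  exponential moment is computed for independent truncated variables, without knowledge of \<open>V\<close>.
  The factor \<open>exp K\<close> compensates for the penalty, as \<open>V\<^sup>2 / v\<^sup>2 \<le> 1\<close>.\<close>

lemma self_normalised_exp_shell:
  assumes l: "0 \<le> l" and v: "0 < v" and K: "0 \<le> K"
    and V: "v / 2 < root_sum_squares n x" "root_sum_squares n x \<le> v"
  shows "self_normalised_exp l n x \<le> exp K *
    (exp (\<Sum>i<n. if \<bar>x i\<bar> \<le> v then 2 * l * (x i / v) - K * (x i / v)\<^sup>2 else 0) +
     exp (\<Sum>i<n. if \<bar>x i\<bar> \<le> v then - (2 * l) * (x i / v) - K * (x i / v)\<^sup>2 else 0))"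
proof -
  let ?V = "root_sum_squares n x"
  have Vpos: "0 < ?V" using V v by linarith
  define s where "s = (\<Sum>i<n. x i) / v"
  have small: "\<bar>x i\<bar> \<le> v" if "i < n" for i using abs_le_root_sum_squares[OF that, of x] V by linarith
  have split: "(\<Sum>i<n. if \<bar>x i\<bar> \<le> v then c * (x i / v) - K * (x i / v)\<^sup>2 else 0) = c * s - K * (?V / v)\<^sup>2" for c
    unfolding power_divide root_sum_squares_sq s_def using small
    by (simp add: sum_subtractf sum_distrib_left sum_divide_distrib)
  have "(?V / v)\<^sup>2 \<le> 1" using V v Vpos by (simp add: power_le_one)
  then have one: "0 \<le> K - K * (?V / v)\<^sup>2" using K mult_left_mono[of "(?V / v)\<^sup>2" 1 K] by simp
  have "\<bar>\<Sum>i<n. x i\<bar> = v * \<bar>s\<bar>" using v by (simp add: s_def abs_mult)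
  also have "\<dots> \<le> 2 * ?V * \<bar>s\<bar>" using V by (intro mult_right_mono) auto
  finally have "\<bar>\<Sum>i<n. x i\<bar> / ?V \<le> 2 * \<bar>s\<bar>" using Vpos by (simp add: field_simps)
  then have "l * (\<bar>\<Sum>i<n. x i\<bar> / ?V) \<le> l * (2 * \<bar>s\<bar>)" using l by (rule mult_left_mono)
  then have "self_normalised_exp l n x \<le> exp (\<bar>2 * l * s\<bar> + (K - K * (?V / v)\<^sup>2))"
    using Vpos l one by (simp add: self_normalised_exp_def abs_mult algebra_simps)
  also have "\<dots> = exp K * (exp \<bar>2 * l * s\<bar> * exp (- K * (?V / v)\<^sup>2))" by (simp add: exp_add[symmetric])
  also have "\<dots> \<le> exp K * ((exp (2 * l * s) + exp (- (2 * l * s))) * exp (- K * (?V / v)\<^sup>2))"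
    by (intro mult_left_mono mult_right_mono exp_abs_le) auto
  also have "\<dots> = exp K * (exp (2 * l * s - K * (?V / v)\<^sup>2) + exp (- (2 * l) * s - K * (?V / v)\<^sup>2))"
    by (simp add: exp_add[symmetric] algebra_simps)
  finally show ?thesis by (simp only: split)
qed

text \<open>A Chernoff bound for the event that \<open>V \<le> v\<close>.\<close>

lemma small_root_sum_squares:
  assumes v: "0 < v" and V: "root_sum_squares n x \<le> v"
  shows "1 \<le> exp 1 * exp (\<Sum>i<n. if \<bar>x i\<bar> \<le> v then - (x i / v)\<^sup>2 else 0)"
proof -
  have small: "\<bar>x i\<bar> \<le> v" if "i < n" for i using abs_le_root_sum_squares[OF that, of x] V by linarith
  have "(\<Sum>i<n. if \<bar>x i\<bar> \<le> v then - (x i / v)\<^sup>2 else 0) = - (root_sum_squares n x / v)\<^sup>2"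
    unfolding power_divide root_sum_squares_sq using small
    by (simp add: sum_negf sum_divide_distrib)
  moreover have "(root_sum_squares n x / v)\<^sup>2 \<le> 1"
    using V v root_sum_squares_nonneg[of n x] by (simp add: power_le_one)
  ultimately show ?thesis by (simp add: exp_add[symmetric])
qed

section \<open>Uniform bound for the exponential moment of a self-normalised sum\<close>

text \<open>A uniform version of Feller's criterion for attraction to the normal law, with \<open>v J v\<close> in the place of
  \<open>v\<^sup>2 P (\<bar>X\<bar> > v)\<close>, which it dominates.  The last clause keeps the laws of the class uniformly away from
  degenerate ones.\<close>

definition uniformly_small_tails :: "real measure set \<Rightarrow> bool" where
  "uniformly_small_tails \<Q> \<longleftrightarrow>
     (\<forall>Q\<in>\<Q>. centred_law Q) \<and>
     (\<forall>\<epsilon>>0. \<exists>v\<^sub>0>0. \<forall>Q\<in>\<Q>. \<forall>v\<ge>v\<^sub>0. v * tail_first_moment Q v \<le> \<epsilon> * truncated_second_moment Q v) \<and>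
     (\<exists>c>0. \<exists>w. \<forall>Q\<in>\<Q>. c \<le> truncated_second_moment Q w)"

lemma nn_integral_add_le:
  assumes "f \<in> borel_measurable M" "g \<in> borel_measurable M" "\<And>x. 0 \<le> f x" "\<And>x. 0 \<le> g x" "0 \<le> a" "0 \<le> b"
    and "(\<integral>\<^sup>+x. ennreal (f x) \<partial>M) \<le> ennreal a" "(\<integral>\<^sup>+x. ennreal (g x) \<partial>M) \<le> ennreal b"
  shows "(\<integral>\<^sup>+x. ennreal (f x + g x) \<partial>M) \<le> ennreal (a + b)"
  using assms by (simp add: ennreal_plus nn_integral_add add_mono del: ennreal_plus[symmetric])

lemma nn_integral_cmult_le:
  assumes "f \<in> borel_measurable M" "0 \<le> c" "(\<integral>\<^sup>+x. ennreal (f x) \<partial>M) \<le> ennreal a"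
  shows "(\<integral>\<^sup>+x. ennreal (c * f x) \<partial>M) \<le> ennreal (c * a)"
  using assms by (simp add: ennreal_mult' nn_integral_cmult mult_left_mono)

lemma nn_integral_sum_le:
  assumes "\<And>k. k < N \<Longrightarrow> f k \<in> borel_measurable M" "\<And>k x. 0 \<le> f k x" "\<And>k. 0 \<le> a k"
    and "\<And>k. k < N \<Longrightarrow> (\<integral>\<^sup>+x. ennreal (f k x) \<partial>M) \<le> ennreal (a k)"
  shows "(\<integral>\<^sup>+x. ennreal (\<Sum>k<N. f k x) \<partial>M) \<le> ennreal (\<Sum>k<(N::nat). a k)"
  using assms
proof (induction N)
  case (Suc N)
  then show ?case
    unfolding sum.lessThan_Suc
    by (intro nn_integral_add_le) (auto intro!: sum_nonneg borel_measurable_sum)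
qed simp

text \<open>The shells cover everything between \<open>a / 2 ^ N\<close> and \<open>a\<close>.\<close>

lemma dyadic_shell:
  fixes V a :: real
  assumes "V \<le> a" "a / 2 ^ N < V"
  shows "\<exists>k<N. a / 2 ^ k / 2 < V \<and> V \<le> a / 2 ^ k"
  using assms(2)
proof (induction N)
  case (Suc N)
  show ?case
  proof (cases "a / 2 ^ N < V")
    case True
    then show ?thesis using Suc.IH less_Suc_eq by auto
  next
    case False
    then show ?thesis using Suc.prems by (intro exI[of _ N]) (simp add: field_simps)
  qed
qed (use assms(1) in simp)

text \<open>Slow variation of \<open>L\<close>: halving the level loses only a small fraction of the truncated second moment.\<close>

lemma (in centred_law) shell_ratio_ge:
  assumes v: "0 < v" and small: "v / 2 * J (v / 2) \<le> \<epsilon> * L (v / 2)" and \<epsilon>: "0 \<le> \<epsilon>" and u: "v / 2 \<le> u"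
  shows "(1 - 2 * \<epsilon>) * L v \<le> L u"
proof -
  have "L v - L (v / 2) \<le> v * J (v / 2)" using v by (intro L_diff_le) auto
  also have "\<dots> \<le> 2 * (\<epsilon> * L (v / 2))" using small by simp
  also have "\<dots> \<le> 2 * (\<epsilon> * L v)" using v \<epsilon> by (intro mult_left_mono L_mono) auto
  finally show ?thesis using L_mono[OF u] by (simp add: algebra_simps)
qed

lemma ex_outer_ratio:
  fixes \<eta> l :: real
  assumes "0 < \<eta>"
  obtains r where "1 < r" "r < 2" "2 * exp (l\<^sup>2 * r ^ 3 / 2 + (r - 1)) \<le> 2 * exp (l\<^sup>2 / 2) + \<eta>"
proof -
  have "((\<lambda>r. 2 * exp (l\<^sup>2 * r ^ 3 / 2 + (r - 1))) \<longlongrightarrow> 2 * exp (l\<^sup>2 * 1 ^ 3 / 2 + (1 - 1))) (at_right 1)"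
    by (intro tendsto_intros) simp
  then have "\<forall>\<^sub>F r in at_right 1. 2 * exp (l\<^sup>2 * r ^ 3 / 2 + (r - 1)) < 2 * exp (l\<^sup>2 / 2) + \<eta>"
    by (rule order_tendstoD(2)) (use assms in simp)
  moreover have "\<forall>\<^sub>F r in at_right 1. r \<in> {1<..<2 :: real}" by (rule eventually_at_right_real) simp
  ultimately have "\<forall>\<^sub>F r in at_right 1. 1 < r \<and> r < 2 \<and>
      2 * exp (l\<^sup>2 * r ^ 3 / 2 + (r - 1)) \<le> 2 * exp (l\<^sup>2 / 2) + \<eta>"
    by eventually_elim auto
  then show ?thesis
    using that eventually_happens[of _ "at_right (1::real)"] trivial_limit_at_right_real by blast
qed

text \<open>The exponent is \<open>(C + 1) r - (r - 1) K\<close>; it tends to \<open>- \<infinity>\<close> because \<open>r > 1\<close>.\<close>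

lemma ex_shell_penalty:
  fixes r C \<eta> :: real
  assumes "1 < r" "0 < \<eta>"
  obtains K where "2 \<le> K" "C + 2 \<le> K" "4 * exp (K - (K - C - 1) * r) \<le> \<eta>"
proof -
  have "((\<lambda>K. 4 * exp ((C + 1) * r - (r - 1) * K)) \<longlongrightarrow> 0) at_top"
    using assms by real_asymp
  then have "\<forall>\<^sub>F K in at_top. 4 * exp ((C + 1) * r - (r - 1) * K) < \<eta>"
    using assms by (intro order_tendstoD(2)) auto
  then have "\<forall>\<^sub>F K in at_top. 2 \<le> K \<and> C + 2 \<le> K \<and> 4 * exp (K - (K - C - 1) * r) \<le> \<eta>"
    using eventually_ge_at_top[of 2] eventually_ge_at_top[of "C + 2"]
    by eventually_elim (auto simp: algebra_simps)
  then show ?thesis using that eventually_happens[of _ "at_top :: real filter"] by auto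
qed

lemma eventually_root_exp_small:
  fixes l c \<eta> :: real
  assumes "0 < c" "0 < \<eta>"
  shows "\<forall>\<^sub>F n in sequentially. exp (l * sqrt (real n)) * (exp 1 * exp (- (real n * c))) \<le> \<eta>"
proof -
  have "((\<lambda>n. exp (l * sqrt (real n)) * (exp 1 * exp (- (real n * c)))) \<longlongrightarrow> 0) sequentially"
  proof (cases "l > 0")
    case True then show ?thesis using assms by real_asymp
  next
    case False
    then consider "l = 0" | "l < 0" by linarith
    then show ?thesis using assms by cases real_asymp+
  qed
  then have "\<forall>\<^sub>F n in sequentially. exp (l * sqrt (real n)) * (exp 1 * exp (- (real n * c))) < \<eta>"
    using assms by (intro order_tendstoD(2)) auto
  then show ?thesis by eventually_elim simp
qed

lemma sum_half_powers_le: "(\<Sum>k<N. a * (1 / 2) ^ k) \<le> 2 * a" if "0 \<le> a" for a :: real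
proof -
  have "(\<Sum>k<N. a * (1 / 2) ^ k) = 2 * a - 2 * a * (1 / 2) ^ N" by (induction N) auto
  then show ?thesis using that by simp
qed

text \<open>The constants are chosen in the order \<open>r\<close>, \<open>K\<close>, \<open>\<tau>\<close>, \<open>\<epsilon>\<close>, then the level \<open>v\<^sub>0\<close> beyond which the tails
  are small, and finally \<open>n\<close>.  The laws enter only through \<open>v\<^sub>0\<close> and
  the lower bound \<open>c\<close> for \<open>L\<close>, which are common to the whole class; this is why the result is uniform.\<close>

theorem self_normalised_exp_limit_le:
  fixes l \<eta> :: real
  assumes Q: "uniformly_small_tails \<Q>" and l: "0 < l" and \<eta>: "0 < \<eta>"
  shows "\<forall>\<^sub>F n in sequentially. \<forall>Q\<in>\<Q>. \<forall>(M :: 'w measure) X. iid_with_law M X Q \<longrightarrow>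
    (\<integral>\<^sup>+\<omega>. ennreal (self_normalised_exp l n (\<lambda>i. X i \<omega>)) \<partial>M) \<le> ennreal (2 * exp (l\<^sup>2 / 2) + \<eta>)"
proof -
  obtain r where r: "1 < r" "r < 2" "2 * exp (l\<^sup>2 * r ^ 3 / 2 + (r - 1)) \<le> 2 * exp (l\<^sup>2 / 2) + \<eta> / 3"
    using ex_outer_ratio[of "\<eta> / 3" l] \<eta> by auto
  define C where "C = (2 * l + 1)\<^sup>2 / 2 * exp (2 * l + 1)"
  obtain K where K: "2 \<le> K" "C + 2 \<le> K" "4 * exp (K - (K - C - 1) * r) \<le> \<eta> / 3"
    using ex_shell_penalty[of r "\<eta> / 3" C] r \<eta> by auto
  define \<tau> where "\<tau> = min 1 (ln r / (l * r))"
  have \<tau>: "0 < \<tau>" "\<tau> \<le> 1" using r l by (auto simp: \<tau>_def)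
  have "l * r * \<tau> \<le> l * r * (ln r / (l * r))" using r l by (intro mult_left_mono) (auto simp: \<tau>_def)
  also have "\<dots> = ln r" using r l by simp
  finally have "exp (l * r * \<tau>) \<le> exp (ln r)" by simp
  then have \<tau>r: "exp (l * r * \<tau>) \<le> r" using r by simp
  \<comment> \<open>\<open>cA\<close> and \<open>cB\<close> are the factors of \<open>\<epsilon>\<close> in the exponents of the typical region and of the shells.\<close>
  define cA where "cA = l * r + exp l + (l * r)\<^sup>2 / 2 * exp (l * r) / \<tau>"
  define cB where "cB = 2 * l + K ^ 3 * (exp (2 * l) + 2 * l + K)"
  have cA: "0 < cA" using \<tau> l r by (auto simp: cA_def intro!: add_pos_nonneg add_pos_pos)
  have cB: "0 < cB" using l K by (auto simp: cB_def intro!: add_pos_nonneg)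
  define \<epsilon> where "\<epsilon> = min ((r - 1) / cA) (min (1 / cB) ((1 - 1 / r) / 2))"
  have \<epsilon>: "0 < \<epsilon>" "\<epsilon> * cA \<le> r - 1" "\<epsilon> * cB \<le> 1" "2 * \<epsilon> \<le> 1 - 1 / r"
  proof -
    show "0 < \<epsilon>" using r cA cB by (auto simp: \<epsilon>_def field_simps)
    have "\<epsilon> \<le> (r - 1) / cA" "\<epsilon> \<le> 1 / cB" by (auto simp: \<epsilon>_def)
    then show "\<epsilon> * cA \<le> r - 1" "\<epsilon> * cB \<le> 1" using cA cB by (auto simp: pos_le_divide_eq)
    have "\<epsilon> \<le> (1 - 1 / r) / 2" unfolding \<epsilon>_def by (meson min.cobounded2 order_trans)
    then show "2 * \<epsilon> \<le> 1 - 1 / r" by simp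
  qed
  have \<epsilon>4: "2 * \<epsilon> \<le> 1 / 2" 
  proof -
    have "1 / 2 \<le> 1 / r" using r by (simp add: field_simps)
    then show ?thesis using \<epsilon>(4) by linarith
  qed
  obtain v\<^sub>0' where v\<^sub>0': "0 < v\<^sub>0'"
    "\<And>Q v. Q \<in> \<Q> \<Longrightarrow> v\<^sub>0' \<le> v \<Longrightarrow> v * tail_first_moment Q v \<le> \<epsilon> * truncated_second_moment Q v"
    using Q \<epsilon>(1) unfolding uniformly_small_tails_def by meson
  obtain c w where c: "0 < c" "\<And>Q. Q \<in> \<Q> \<Longrightarrow> c \<le> truncated_second_moment Q w"
    using Q unfolding uniformly_small_tails_def by meson
  define v\<^sub>0 where "v\<^sub>0 = max v\<^sub>0' w"
  have v\<^sub>0: "0 < v\<^sub>0" "v\<^sub>0' \<le> v\<^sub>0" "w \<le> v\<^sub>0" using v\<^sub>0' by (auto simp: v\<^sub>0_def)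
  \<comment> \<open>The shells are used down to \<open>w\<^sub>0\<close>, so that both \<open>v\<close> and the inner threshold \<open>v / K\<close> of a shell lie
    beyond \<open>v\<^sub>0\<close>.\<close>
  define w\<^sub>0 where "w\<^sub>0 = K * v\<^sub>0"
  have w\<^sub>0: "0 < w\<^sub>0" "2 * v\<^sub>0 \<le> w\<^sub>0" using v\<^sub>0 K by (auto simp: w\<^sub>0_def)
  \<comment> \<open>A norming constant beyond \<open>b\<^sub>0\<close> leaves room for \<open>\<tau> b\<close> and \<open>b / r\<close> above the thresholds.\<close>
  define b\<^sub>0 where "b\<^sub>0 = 2 * w\<^sub>0 + v\<^sub>0 / \<tau>"
  have b\<^sub>0: "2 * w\<^sub>0 \<le> b\<^sub>0" "v\<^sub>0 / \<tau> \<le> b\<^sub>0" using v\<^sub>0 \<tau> w\<^sub>0 by (auto simp: b\<^sub>0_def)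
  have "\<forall>\<^sub>F n in sequentially. b\<^sub>0\<^sup>2 / c \<le> real n"
    using eventually_ge_at_top[of "nat \<lceil>b\<^sub>0\<^sup>2 / c\<rceil>"] by eventually_elim linarith
  moreover have "\<forall>\<^sub>F n in sequentially. exp (l * sqrt (real n)) * (exp 1 * exp (- (real n * (c / (2 * w\<^sub>0\<^sup>2))))) \<le> \<eta> / 3"
    using c(1) w\<^sub>0 \<eta> by (intro eventually_root_exp_small) auto
  ultimately show ?thesis
  proof eventually_elim
    case (elim n)
    show ?case
    proof (intro ballI allI impI)
      fix Q M and X :: "nat \<Rightarrow> 'w \<Rightarrow> real"
      assume QQ: "Q \<in> \<Q>" and iid: "iid_with_law M X Q"
      interpret centred_law Q using Q QQ by (auto simp: uniformly_small_tails_def)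
      have [measurable]: "X i \<in> borel_measurable M" for i
        using iid by (auto simp: iid_with_law_def prob_space.indep_vars_def)
      have tails: "v * J v \<le> \<epsilon> * L v" if "v\<^sub>0 \<le> v" for v using v\<^sub>0'(2)[OF QQ, of v] that v\<^sub>0 by simp
      have Lw: "c \<le> L v" if "v\<^sub>0 \<le> v" for v using c(2)[OF QQ] L_mono[of w v] that v\<^sub>0 by linarith
      have Lpos: "0 < L v" if "v\<^sub>0 \<le> v" for v using Lw[OF that] c(1) by linarith
      have "b\<^sub>0\<^sup>2 \<le> real n * c" using elim(1) c(1) by (simp add: field_simps)
      also have "\<dots> \<le> real n * L b\<^sub>0" using b\<^sub>0 w\<^sub>0 v\<^sub>0 by (intro mult_left_mono Lw) auto
      finally obtain b where b: "b\<^sub>0 \<le> b" "real n * L b = b\<^sup>2"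
        using ex_norming_constant[of b\<^sub>0 n] b\<^sub>0 w\<^sub>0 by auto
      have bpos: "0 < b" and bw: "2 * w\<^sub>0 \<le> b" and \<tau>b: "v\<^sub>0 \<le> \<tau> * b"
        using b b\<^sub>0 w\<^sub>0 \<tau> by (auto simp: field_simps intro: order_trans)
      let ?SN = "\<lambda>\<omega>. self_normalised_exp l n (\<lambda>i. X i \<omega>)" and ?V = "\<lambda>\<omega>. root_sum_squares n (\<lambda>i. X i \<omega>)"
      define A where "A \<theta> \<omega> = exp (\<Sum>i<n. if \<bar>X i \<omega>\<bar> \<le> b then \<theta> * (X i \<omega> / b) else l)" for \<theta> \<omega>
      define v where "v k = b / r / 2 ^ k" for k
      define B where "B \<theta> k \<omega> = exp (\<Sum>i<n. if \<bar>X i \<omega>\<bar> \<le> v k then \<theta> * (X i \<omega> / v k) - K * (X i \<omega> / v k)\<^sup>2 else 0)"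
        for \<theta> k \<omega>
      define D where "D \<omega> = exp (\<Sum>i<n. if \<bar>X i \<omega>\<bar> \<le> w\<^sub>0 then - (X i \<omega> / w\<^sub>0)\<^sup>2 else 0)" for \<omega>
      have vpos: "0 < v k" for k using bpos r by (simp add: v_def)
      have "\<exists>N. b / r / 2 ^ N \<le> w\<^sub>0"
      proof -
        obtain N where "b / r / w\<^sub>0 < 2 ^ N" using real_arch_pow[of 2] by auto
        then have "b / r < 2 ^ N * w\<^sub>0" using w\<^sub>0(1) by (simp only: pos_divide_less_eq)
        then have "b / r / 2 ^ N \<le> w\<^sub>0" by (subst pos_divide_le_eq) (simp_all add: mult.commute)
        then show ?thesis ..
      qed
      then obtain N where N: "v N \<le> w\<^sub>0" by (auto simp: v_def)
      define bnd where "bnd \<omega> = (A (l * r) \<omega> + A (- (l * r)) \<omega>)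
          + ((\<Sum>k<N. if w\<^sub>0 \<le> v k then exp K * (B (2 * l) k \<omega> + B (- (2 * l)) k \<omega>) else 0)
          + exp (l * sqrt n) * (exp 1 * D \<omega>))" for \<omega>
      have [measurable]: "A \<theta> \<in> borel_measurable M" "B \<theta> k \<in> borel_measurable M" "D \<in> borel_measurable M" for \<theta> k
        by (simp_all add: A_def[abs_def] B_def[abs_def] D_def[abs_def])
      have nonneg: "0 \<le> A \<theta> \<omega>" "0 \<le> B \<theta> k \<omega>" "0 \<le> D \<omega>" for \<theta> k \<omega> by (auto simp: A_def B_def D_def)
      have snn: "0 \<le> (\<Sum>k<N. if w\<^sub>0 \<le> v k then exp K * (B (2 * l) k \<omega> + B (- (2 * l)) k \<omega>) else 0)" for \<omega>
        using nonneg by (intro sum_nonneg) auto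
      have pointwise: "?SN \<omega> \<le> bnd \<omega>" for \<omega>
      proof -
        consider (A) "b / r \<le> ?V \<omega>" | (B) "w\<^sub>0 < ?V \<omega>" "?V \<omega> < b / r" | (C) "?V \<omega> \<le> w\<^sub>0" by linarith
        then show ?thesis
        proof cases
          case A
          have "?SN \<omega> \<le> A (l * r) \<omega> + A (- (l * r)) \<omega>"
            using self_normalised_exp_typical[OF _ bpos _ A, of l] l r by (simp add: A_def)
          then show ?thesis using snn[of \<omega>] nonneg(3)[of \<omega>] by (auto simp: bnd_def intro: order_trans)
        next
          case B
          have "\<exists>k<N. b / r / 2 ^ k / 2 < ?V \<omega> \<and> ?V \<omega> \<le> b / r / 2 ^ k"
            using B N by (intro dyadic_shell) (auto simp: v_def)
          then obtain k where k: "k < N" "v k / 2 < ?V \<omega>" "?V \<omega> \<le> v k" by (auto simp: v_def)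
          then have "w\<^sub>0 \<le> v k" using B by simp
          have "?SN \<omega> \<le> exp K * (B (2 * l) k \<omega> + B (- (2 * l)) k \<omega>)"
            using self_normalised_exp_shell[OF _ vpos _ k(2,3), of l K] l K by (simp add: B_def)
          also have "\<dots> \<le> (\<Sum>k<N. if w\<^sub>0 \<le> v k then exp K * (B (2 * l) k \<omega> + B (- (2 * l)) k \<omega>) else 0)"
            using member_le_sum[of k "{..<N}"
                "\<lambda>k. if w\<^sub>0 \<le> v k then exp K * (B (2 * l) k \<omega> + B (- (2 * l)) k \<omega>) else 0"]
              k(1) \<open>w\<^sub>0 \<le> v k\<close> nonneg by auto
          also have "\<dots> \<le> bnd \<omega>" using nonneg by (auto simp: bnd_def)
          finally show ?thesis .
        next
          case C
          have "?SN \<omega> \<le> exp (l * sqrt n) * 1" using self_normalised_exp_le_max[of l] l by simp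
          also have "\<dots> \<le> exp (l * sqrt n) * (exp 1 * D \<omega>)"
            unfolding D_def by (intro mult_left_mono small_root_sum_squares w\<^sub>0 C) auto
          also have "\<dots> \<le> bnd \<omega>" using nonneg snn[of \<omega>] by (auto simp: bnd_def)
          finally show ?thesis .
        qed
      qed

      have A: "(\<integral>\<^sup>+\<omega>. ennreal (A \<theta> \<omega>) \<partial>M) \<le> ennreal (exp (l\<^sup>2 * r ^ 3 / 2 + (r - 1)))" if \<theta>: "\<bar>\<theta>\<bar> = l * r" for \<theta>
      proof -
        have sq: "\<theta>\<^sup>2 = (l * r)\<^sup>2" using \<theta> by (metis power2_abs)
        have "(\<integral>\<^sup>+\<omega>. ennreal (A \<theta> \<omega>) \<partial>M)
            \<le> ennreal (exp (\<theta>\<^sup>2 / 2 * r + \<epsilon> * (\<bar>\<theta>\<bar> + exp l + \<theta>\<^sup>2 / 2 * exp \<bar>\<theta>\<bar> / \<tau>)))"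
          unfolding A_def
        proof (rule typical_region_mgf_le[OF iid bpos b(2) \<tau>])
          show "exp (\<bar>\<theta>\<bar> * \<tau>) \<le> r" using \<tau>r \<theta> by simp
        qed (use tails \<tau>b bw w\<^sub>0 v\<^sub>0 \<epsilon> in auto)
        also have "\<dots> \<le> ennreal (exp (l\<^sup>2 * r ^ 3 / 2 + (r - 1)))"
        proof (rule ennreal_leI)
          have "\<theta>\<^sup>2 / 2 * r + \<epsilon> * (\<bar>\<theta>\<bar> + exp l + \<theta>\<^sup>2 / 2 * exp \<bar>\<theta>\<bar> / \<tau>) = l\<^sup>2 * r ^ 3 / 2 + \<epsilon> * cA"
            unfolding sq \<theta> cA_def by (simp add: power_mult_distrib power2_eq_square power3_eq_cube)
          then show "exp (\<theta>\<^sup>2 / 2 * r + \<epsilon> * (\<bar>\<theta>\<bar> + exp l + \<theta>\<^sup>2 / 2 * exp \<bar>\<theta>\<bar> / \<tau>)) \<le> exp (l\<^sup>2 * r ^ 3 / 2 + (r - 1))"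
            using \<epsilon>(2) by simp
        qed
        finally show ?thesis .
      qed
      \<comment> \<open>The effective number of observations in shell \<open>k\<close>: it is at least \<open>r\<close> in the outermost shell and at least
        doubles from each shell to the next.\<close>
      define m where "m k = real n * L (v k) / (v k)\<^sup>2" for k
      have m: "r * 2 ^ k \<le> m k" if "w\<^sub>0 \<le> v k" for k
        using that
      proof (induction k)
        case 0
        have "(1 - 2 * \<epsilon>) * L b \<le> L (b / r)"
        proof (rule shell_ratio_ge[OF bpos])
          show "b / 2 * J (b / 2) \<le> \<epsilon> * L (b / 2)" using bw w\<^sub>0 by (intro tails) auto
          show "b / 2 \<le> b / r" using r bpos by (simp add: field_simps)
        qed (use \<epsilon> in auto)
        moreover have "1 / r * L b \<le> (1 - 2 * \<epsilon>) * L b" using \<epsilon>(4) L_nonneg by (intro mult_right_mono) auto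
        ultimately have "1 / r * L b \<le> L (b / r)" by linarith
        then have "real n * (1 / r * L b) \<le> real n * L (b / r)" by (intro mult_left_mono) auto
        then have "b\<^sup>2 / r \<le> real n * L (b / r)" using b(2) by simp
        then have "b\<^sup>2 / r / (b / r)\<^sup>2 \<le> real n * L (b / r) / (b / r)\<^sup>2" by (rule divide_right_mono) simp
        then have "b\<^sup>2 / r / (b / r)\<^sup>2 \<le> m 0" unfolding m_def v_def by (simp only: power_0 div_by_1)
        then show ?case using bpos r by (simp add: power2_eq_square)
      next
        case (Suc k)
        have half: "v (Suc k) = v k / 2" by (simp add: v_def)
        then have wk: "w\<^sub>0 \<le> v k" using Suc.prems w\<^sub>0 by simp
        have "(1 - 2 * \<epsilon>) * L (v k) \<le> L (v (Suc k))"
        proof (rule shell_ratio_ge[OF vpos])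
          show "v k / 2 * J (v k / 2) \<le> \<epsilon> * L (v k / 2)" using Suc.prems w\<^sub>0 v\<^sub>0 half by (intro tails) auto
        qed (use \<epsilon> half in auto)
        moreover have "1 / 2 * L (v k) \<le> (1 - 2 * \<epsilon>) * L (v k)"
          using \<epsilon>4 L_nonneg by (intro mult_right_mono) auto
        ultimately have "L (v k) \<le> 2 * L (v (Suc k))" by linarith
        then have "real n * L (v k) / (v k)\<^sup>2 \<le> real n * (2 * L (v (Suc k))) / (v k)\<^sup>2"
          by (intro divide_right_mono mult_left_mono) auto
        moreover have "m (Suc k) = 2 * (real n * (2 * L (v (Suc k))) / (v k)\<^sup>2)"
          unfolding m_def half by (simp add: power_divide)
        ultimately have "2 * m k \<le> m (Suc k)" unfolding m_def[of k] by linarith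
        then show ?case using Suc.IH[OF wk] by simp
      qed
      define a where "a = exp (K - (K - C - 1) * r)"
      have B: "(\<integral>\<^sup>+\<omega>. ennreal (B \<theta> k \<omega>) \<partial>M) \<le> ennreal (exp (- (K - C - 1) * r) * (1 / 2) ^ k)"
        if k: "w\<^sub>0 \<le> v k" and \<theta>: "\<bar>\<theta>\<bar> = 2 * l" for k \<theta>
      proof -
        have "v\<^sub>0 \<le> 1 / K * v k" using k K by (simp add: w\<^sub>0_def field_simps)
        moreover have "v\<^sub>0 \<le> v k" using k w\<^sub>0 v\<^sub>0 by linarith
        ultimately have "(\<integral>\<^sup>+\<omega>. ennreal (B \<theta> k \<omega>) \<partial>M) \<le> ennreal (exp (real n * L (v k) / (v k)\<^sup>2
            * ((\<bar>\<theta>\<bar> + 1)\<^sup>2 / 2 * exp (\<bar>\<theta>\<bar> + 1) - K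
              + \<epsilon> * (\<bar>\<theta>\<bar> + K ^ 3 * (exp \<bar>\<theta>\<bar> + \<bar>\<theta>\<bar> + K)))))"
          unfolding B_def using K \<epsilon> by (intro shell_mgf_le[OF iid vpos] tails) auto
        also have "\<dots> = ennreal (exp (m k * (C - K + \<epsilon> * cB)))"
          unfolding \<theta> C_def cB_def m_def ..
        also have "\<dots> \<le> ennreal (exp (- (K - C - 1) * r) * (1 / 2) ^ k)"
        proof (rule ennreal_leI)
          have "0 \<le> m k" using L_nonneg by (simp add: m_def)
          then have "m k * (C - K + \<epsilon> * cB) \<le> m k * (- (K - C - 1))"
            using \<epsilon>(3) by (intro mult_left_mono) auto
          also have "\<dots> = - ((K - C - 1) * m k)" by (simp add: algebra_simps)
          also have "\<dots> \<le> - ((K - C - 1) * (r + k))"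
          proof -
            have "real k + 1 \<le> 2 ^ k" using of_nat_less_two_power[of k, where ?'a = real] by (simp add: add.commute Suc_le_eq)
                (metis Suc_leI add.commute less_exp of_nat_Suc of_nat_le_iff of_nat_numeral of_nat_power)
            then have "r * (real k + 1) \<le> m k" using m[OF k] mult_left_mono[of "real k + 1" "2 ^ k" r] r by linarith
            moreover have "real k \<le> r * real k" using r mult_right_mono[of 1 r "real k"] by simp
            ultimately have "r + k \<le> m k" by (simp add: algebra_simps)
            then show ?thesis using K by (simp add: mult_left_mono)
          qed
          also have "\<dots> \<le> - (K - C - 1) * r - real k"
            using K mult_right_mono[of 1 "K - C - 1" "real k"] by (simp add: algebra_simps)
          finally have "exp (m k * (C - K + \<epsilon> * cB)) \<le> exp (- (K - C - 1) * r) * exp (- real k)"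
            by (simp add: exp_add[symmetric])
          also have "exp (- real k) = exp (- 1) ^ k" by (simp add: exp_of_nat_mult[symmetric])
          also have "exp (- 1) ^ k \<le> (1 / 2 :: real) ^ k"
            using exp_ge_add_one_self[of 1] by (intro power_mono) (auto simp: exp_minus field_simps)
          finally show "exp (m k * (C - K + \<epsilon> * cB)) \<le> exp (- (K - C - 1) * r) * (1 / 2) ^ k"
            by (simp add: mult_left_mono)
        qed
        finally show ?thesis .
      qed
      have Bsum: "(\<integral>\<^sup>+\<omega>. ennreal (\<Sum>k<N. if w\<^sub>0 \<le> v k then exp K * (B (2 * l) k \<omega> + B (- (2 * l)) k \<omega>) else 0) \<partial>M)
          \<le> ennreal (\<Sum>k<N. 2 * a * (1 / 2) ^ k)"
      proof (rule nn_integral_sum_le)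
        fix k assume "k < N"
        show "(\<integral>\<^sup>+\<omega>. ennreal (if w\<^sub>0 \<le> v k then exp K * (B (2 * l) k \<omega> + B (- (2 * l)) k \<omega>) else 0) \<partial>M)
          \<le> ennreal (2 * a * (1 / 2) ^ k)"
        proof (cases "w\<^sub>0 \<le> v k")
          case True
          have "a = exp K * exp (- (K - C - 1) * r)" unfolding a_def exp_add[symmetric] by (simp add: algebra_simps)
          then have eq: "exp K * (exp (- (K - C - 1) * r) * (1 / 2) ^ k + exp (- (K - C - 1) * r) * (1 / 2) ^ k)
              = 2 * a * (1 / 2) ^ k" by simp
          have le: "(\<integral>\<^sup>+\<omega>. ennreal (exp K * (B (2 * l) k \<omega> + B (- (2 * l)) k \<omega>)) \<partial>M)
            \<le> ennreal (exp K * (exp (- (K - C - 1) * r) * (1 / 2) ^ k + exp (- (K - C - 1) * r) * (1 / 2) ^ k))"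
            using nonneg l True
            by (intro nn_integral_cmult_le nn_integral_add_le B) auto
          show ?thesis using le[unfolded eq] True by simp
        qed (simp add: a_def)
      qed (use nonneg in \<open>auto simp: a_def\<close>)
      have "(\<Sum>k<N. 2 * a * (1 / 2) ^ k) \<le> 2 * (2 * a)" by (rule sum_half_powers_le) (simp add: a_def)
      also have "\<dots> \<le> \<eta> / 3" using K(3) by (simp add: a_def)
      finally have Bsum': "(\<integral>\<^sup>+\<omega>. ennreal (\<Sum>k<N. if w\<^sub>0 \<le> v k then exp K * (B (2 * l) k \<omega> + B (- (2 * l)) k \<omega>) else 0) \<partial>M)
          \<le> ennreal (\<eta> / 3)"
        using Bsum by (meson ennreal_leI order_trans)
      have "(\<integral>\<^sup>+\<omega>. ennreal (D \<omega>) \<partial>M) \<le> ennreal (exp (- (real n * (L w\<^sub>0 / (2 * w\<^sub>0\<^sup>2)))))"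
        unfolding D_def by (rule small_region_mgf_le[OF iid w\<^sub>0(1)])
      also have "\<dots> \<le> ennreal (exp (- (real n * (c / (2 * w\<^sub>0\<^sup>2)))))"
      proof -
        have "c \<le> L w\<^sub>0" using w\<^sub>0 v\<^sub>0 by (intro Lw) auto
        then show ?thesis by (intro ennreal_leI) (auto intro!: mult_left_mono divide_right_mono)
      qed
      finally have "(\<integral>\<^sup>+\<omega>. ennreal (exp (l * sqrt n) * (exp 1 * D \<omega>)) \<partial>M)
          \<le> ennreal (exp (l * sqrt n) * (exp 1 * exp (- (real n * (c / (2 * w\<^sub>0\<^sup>2))))))"
        by (intro nn_integral_cmult_le) auto
      also have "\<dots> \<le> ennreal (\<eta> / 3)" using elim(2) by (rule ennreal_leI)
      finally have D: "(\<integral>\<^sup>+\<omega>. ennreal (exp (l * sqrt n) * (exp 1 * D \<omega>)) \<partial>M) \<le> ennreal (\<eta> / 3)" .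
      have "(\<integral>\<^sup>+\<omega>. ennreal (?SN \<omega>) \<partial>M) \<le> (\<integral>\<^sup>+\<omega>. ennreal (bnd \<omega>) \<partial>M)"
        by (intro nn_integral_mono ennreal_leI pointwise)
      also have "\<dots> \<le> ennreal ((exp (l\<^sup>2 * r ^ 3 / 2 + (r - 1)) + exp (l\<^sup>2 * r ^ 3 / 2 + (r - 1))) + (\<eta> / 3 + \<eta> / 3))"
        unfolding bnd_def
        using nonneg snn l r \<eta>
        by (intro nn_integral_add_le A Bsum' D) auto
      also have "\<dots> \<le> ennreal (2 * exp (l\<^sup>2 / 2) + \<eta>)" using r(3) by (intro ennreal_leI) simp
      finally show "(\<integral>\<^sup>+\<omega>. ennreal (?SN \<omega>) \<partial>M) \<le> ennreal (2 * exp (l\<^sup>2 / 2) + \<eta>)" .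
    qed
  qed
qed

section \<open>Characteristic functions under weak convergence\<close>

lemma cmod_iexp_diff_le: "cmod (iexp a - iexp b) \<le> \<bar>a - b\<bar>" for a b :: real
proof -
  have "iexp a - iexp b = iexp b * (iexp (a - b) - 1)"
    by (simp add: right_diff_distrib exp_add[symmetric])
  then have "cmod (iexp a - iexp b) = cmod (iexp (a - b) - 1)" by (simp add: norm_mult)
  then show ?thesis using iexp_approx1[of "a - b" 0] by simp
qed

text \<open>In Skorohod's representation the variables converge pointwise, and
  \<open>\<bar>exp (i t y) - exp (i t z)\<bar> \<le> min 2 (T \<bar>y - z\<bar>)\<close> is a dominated bound that does not depend on \<open>t\<close>.\<close>

theorem weak_conv_imp_char_uniform:
  fixes \<mu> :: "nat \<Rightarrow> real measure" and \<nu> :: "real measure"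
  assumes "\<And>n. real_distribution (\<mu> n)" "real_distribution \<nu>" "weak_conv_m \<mu> \<nu>" and \<delta>: "0 < \<delta>" and T: "0 \<le> T"
  shows "\<forall>\<^sub>F n in sequentially. \<forall>t. \<bar>t\<bar> \<le> T \<longrightarrow> cmod (char (\<mu> n) t - char \<nu> t) < \<delta>"
proof -
  obtain \<Omega> :: "real measure" and Y_seq Y where ps: "prob_space \<Omega>"
    and meas [measurable]: "\<And>n. Y_seq n \<in> borel_measurable \<Omega>" and dn: "\<And>n. distr \<Omega> borel (Y_seq n) = \<mu> n"
    and measY [measurable]: "Y \<in> borel_measurable \<Omega>" and d: "distr \<Omega> borel Y = \<nu>"
    and conv: "\<And>x. x \<in> space \<Omega> \<Longrightarrow> (\<lambda>n. Y_seq n x) \<longlonglongrightarrow> Y x"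
    using Skorohod[OF assms(1-3)] by force
  interpret prob_space \<Omega> by (rule ps)
  define D where "D n = (\<integral>x. min 2 (T * \<bar>Y_seq n x - Y x\<bar>) \<partial>\<Omega>)" for n
  have "D \<longlonglongrightarrow> (\<integral>x. 0 \<partial>\<Omega>)"
    unfolding D_def
  proof (rule integral_dominated_convergence[where w = "\<lambda>_. 2"])
    show "AE x in \<Omega>. (\<lambda>n. min 2 (T * \<bar>Y_seq n x - Y x\<bar>)) \<longlonglongrightarrow> 0"
    proof (rule AE_I2)
      fix x assume "x \<in> space \<Omega>"
      then have "(\<lambda>n. min 2 (T * \<bar>Y_seq n x - Y x\<bar>)) \<longlonglongrightarrow> min 2 (T * \<bar>Y x - Y x\<bar>)"
        by (intro tendsto_intros conv)
      then show "(\<lambda>n. min 2 (T * \<bar>Y_seq n x - Y x\<bar>)) \<longlonglongrightarrow> 0" by simp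
    qed
    show "AE x in \<Omega>. norm (min 2 (T * \<bar>Y_seq n x - Y x\<bar>)) \<le> 2" for n
      using T by (intro AE_I2) (simp add: min_def)
  qed auto
  then have "\<forall>\<^sub>F n in sequentially. D n < \<delta>" using \<delta> by (intro order_tendstoD(2)) auto
  then show ?thesis
  proof eventually_elim
    case (elim n)
    show ?case
    proof (intro allI impI)
      fix t :: real assume t: "\<bar>t\<bar> \<le> T"
      have int: "integrable \<Omega> (\<lambda>x. iexp (t * Y_seq n x))" "integrable \<Omega> (\<lambda>x. iexp (t * Y x))"
        by (intro integrable_iexp; simp)+
      have "char (\<mu> n) t - char \<nu> t = (CLINT x|\<Omega>. iexp (t * Y_seq n x)) - (CLINT x|\<Omega>. iexp (t * Y x))"
        unfolding char_def dn[symmetric] d[symmetric] by (simp add: integral_distr)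
      also have "\<dots> = (CLINT x|\<Omega>. iexp (t * Y_seq n x) - iexp (t * Y x))" using int by simp
      also have "cmod \<dots> \<le> (\<integral>x. cmod (iexp (t * Y_seq n x) - iexp (t * Y x)) \<partial>\<Omega>)" by (rule integral_norm_bound)
      also have "\<dots> \<le> D n"
        unfolding D_def
      proof (rule integral_mono)
        show "integrable \<Omega> (\<lambda>x. cmod (iexp (t * Y_seq n x) - iexp (t * Y x)))"
          using int by (intro integrable_norm Bochner_Integration.integrable_diff)
        show "integrable \<Omega> (\<lambda>x. min 2 (T * \<bar>Y_seq n x - Y x\<bar>))"
          by (rule integrable_const_bound[where B = 2]) (use T in \<open>auto simp: min_def\<close>)
        fix x
        have "cmod (iexp (t * Y_seq n x) - iexp (t * Y x)) \<le> cmod (iexp (t * Y_seq n x)) + cmod (iexp (t * Y x))"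
          by (rule norm_triangle_ineq4)
        moreover have "cmod (iexp (t * Y_seq n x) - iexp (t * Y x)) \<le> \<bar>t\<bar> * \<bar>Y_seq n x - Y x\<bar>"
          using cmod_iexp_diff_le[of "t * Y_seq n x" "t * Y x"] by (simp add: right_diff_distrib[symmetric] abs_mult)
        moreover have "\<bar>t\<bar> * \<bar>Y_seq n x - Y x\<bar> \<le> T * \<bar>Y_seq n x - Y x\<bar>" using t by (intro mult_right_mono) auto
        ultimately show "cmod (iexp (t * Y_seq n x) - iexp (t * Y x)) \<le> min 2 (T * \<bar>Y_seq n x - Y x\<bar>)" by simp
      qed
      finally show "cmod (char (\<mu> n) t - char \<nu> t) < \<delta>" using elim by linarith
    qed
  qed
qed

text \<open>Taking logarithms gives \<open>n ln (x n) \<rightarrow> - c\<close>, and \<open>1 - x\<close> lies between \<open>- x ln x\<close> and \<open>- ln x\<close>.\<close>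

lemma tendsto_root_power_exp:
  fixes x :: "nat \<Rightarrow> real"
  assumes x: "\<And>n. 0 \<le> x n" "\<And>n. x n \<le> 1" and lim: "(\<lambda>n. x n ^ n) \<longlonglongrightarrow> exp (- c)"
  shows "(\<lambda>n. real n * (1 - x n)) \<longlonglongrightarrow> c"
proof -
  have "\<forall>\<^sub>F n in sequentially. exp (- c) / 2 < x n ^ n" using lim by (intro order_tendstoD(1)) auto
  moreover have "\<forall>\<^sub>F n :: nat in sequentially. 0 < n" by (rule eventually_gt_at_top)
  ultimately have pos: "\<forall>\<^sub>F n in sequentially. 0 < x n \<and> 0 < n"
  proof eventually_elim
    case (elim n)
    have "0 < x n ^ n" using elim exp_gt_zero[of "- c"] by (smt (verit) half_gt_zero)
    then have "x n \<noteq> 0" using elim by (auto simp: power_0_left)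
    then show ?case using x(1)[of n] elim by simp
  qed
  have "(\<lambda>n. ln (x n ^ n)) \<longlonglongrightarrow> ln (exp (- c))" by (intro tendsto_ln lim) simp
  then have "(\<lambda>n. - ln (x n ^ n)) \<longlonglongrightarrow> c" using tendsto_minus by fastforce
  moreover have "\<forall>\<^sub>F n in sequentially. - ln (x n ^ n) = real n * - ln (x n)"
    using pos by eventually_elim (simp add: ln_realpow)
  ultimately have up: "(\<lambda>n. real n * - ln (x n)) \<longlonglongrightarrow> c" by (simp add: tendsto_cong)
  then have "(\<lambda>n. 1 / real n * (real n * - ln (x n))) \<longlonglongrightarrow> 0 * c"
    by (intro tendsto_mult lim_1_over_n)
  moreover have "\<forall>\<^sub>F n in sequentially. 1 / real n * (real n * - ln (x n)) = - ln (x n)"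
    using pos by eventually_elim simp
  ultimately have "(\<lambda>n. - ln (x n)) \<longlonglongrightarrow> 0 * c" by (rule Lim_transform_eventually)
  then have "(\<lambda>n. - ln (x n)) \<longlonglongrightarrow> 0" by simp
  then have "(\<lambda>n. exp (- (- ln (x n)))) \<longlonglongrightarrow> exp (- 0)" by (intro tendsto_exp tendsto_minus)
  moreover have "\<forall>\<^sub>F n in sequentially. exp (- (- ln (x n))) = x n" using pos by eventually_elim simp
  ultimately have "x \<longlonglongrightarrow> exp (- 0)" by (rule Lim_transform_eventually)
  then have "x \<longlonglongrightarrow> 1" by simp
  then have low: "(\<lambda>n. x n * (real n * - ln (x n))) \<longlonglongrightarrow> 1 * c" by (intro tendsto_mult up)
  show ?thesis
  proof (rule tendsto_sandwich[OF _ _ _ up])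
    show "(\<lambda>n. x n * (real n * - ln (x n))) \<longlonglongrightarrow> c" using low by simp
    show "\<forall>\<^sub>F n in sequentially. real n * (1 - x n) \<le> real n * - ln (x n)"
      using pos by eventually_elim (use ln_le_minus_one in \<open>fastforce intro!: mult_left_mono\<close>)
    show "\<forall>\<^sub>F n in sequentially. x n * (real n * - ln (x n)) \<le> real n * (1 - x n)"
      using pos
    proof eventually_elim
      case (elim n)
      have "ln (1 / x n) \<le> 1 / x n - 1" using elim by (intro ln_le_minus_one) simp
      then have "x n * - ln (x n) \<le> x n * (1 / x n - 1)" using elim by (intro mult_left_mono) (simp_all add: ln_div)
      also have "\<dots> = 1 - x n" using elim by (simp add: right_diff_distrib)
      finally have "real n * (x n * - ln (x n)) \<le> real n * (1 - x n)" by (intro mult_left_mono) auto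
      then show ?case by (simp add: mult.left_commute)
    qed
  qed
qed

lemma power_ge_imp_deficit_le:
  fixes x :: real
  assumes "0 \<le> x" "x \<le> 1" "c \<le> x ^ n" "0 < c"
  shows "real n * (1 - x) \<le> - ln c"
proof -
  have "x \<le> exp (x - 1)" using exp_ge_add_one_self[of "x - 1"] by simp
  then have "x ^ n \<le> exp (x - 1) ^ n" using assms by (intro power_mono)
  then have "c \<le> exp (real n * (x - 1))" using assms by (simp add: exp_of_nat_mult)
  then have "ln c \<le> ln (exp (real n * (x - 1)))" using assms by (subst ln_le_cancel_iff) auto
  then show ?thesis by (simp add: right_diff_distrib)
qed

lemma sin_minus_self_le: "\<bar>sin y - y\<bar> \<le> y\<^sup>2 / 2" for y :: real
  using Maclaurin_sin_bound[of y 2] by (simp add: sin_coeff_def numeral_2_eq_2 power2_eq_square)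

lemma one_minus_cos_ge: "\<bar>y\<bar> \<le> 1 \<Longrightarrow> y\<^sup>2 / 4 \<le> 1 - cos y" for y :: real
proof -
  assume y: "\<bar>y\<bar> \<le> 1"
  have "\<bar>sin (y / 2)\<bar> \<ge> \<bar>y / 2\<bar> - \<bar>y / 2\<bar> * \<bar>y / 2\<bar> / 2"
    using sin_minus_self_le[of "y / 2"] by (simp only: power2_eq_square abs_mult_self_eq)
  moreover have "\<bar>y / 2\<bar> * \<bar>y / 2\<bar> \<le> \<bar>y / 2\<bar> * (1 / 2)" using y by (intro mult_left_mono) auto
  ultimately have "3 / 4 * \<bar>y / 2\<bar> \<le> \<bar>sin (y / 2)\<bar>" by linarith
  then have "(3 / 4 * \<bar>y / 2\<bar>)\<^sup>2 \<le> (sin (y / 2))\<^sup>2" using power_mono[of "3 / 4 * \<bar>y / 2\<bar>" "\<bar>sin (y / 2)\<bar>" 2] by simp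
  then have "y\<^sup>2 * (9 / 32) \<le> 2 * (sin (y / 2))\<^sup>2" by (simp add: power_mult_distrib power_divide)
  moreover have "1 - cos y = 2 * (sin (y / 2))\<^sup>2" using cos_double_sin[of "y / 2"] by simp
  moreover have "0 \<le> y\<^sup>2" by simp
  ultimately show ?thesis by linarith
qed

lemma one_minus_cos_le: "1 - cos y \<le> 2 * min 1 ((y / 2)\<^sup>2)" for y :: real
proof -
  have "1 - cos y = 2 * (sin (y / 2))\<^sup>2" using cos_double_sin[of "y / 2"] by simp
  moreover have "(sin (y / 2))\<^sup>2 \<le> (y / 2)\<^sup>2" by (simp only: abs_le_square_iff[symmetric] abs_sin_x_le_abs_x)
  moreover have "(sin (y / 2))\<^sup>2 \<le> 1" by (simp add: abs_square_le_1)
  ultimately show ?thesis by simp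
qed

section \<open>The deficit of the characteristic function near zero\<close>

context centred_law begin

definition tail_prob :: "real \<Rightarrow> real" where
  "tail_prob v = (\<integral>x. (if \<bar>x\<bar> \<le> v then 0 else 1) \<partial>Q)"

text \<open>One minus the real part of the characteristic function.\<close>

definition cos_deficit :: "real \<Rightarrow> real" where
  "cos_deficit s = (\<integral>x. 1 - cos (s * x) \<partial>Q)"

lemma integrable_cos: "integrable Q (\<lambda>x. cos (s * x))" and integrable_sin: "integrable Q (\<lambda>x. sin (s * x))"
  by (rule integrable_const_bound[where B = 1]; auto intro!: AE_I2)+

lemma Re_char: "Re (char Q s) = 1 - cos_deficit s" and Im_char: "Im (char Q s) = (\<integral>x. sin (s * x) \<partial>Q)"
proof -
  have int: "integrable Q (\<lambda>x. iexp (s * x))" by (rule integrable_iexp) auto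
  have "Re (char Q s) = (\<integral>x. cos (s * x) \<partial>Q)" unfolding char_def
    using integral_Re[OF int] by (simp add: Re_exp)
  also have "\<dots> = 1 - cos_deficit s" using integrable_cos[of s] prob_space by (simp add: cos_deficit_def)
  finally show "Re (char Q s) = 1 - cos_deficit s" .
  show "Im (char Q s) = (\<integral>x. sin (s * x) \<partial>Q)" unfolding char_def
    using integral_Im[OF int] by (simp add: Im_exp)
qed

lemma cos_deficit_measurable [measurable]: "cos_deficit \<in> borel_measurable borel"
proof -
  have "cos_deficit = (\<lambda>s. 1 - Re (char Q s))" by (simp add: Re_char)
  then show ?thesis by simp
qed

lemma cos_deficit_nonneg: "0 \<le> cos_deficit s"
  unfolding cos_deficit_def by (rule integral_nonneg_AE) auto

lemma cos_deficit_tendsto_0: "(cos_deficit \<longlongrightarrow> 0) (at_right 0)"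
proof -
  have "(char Q \<longlongrightarrow> char Q 0) (at 0)" using isCont_char[of 0] by (simp add: isCont_def)
  then have "((\<lambda>s. 1 - Re (char Q s)) \<longlongrightarrow> 1 - Re (char Q 0)) (at 0)" by (intro tendsto_intros)
  then have "(cos_deficit \<longlongrightarrow> 0) (at 0)" by (simp add: Re_char char_zero)
  then show ?thesis by (rule filterlim_mono) (auto simp: at_le)
qed

text \<open>A nondegenerate law has a deficit of at least quadratic order.\<close>

lemma cos_deficit_ge:
  assumes "0 \<le> s" "s * w \<le> 1"
  shows "s\<^sup>2 * L w / 4 \<le> cos_deficit s"
proof -
  have "s\<^sup>2 / 4 * L w = (\<integral>x. s\<^sup>2 / 4 * (if \<bar>x\<bar> \<le> w then x\<^sup>2 else 0) \<partial>Q)"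
    by (simp add: truncated_second_moment_def)
  also have "\<dots> \<le> cos_deficit s"
    unfolding cos_deficit_def
  proof (rule integral_mono)
    show "integrable Q (\<lambda>x. 1 - cos (s * x))" using integrable_cos by auto
    fix x :: real
    show "s\<^sup>2 / 4 * (if \<bar>x\<bar> \<le> w then x\<^sup>2 else 0) \<le> 1 - cos (s * x)"
    proof (cases "\<bar>x\<bar> \<le> w")
      case True
      then have "\<bar>s * x\<bar> \<le> 1" using assms mult_left_mono[of "\<bar>x\<bar>" w s] by (simp add: abs_mult)
      then show ?thesis using True one_minus_cos_ge[of "s * x"] by (simp add: power_mult_distrib)
    qed simp
  qed (rule integrable_mult_right[OF integrable_truncated_square])
  finally show ?thesis by simp
qed

lemma J_tendsto_0: "(J \<longlongrightarrow> 0) at_top"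
proof -
  have "((\<lambda>v. J v) \<longlongrightarrow> (\<integral>x. 0 \<partial>Q)) at_top"
    unfolding tail_first_moment_def
  proof (rule integral_dominated_convergence_at_top[where w = "\<lambda>x. \<bar>x\<bar>"])
    show "AE x in Q. ((\<lambda>v. if \<bar>x\<bar> \<le> v then 0 else \<bar>x\<bar>) \<longlongrightarrow> 0) at_top"
    proof (rule AE_I2)
      fix x :: real
      have "\<forall>\<^sub>F v in at_top. (if \<bar>x\<bar> \<le> v then 0 else \<bar>x\<bar>) = 0"
        using eventually_ge_at_top[of "\<bar>x\<bar>"] by eventually_elim simp
      then show "((\<lambda>v. if \<bar>x\<bar> \<le> v then 0 else \<bar>x\<bar>) \<longlongrightarrow> 0) at_top" by (rule tendsto_eventually)
    qed
    show "\<forall>\<^sub>F v in at_top. AE x in Q. norm (if \<bar>x\<bar> \<le> v then 0 else \<bar>x\<bar>) \<le> \<bar>x\<bar>"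
      by (intro always_eventually allI AE_I2) simp
    show "integrable Q (\<lambda>x. \<bar>x\<bar>)" using integrable_id by simp
  qed simp_all
  then show ?thesis by simp
qed

text \<open>Up to \<open>v\<close> the sine is replaced by its argument, whose truncated mean is controlled by \<open>J v\<close>.  Beyond
  \<open>v\<close>, \<open>\<bar>sin\<bar> \<le> sin\<^sup>2 / (2 \<kappa>) + \<kappa> / 2\<close> and \<open>sin\<^sup>2 \<le> 2 (1 - cos)\<close>; the parameter \<open>\<kappa>\<close> is left free in order to
  play the part of the Cauchy-Schwarz inequality.\<close>

lemma sine_part_le:
  assumes s: "0 < s" and v: "0 < v" and \<kappa>: "0 < \<kappa>"
  shows "\<bar>\<integral>x. sin (s * x) \<partial>Q\<bar> \<le> s * J v + s\<^sup>2 * v\<^sup>2 / 2 + (cos_deficit s / \<kappa> + \<kappa> / 2 * (J v / v))"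
proof -
  let ?i = "\<lambda>x. if \<bar>x\<bar> \<le> v then x else 0"
  let ?e = "\<lambda>x. s\<^sup>2 * v\<^sup>2 / 2 + ((1 - cos (s * x)) / \<kappa> + \<kappa> / 2 * (if \<bar>x\<bar> \<le> v then 0 else 1))"
  have int: "integrable Q ?i" "integrable Q (\<lambda>x. sin (s * x))" "integrable Q ?e"
    using integrable_truncated_id integrable_sin integrable_cos[of s] integrable_tail_indicator[of v] by auto
  have "\<bar>sin (s * x) - s * ?i x\<bar> \<le> ?e x" for x
  proof (cases "\<bar>x\<bar> \<le> v")
    case True
    have "x\<^sup>2 \<le> v\<^sup>2" using True by (intro abs_le_square_iff[THEN iffD1]) simp
    then have "(s * x)\<^sup>2 / 2 \<le> s\<^sup>2 * v\<^sup>2 / 2" by (simp add: power_mult_distrib mult_left_mono)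
    moreover have "0 \<le> (1 - cos (s * x)) / \<kappa>" using \<kappa> by simp
    ultimately show ?thesis using sin_minus_self_le[of "s * x"] True by simp
  next
    case False
    have "(sin (s * x))\<^sup>2 = (1 - cos (s * x)) * (1 + cos (s * x))"
      using sin_cos_squared_add[of "s * x"] by (simp add: power2_eq_square algebra_simps)
    also have "\<dots> \<le> (1 - cos (s * x)) * 2" by (intro mult_left_mono) auto
    finally have sq: "(sin (s * x))\<^sup>2 \<le> 2 * (1 - cos (s * x))" by simp
    have "0 \<le> (\<bar>sin (s * x)\<bar> - \<kappa>)\<^sup>2" by simp
    then have "2 * \<kappa> * \<bar>sin (s * x)\<bar> \<le> (sin (s * x))\<^sup>2 + \<kappa>\<^sup>2" by (simp add: power2_diff mult_ac)
    also have "\<dots> \<le> 2 * (1 - cos (s * x)) + \<kappa>\<^sup>2" using sq by simp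
    finally have "\<bar>sin (s * x)\<bar> \<le> (1 - cos (s * x)) / \<kappa> + \<kappa> / 2"
      using \<kappa> by (simp add: field_simps power2_eq_square)
    moreover have "0 \<le> s\<^sup>2 * v\<^sup>2 / 2" by simp
    ultimately have "\<bar>sin (s * x)\<bar> \<le> s\<^sup>2 * v\<^sup>2 / 2 + ((1 - cos (s * x)) / \<kappa> + \<kappa> / 2)" by linarith
    then show ?thesis using False by simp
  qed
  then have "(\<integral>x. \<bar>sin (s * x) - s * ?i x\<bar> \<partial>Q) \<le> (\<integral>x. ?e x \<partial>Q)"
    using int by (intro integral_mono) auto
  also have "\<dots> = s\<^sup>2 * v\<^sup>2 / 2 + (cos_deficit s / \<kappa> + \<kappa> / 2 * tail_prob v)"
    using integrable_cos[of s] integrable_tail_indicator[of v] prob_space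
    by (simp add: cos_deficit_def tail_prob_def)
  also have "\<dots> \<le> s\<^sup>2 * v\<^sup>2 / 2 + (cos_deficit s / \<kappa> + \<kappa> / 2 * (J v / v))"
    using tail_prob_le[OF v] \<kappa> unfolding tail_prob_def by (intro add_left_mono mult_left_mono) auto
  finally have "\<bar>\<integral>x. sin (s * x) - s * ?i x \<partial>Q\<bar> \<le> s\<^sup>2 * v\<^sup>2 / 2 + (cos_deficit s / \<kappa> + \<kappa> / 2 * (J v / v))"
    using integral_abs_bound[of Q "\<lambda>x. sin (s * x) - s * ?i x"] by linarith
  moreover have "(\<integral>x. sin (s * x) - s * ?i x \<partial>Q) = (\<integral>x. sin (s * x) \<partial>Q) - s * (\<integral>x. ?i x \<partial>Q)" using int by simp
  moreover have "\<bar>s * (\<integral>x. ?i x \<partial>Q)\<bar> \<le> s * J v"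
    using truncated_mean_le[of v] s by (simp add: abs_mult)
  ultimately show ?thesis by linarith
qed

text \<open>The square of the imaginary part of the characteristic function is of smaller order than the deficit
  of the real part.  With \<open>\<kappa>\<close> proportional to the square root \<open>R\<close> of the deficit, all four terms of the
  preceding bound are small multiples of \<open>R\<close>, since \<open>s\<close> itself is at most a multiple of \<open>R\<close>.  This is
  the place where the vanishing mean enters.\<close>

lemma sine_part_negligible:
  assumes w: "0 < L w" and \<delta>: "0 < \<delta>"
  shows "\<forall>\<^sub>F s in at_right 0. 0 < cos_deficit s \<and> \<bar>\<integral>x. sin (s * x) \<partial>Q\<bar> \<le> \<delta> * sqrt (cos_deficit s)"
proof -
  have wpos: "0 < w"
  proof (rule ccontr)
    assume "\<not> 0 < w"
    then have "(if \<bar>x\<bar> \<le> w then x\<^sup>2 else 0) = 0" for x :: real by auto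
    then show False using w by (simp add: truncated_second_moment_def)
  qed
  define A where "A = sqrt (L w) / 2"
  have A: "0 < A" using w by (simp add: A_def)
  define \<delta>' where "\<delta>' = \<delta> / 4"
  have \<delta>': "0 < \<delta>'" using \<delta> by (simp add: \<delta>'_def)
  have "\<forall>\<^sub>F v in at_top. J v < min (\<delta>' * A) (2 * \<delta>'\<^sup>2)"
    using J_tendsto_0 \<delta>' A by (intro order_tendstoD(2)) auto
  then have "\<forall>\<^sub>F v in at_top. J v < min (\<delta>' * A) (2 * \<delta>'\<^sup>2) \<and> 1 \<le> v"
    using eventually_ge_at_top[of 1] by eventually_elim simp
  then obtain v where v: "J v < \<delta>' * A" "J v < 2 * \<delta>'\<^sup>2" "1 \<le> v"
    using eventually_happens[of _ "at_top :: real filter"] by auto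
  have "\<forall>\<^sub>F s in at_right 0. s \<in> {0<..<min (1 / w) (2 * (\<delta>' * A) / v\<^sup>2)}"
    using wpos A \<delta>' v by (intro eventually_at_right_real) auto
  then show ?thesis
  proof eventually_elim
    case (elim s)
    then have s: "0 < s" "s * w \<le> 1" "s * v\<^sup>2 / 2 \<le> \<delta>' * A"
      using wpos v by (auto simp: field_simps)
    define R where "R = sqrt (cos_deficit s)"
    have ge: "s\<^sup>2 * L w / 4 \<le> cos_deficit s" using s by (intro cos_deficit_ge) auto
    moreover have "0 < s\<^sup>2 * L w / 4" using s w by simp
    ultimately have pos: "0 < cos_deficit s" by linarith
    then have R: "0 < R" "R * R = cos_deficit s" by (auto simp: R_def)
    have "sqrt (s\<^sup>2 * L w / 4) \<le> R" unfolding R_def using ge by (rule real_sqrt_le_mono)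
    then have sA: "s * A \<le> R" using s by (simp add: A_def real_sqrt_mult real_sqrt_divide)
    have "\<bar>\<integral>x. sin (s * x) \<partial>Q\<bar> \<le> s * J v + s\<^sup>2 * v\<^sup>2 / 2 + (cos_deficit s / (R / \<delta>') + R / \<delta>' / 2 * (J v / v))"
      using s v R \<delta>' by (intro sine_part_le) auto
    also have "\<dots> \<le> \<delta>' * R + \<delta>' * R + (\<delta>' * R + \<delta>' * R)"
    proof (intro add_mono)
      have "s * J v \<le> s * (\<delta>' * A)" using s v by (intro mult_left_mono) auto
      also have "\<dots> = \<delta>' * (s * A)" by simp
      also have "\<dots> \<le> \<delta>' * R" using sA \<delta>' by (intro mult_left_mono) auto
      finally show "s * J v \<le> \<delta>' * R" .
      have "s\<^sup>2 * v\<^sup>2 / 2 = s * (s * v\<^sup>2 / 2)" by (simp add: power2_eq_square)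
      also have "\<dots> \<le> s * (\<delta>' * A)" using s by (intro mult_left_mono) auto
      also have "\<dots> = \<delta>' * (s * A)" by simp
      also have "\<dots> \<le> \<delta>' * R" using sA \<delta>' by (intro mult_left_mono) auto
      finally show "s\<^sup>2 * v\<^sup>2 / 2 \<le> \<delta>' * R" .
      show "cos_deficit s / (R / \<delta>') \<le> \<delta>' * R" using R \<delta>' by (simp add: R(2)[symmetric])
      have "J v / v \<le> 2 * \<delta>'\<^sup>2" 
      proof -
        have "J v / v \<le> J v / 1" using v J_nonneg[of v] by (intro divide_left_mono) auto
        then show ?thesis using v by simp
      qed
      then have "R / \<delta>' / 2 * (J v / v) \<le> R / \<delta>' / 2 * (2 * \<delta>'\<^sup>2)" using R \<delta>' by (intro mult_left_mono) auto
      also have "\<dots> = \<delta>' * R" using \<delta>' by (simp add: power2_eq_square)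
      finally show "R / \<delta>' / 2 * (J v / v) \<le> \<delta>' * R" .
    qed
    also have "\<dots> = \<delta> * R" by (simp add: \<delta>'_def)
    finally show ?case using pos by (simp add: R_def)
  qed
qed

text \<open>Hence \<open>\<bar>\<phi>\<bar>\<^sup>2 = (1 - g)\<^sup>2 + o (g) = 1 - 2 g + o (g)\<close> for the deficit \<open>g\<close>: the modulus, which is
  insensitive to the centring of the sums, determines \<open>g\<close>.\<close>

lemma norm_char_deficit_ratio:
  assumes w: "0 < L w"
  shows "((\<lambda>s. (1 - (cmod (char Q s))\<^sup>2) / cos_deficit s) \<longlongrightarrow> 2) (at_right 0)"
proof -
  define I where "I s = (\<integral>x. sin (s * x) \<partial>Q)" for s
  have sq: "(cmod (char Q s))\<^sup>2 = (1 - cos_deficit s)\<^sup>2 + (I s)\<^sup>2" for s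
    by (simp add: cmod_power2 Re_char Im_char I_def)
  have pos: "\<forall>\<^sub>F s in at_right 0. 0 < cos_deficit s"
    using sine_part_negligible[OF w, of 1] by (auto elim: eventually_mono)
  have "((\<lambda>s. (I s)\<^sup>2 / cos_deficit s) \<longlongrightarrow> 0) (at_right 0)"
  proof (rule tendstoI)
    fix e :: real assume e: "0 < e"
    have "\<forall>\<^sub>F s in at_right 0. 0 < cos_deficit s \<and> \<bar>I s\<bar> \<le> sqrt (e / 2) * sqrt (cos_deficit s)"
      unfolding I_def using e by (intro sine_part_negligible[OF w]) simp
    then show "\<forall>\<^sub>F s in at_right 0. dist ((I s)\<^sup>2 / cos_deficit s) 0 < e"
    proof eventually_elim
      case (elim s)
      then have "\<bar>I s\<bar>\<^sup>2 \<le> (sqrt (e / 2) * sqrt (cos_deficit s))\<^sup>2" by (intro power_mono) auto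
      also have "\<dots> = e / 2 * cos_deficit s" using e elim by (simp add: power_mult_distrib)
      finally have "(I s)\<^sup>2 / cos_deficit s \<le> e / 2" using elim by (simp add: pos_divide_le_eq)
      then have "(I s)\<^sup>2 / cos_deficit s < e" using e by linarith
      moreover have "0 \<le> (I s)\<^sup>2 / cos_deficit s" using elim by simp
      ultimately show ?case by (simp only: dist_real_def diff_0_right abs_of_nonneg)
    qed
  qed
  then have "((\<lambda>s. 2 - cos_deficit s - (I s)\<^sup>2 / cos_deficit s) \<longlongrightarrow> 2 - 0 - 0) (at_right 0)"
    by (intro tendsto_intros cos_deficit_tendsto_0)
  moreover have "\<forall>\<^sub>F s in at_right 0. 2 - cos_deficit s - (I s)\<^sup>2 / cos_deficit s = (1 - (cmod (char Q s))\<^sup>2) / cos_deficit s"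
    unfolding sq using pos by eventually_elim (simp add: field_simps power2_eq_square)
  ultimately show ?thesis by (simp add: tendsto_cong)
qed

end

text \<open>For a single \<open>t\<close> the integrand may vanish at large \<open>y\<close>; averaged over an interval of \<open>t\<close> it stays away
  from zero.\<close>

lemma integral_one_minus_cos_sq_ge:
  fixes y :: real
  assumes y: "2 / 3 \<le> \<bar>y\<bar>"
  shows "5 \<le> (\<integral>\<^sup>+t. ennreal ((1 - cos (t * y))\<^sup>2) * indicator {0..6} t \<partial>lborel)"
proof -
  define F where "F t = 3 / 2 * t - 2 * sin (t * y) / y + sin (2 * t * y) / (4 * y)" for t
  have y0: "y \<noteq> 0" using y by auto
  have deriv: "(F has_real_derivative (1 - cos (t * y))\<^sup>2) (at t)" for t
  proof -
    have "(F has_real_derivative (3 / 2 - 2 * (cos (t * y) * y) / y + (cos (2 * t * y) * (2 * y)) / (4 * y))) (at t)"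
      unfolding F_def using y0 by (auto intro!: derivative_eq_intros)
    moreover have "3 / 2 - 2 * (cos (t * y) * y) / y + (cos (2 * t * y) * (2 * y)) / (4 * y) = (1 - cos (t * y))\<^sup>2"
      using y0 cos_double_cos[of "t * y"] by (simp add: power2_diff mult.assoc diff_divide_distrib)
    ultimately show ?thesis by simp
  qed
  have "(\<integral>\<^sup>+t. ennreal ((1 - cos (t * y))\<^sup>2) * indicator {0..6} t \<partial>lborel) = ennreal (F 6 - F 0)"
    using deriv by (intro nn_integral_FTC_Icc) auto
  moreover have "5 \<le> F 6 - F 0"
  proof -
    have inv: "1 / \<bar>y\<bar> \<le> 3 / 2" using y by (simp add: field_simps)
    define p q where "p = sin (6 * y) / y" and "q = sin (12 * y) / y"
    have "\<bar>p\<bar> \<le> 1 / \<bar>y\<bar>" "\<bar>q\<bar> \<le> 1 / \<bar>y\<bar>"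
      by (simp_all add: p_def q_def divide_right_mono)
    moreover have "F 6 - F 0 = 9 - 2 * p + q / 4" by (simp add: F_def p_def q_def)
    ultimately show ?thesis using inv by linarith
  qed
  ultimately show ?thesis by (metis ennreal_leI ennreal_numeral)
qed

section \<open>From a negligible tail probability to a negligible tail moment\<close>

context centred_law begin

text \<open>Unlike \<open>L\<close>, this function also charges the mass beyond \<open>v\<close>, so that \<open>U v / v\<^sup>2\<close> is monotone.\<close>

definition capped_second_moment :: "real \<Rightarrow> real" where
  "capped_second_moment v = (\<integral>x. min (v\<^sup>2) (x\<^sup>2) \<partial>Q)"

abbreviation "U \<equiv> capped_second_moment"

lemma integrable_capped_square: "integrable Q (\<lambda>x. min (v\<^sup>2) (x\<^sup>2))"
  by (rule integrable_const_bound[where B = "v\<^sup>2"]) (auto intro!: AE_I2 simp: min_def)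

lemma U_nonneg: "0 \<le> U v"
  unfolding capped_second_moment_def by (rule integral_nonneg_AE) auto

lemma tail_prob_antimono: "u \<le> v \<Longrightarrow> tail_prob v \<le> tail_prob u"
  unfolding tail_prob_def
  by (rule integral_mono[OF integrable_tail_indicator integrable_tail_indicator]) auto

lemma U_eq:
  assumes v: "0 \<le> v"
  shows "U v = L v + v\<^sup>2 * tail_prob v"
proof -
  have "U v = (\<integral>x. (if \<bar>x\<bar> \<le> v then x\<^sup>2 else 0) + v\<^sup>2 * (if \<bar>x\<bar> \<le> v then 0 else 1) \<partial>Q)"
    unfolding capped_second_moment_def
  proof (rule Bochner_Integration.integral_cong[OF refl])
    fix x :: real
    show "min (v\<^sup>2) (x\<^sup>2) = (if \<bar>x\<bar> \<le> v then x\<^sup>2 else 0) + v\<^sup>2 * (if \<bar>x\<bar> \<le> v then 0 else 1)"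
      using abs_le_square_iff[of x v] v by (auto simp: min_def)
  qed
  also have "\<dots> = (\<integral>x. (if \<bar>x\<bar> \<le> v then x\<^sup>2 else 0) \<partial>Q) + (\<integral>x. v\<^sup>2 * (if \<bar>x\<bar> \<le> v then 0 else 1) \<partial>Q)"
    by (intro Bochner_Integration.integral_add integrable_truncated_square integrable_mult_right integrable_tail_indicator)
  also have "\<dots> = L v + v\<^sup>2 * tail_prob v"
    unfolding truncated_second_moment_def tail_prob_def by (simp only: integral_mult_right_zero)
  finally show ?thesis .
qed

lemma U_double_le:
  assumes v: "0 \<le> v"
  shows "U (2 * v) \<le> U v + 3 * v\<^sup>2 * tail_prob v"
proof -
  have "min ((2 * v)\<^sup>2) (x\<^sup>2) \<le> min (v\<^sup>2) (x\<^sup>2) + 3 * v\<^sup>2 * (if \<bar>x\<bar> \<le> v then 0 else 1)" for x :: real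
    using abs_le_square_iff[of x v] v by (auto simp: min_def power_mult_distrib)
  then have "U (2 * v) \<le> (\<integral>x. min (v\<^sup>2) (x\<^sup>2) + 3 * v\<^sup>2 * (if \<bar>x\<bar> \<le> v then 0 else 1) \<partial>Q)"
    unfolding capped_second_moment_def
    by (intro integral_mono integrable_capped_square Bochner_Integration.integrable_add integrable_mult_right integrable_tail_indicator)
  also have "\<dots> = (\<integral>x. min (v\<^sup>2) (x\<^sup>2) \<partial>Q) + (\<integral>x. 3 * v\<^sup>2 * (if \<bar>x\<bar> \<le> v then 0 else 1) \<partial>Q)"
    by (intro Bochner_Integration.integral_add integrable_capped_square integrable_mult_right integrable_tail_indicator)
  also have "\<dots> = U v + 3 * v\<^sup>2 * tail_prob v"
    unfolding capped_second_moment_def tail_prob_def by (simp only: integral_mult_right_zero)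
  finally show ?thesis .
qed

lemma J_double_ge:
  assumes v: "0 \<le> v"
  shows "J v \<le> 2 * v * tail_prob v + J (2 * v)"
proof -
  have "J v \<le> (\<integral>x. 2 * v * (if \<bar>x\<bar> \<le> v then 0 else 1) + (if \<bar>x\<bar> \<le> 2 * v then 0 else \<bar>x\<bar>) \<partial>Q)"
    unfolding tail_first_moment_def
    by (intro integral_mono integrable_tail_abs Bochner_Integration.integrable_add integrable_mult_right integrable_tail_indicator)
       (use v in auto)
  also have "\<dots> = (\<integral>x. 2 * v * (if \<bar>x\<bar> \<le> v then 0 else 1) \<partial>Q) + (\<integral>x. (if \<bar>x\<bar> \<le> 2 * v then 0 else \<bar>x\<bar>) \<partial>Q)"
    by (intro Bochner_Integration.integral_add integrable_tail_abs integrable_mult_right integrable_tail_indicator)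
  also have "\<dots> = 2 * v * tail_prob v + J (2 * v)"
    unfolding tail_first_moment_def tail_prob_def by (simp only: integral_mult_right_zero)
  finally show ?thesis .
qed

text \<open>A negligible tail probability makes \<open>U\<close> slowly varying: \<open>U (2 v) \<le> 3/2 U v\<close>.  Iterating
  \<open>J v \<le> 2 v P (\<bar>X\<bar> > v) + J (2 v)\<close> then yields a geometric series, whose remainder tends to zero because
  the mean is finite.\<close>

lemma J_le_of_tail_prob:
  assumes v\<^sub>1: "0 < v\<^sub>1" and \<delta>: "0 < \<delta>" "\<delta> \<le> 1 / 6"
    and tail: "\<And>v. v\<^sub>1 \<le> v \<Longrightarrow> v\<^sup>2 * tail_prob v \<le> \<delta> * U v" and v: "v\<^sub>1 \<le> v"
  shows "v * J v \<le> 16 * \<delta> * L v"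
proof -
  have step: "J v \<le> 8 * \<delta> * U v / v + J (2 ^ n * v)" if "v\<^sub>1 \<le> v" for v n
    using that
  proof (induction n arbitrary: v)
    case 0
    then show ?case using U_nonneg[of v] \<delta> v\<^sub>1 by simp
  next
    case (Suc n)
    have v: "0 < v" using Suc.prems v\<^sub>1 by simp
    have "U (2 * v) \<le> U v + 3 * (v\<^sup>2 * tail_prob v)" using U_double_le[of v] v by simp
    also have "\<dots> \<le> U v + 3 * (\<delta> * U v)" using tail[OF Suc.prems] by simp
    also have "\<dots> \<le> 3 / 2 * U v" using mult_right_mono[OF \<delta>(2) U_nonneg[of v]] by simp
    finally have U2: "U (2 * v) \<le> 3 / 2 * U v" .
    have "J (2 * v) \<le> 8 * \<delta> * U (2 * v) / (2 * v) + J (2 ^ n * (2 * v))"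
      using Suc.prems v by (intro Suc.IH) simp
    also have "8 * \<delta> * U (2 * v) / (2 * v) \<le> 8 * \<delta> * (3 / 2 * U v) / (2 * v)"
      using U2 \<delta> v by (intro divide_right_mono mult_left_mono) auto
    also have "\<dots> = 6 * \<delta> * U v / v" by simp
    finally have J2: "J (2 * v) \<le> 6 * \<delta> * U v / v + J (2 ^ Suc n * v)" by (simp add: mult_ac)
    have "2 * v * tail_prob v = 2 * (v\<^sup>2 * tail_prob v) / v" using v by (simp add: power2_eq_square)
    also have "\<dots> \<le> 2 * (\<delta> * U v) / v" using tail[OF Suc.prems] v by (intro divide_right_mono mult_left_mono) auto
    finally have "2 * v * tail_prob v \<le> 2 * (\<delta> * U v / v)" by simp
    moreover have "6 * \<delta> * U v / v = 6 * (\<delta> * U v / v)" "8 * \<delta> * U v / v = 8 * (\<delta> * U v / v)" by simp_all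
    ultimately show ?case using J_double_ge[of v] J2 v by linarith
  qed
  have vpos: "0 < v" using v v\<^sub>1 by simp
  have "filterlim (\<lambda>n. v * 2 ^ n) at_top sequentially"
    using vpos by real_asymp
  then have "(\<lambda>n. J (2 ^ n * v)) \<longlonglongrightarrow> 0"
    using filterlim_compose[OF J_tendsto_0] by (simp add: mult.commute)
  then have "(\<lambda>n. 8 * \<delta> * U v / v + J (2 ^ n * v)) \<longlonglongrightarrow> 8 * \<delta> * U v / v + 0" by (intro tendsto_add tendsto_const)
  then have "J v \<le> 8 * \<delta> * U v / v + 0"
    by (rule LIMSEQ_le_const) (use step v in auto)
  then have "v * J v \<le> 8 * (\<delta> * U v)" using vpos by (simp add: field_simps)
  moreover have "U v \<le> 2 * L v"
  proof -
    have "U v \<le> L v + \<delta> * U v" using U_eq[of v] tail[OF v] vpos by simp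
    then show ?thesis using mult_right_mono[OF \<delta>(2) U_nonneg[of v]] L_nonneg[of v] by simp
  qed
  then have "8 * (\<delta> * U v) \<le> 8 * (\<delta> * (2 * L v))" using \<delta> by (intro mult_left_mono) auto
  ultimately show ?thesis by simp
qed

lemma cos_deficit_le:
  assumes v: "0 < v"
  shows "cos_deficit (2 / v) \<le> 2 * (U v / v\<^sup>2)"
proof -
  have "cos_deficit (2 / v) \<le> (\<integral>x. 2 * (min (v\<^sup>2) (x\<^sup>2) / v\<^sup>2) \<partial>Q)"
    unfolding cos_deficit_def
  proof (rule integral_mono)
    show "integrable Q (\<lambda>x. 1 - cos (2 / v * x))" using integrable_cos[of "2 / v"] by auto
    show "integrable Q (\<lambda>x. 2 * (min (v\<^sup>2) (x\<^sup>2) / v\<^sup>2))" using integrable_capped_square[of v] by auto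
    fix x :: real
    have "min (v\<^sup>2) (x\<^sup>2) / v\<^sup>2 = min 1 ((2 / v * x / 2)\<^sup>2)"
      using v by (simp add: min_def power_divide field_simps)
    then show "1 - cos (2 / v * x) \<le> 2 * (min (v\<^sup>2) (x\<^sup>2) / v\<^sup>2)" using one_minus_cos_le[of "2 / v * x"] by simp
  qed
  then show ?thesis by (simp add: capped_second_moment_def)
qed

lemma U_ratio_antimono:
  assumes "0 < u" "u \<le> v"
  shows "U v / v\<^sup>2 \<le> U u / u\<^sup>2"
proof -
  have "min (v\<^sup>2) (x\<^sup>2) / v\<^sup>2 \<le> min (u\<^sup>2) (x\<^sup>2) / u\<^sup>2" for x :: real
  proof -
    have "min (v\<^sup>2) (x\<^sup>2) / v\<^sup>2 = min 1 (x\<^sup>2 / v\<^sup>2)" "min (u\<^sup>2) (x\<^sup>2) / u\<^sup>2 = min 1 (x\<^sup>2 / u\<^sup>2)"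
      using assms by (auto simp: min_def field_simps)
    moreover have "x\<^sup>2 / v\<^sup>2 \<le> x\<^sup>2 / u\<^sup>2" using assms by (intro divide_left_mono power_mono) auto
    ultimately show ?thesis by auto
  qed
  then have "(\<integral>x. min (v\<^sup>2) (x\<^sup>2) / v\<^sup>2 \<partial>Q) \<le> (\<integral>x. min (u\<^sup>2) (x\<^sup>2) / u\<^sup>2 \<partial>Q)"
    using integrable_capped_square by (intro integral_mono) auto
  then show ?thesis by (simp add: capped_second_moment_def)
qed

lemma U_ratio_le:
  assumes v: "0 < v"
  shows "U v / v\<^sup>2 \<le> (\<integral>x. \<bar>x\<bar> \<partial>Q) / v"
proof -
  have "min (v\<^sup>2) (x\<^sup>2) \<le> v * \<bar>x\<bar>" for x :: real
  proof (cases "\<bar>x\<bar> \<le> v")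
    case True
    then have "\<bar>x\<bar> * \<bar>x\<bar> \<le> v * \<bar>x\<bar>" by (intro mult_right_mono) auto
    then show ?thesis by (simp add: power2_eq_square)
  next
    case False
    then have "v * v \<le> v * \<bar>x\<bar>" using v by (intro mult_left_mono) auto
    then show ?thesis by (simp add: power2_eq_square)
  qed
  then have "U v \<le> (\<integral>x. v * \<bar>x\<bar> \<partial>Q)" unfolding capped_second_moment_def
    using integrable_id by (intro integral_mono integrable_capped_square) auto
  then show ?thesis using v by (simp add: field_simps power2_eq_square)
qed

text \<open>As \<open>4 (1 - cos y) - (1 - cos (2 y)) = 2 (1 - cos y)\<^sup>2\<close>, the right-hand side is an average of the mean of
  \<open>(1 - cos (t X / a))\<^sup>2\<close> over \<open>t\<close>, and Tonelli's theorem applies.\<close>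

lemma tail_prob_le_cos_deficit_integral:
  assumes a: "0 < a"
  shows "5 * ennreal (tail_prob (2 / 3 * a))
    \<le> (\<integral>\<^sup>+t. ennreal ((4 * cos_deficit (t / a) - cos_deficit (2 * t / a)) / 2) * indicator {0..6} t \<partial>lborel)"
proof -
  interpret S: pair_sigma_finite Q lborel by standard
  have k: "ennreal ((4 * cos_deficit (t / a) - cos_deficit (2 * t / a)) / 2)
      = (\<integral>\<^sup>+x. ennreal ((1 - cos (t * (x / a)))\<^sup>2) \<partial>Q)" for t
  proof -
    have "(\<integral>\<^sup>+x. ennreal ((1 - cos (t * (x / a)))\<^sup>2) \<partial>Q) = ennreal (\<integral>x. (1 - cos (t * (x / a)))\<^sup>2 \<partial>Q)"
    proof (rule nn_integral_eq_integral)
      have "norm ((1 - cos (t * (x / a)))\<^sup>2) \<le> 2\<^sup>2" for x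
      proof -
        have "\<bar>1 - cos (t * (x / a))\<bar> \<le> 2" using cos_ge_minus_one[of "t * (x / a)"] cos_le_one[of "t * (x / a)"] by linarith
        then show ?thesis using power_mono[of "\<bar>1 - cos (t * (x / a))\<bar>" 2 2] by simp
      qed
      then show "integrable Q (\<lambda>x. (1 - cos (t * (x / a)))\<^sup>2)"
        by (intro integrable_const_bound[where B = "2\<^sup>2"]) auto
    qed auto
    also have "(\<integral>x. (1 - cos (t * (x / a)))\<^sup>2 \<partial>Q)
        = (\<integral>x. (4 * (1 - cos (t / a * x)) - (1 - cos (2 * t / a * x))) / 2 \<partial>Q)"
    proof (rule Bochner_Integration.integral_cong[OF refl])
      fix x
      show "(1 - cos (t * (x / a)))\<^sup>2 = (4 * (1 - cos (t / a * x)) - (1 - cos (2 * t / a * x))) / 2"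
        using cos_double_cos[of "t / a * x"] by (simp add: power2_diff mult.assoc)
    qed
    also have "\<dots> = (4 * cos_deficit (t / a) - cos_deficit (2 * t / a)) / 2"
      using integrable_cos[of "t / a"] integrable_cos[of "2 * t / a"] by (simp add: cos_deficit_def)
    finally show ?thesis by simp
  qed
  have "5 * ennreal (tail_prob (2 / 3 * a)) = 5 * (\<integral>\<^sup>+x. ennreal (if \<bar>x\<bar> \<le> 2 / 3 * a then 0 else 1) \<partial>Q)"
    unfolding tail_prob_def using integrable_tail_indicator[of "2 / 3 * a"]
    by (subst nn_integral_eq_integral) auto
  also have "\<dots> = (\<integral>\<^sup>+x. 5 * ennreal (if \<bar>x\<bar> \<le> 2 / 3 * a then 0 else 1) \<partial>Q)"
    by (rule nn_integral_cmult[symmetric]) simp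
  also have "\<dots> \<le> (\<integral>\<^sup>+x. (\<integral>\<^sup>+t. ennreal ((1 - cos (t * (x / a)))\<^sup>2) * indicator {0..6} t \<partial>lborel) \<partial>Q)"
  proof (rule nn_integral_mono)
    fix x
    show "5 * ennreal (if \<bar>x\<bar> \<le> 2 / 3 * a then 0 else 1)
      \<le> (\<integral>\<^sup>+t. ennreal ((1 - cos (t * (x / a)))\<^sup>2) * indicator {0..6} t \<partial>lborel)"
      using integral_one_minus_cos_sq_ge[of "x / a"] a by (auto simp: field_simps)
  qed
  also have "\<dots> = (\<integral>\<^sup>+t. (\<integral>\<^sup>+x. ennreal ((1 - cos (t * (x / a)))\<^sup>2) * indicator {0..6} t \<partial>Q) \<partial>lborel)"
    by (rule S.Fubini'[symmetric]) measurable
  also have "\<dots> = (\<integral>\<^sup>+t. ennreal ((4 * cos_deficit (t / a) - cos_deficit (2 * t / a)) / 2) * indicator {0..6} t \<partial>lborel)"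
    unfolding k by (intro nn_integral_cong nn_integral_multc) measurable
  finally show ?thesis .
qed

end

section \<open>Tails of laws attracted to the normal law\<close>

context centred_law begin

lemma cos_deficit_double_le: "cos_deficit (2 * s) \<le> 4 * cos_deficit s"
proof -
  have "1 - cos (2 * s * x) \<le> 4 * (1 - cos (s * x))" for x
  proof -
    have "4 * (1 - cos (s * x)) - (1 - cos (2 * s * x)) = 2 * (1 - cos (s * x))\<^sup>2"
      using cos_double_cos[of "s * x"] by (simp add: power2_diff mult.assoc)
    moreover have "0 \<le> 2 * (1 - cos (s * x))\<^sup>2" by simp
    ultimately show ?thesis by linarith
  qed
  then have "cos_deficit (2 * s) \<le> (\<integral>x. 4 * (1 - cos (s * x)) \<partial>Q)"
    unfolding cos_deficit_def using integrable_cos by (intro integral_mono) auto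
  also have "\<dots> = 4 * cos_deficit s" unfolding cos_deficit_def by (rule integral_mult_right_zero)
  finally show ?thesis .
qed

text \<open>If \<open>L\<close> vanished identically, the law would be concentrated at zero.\<close>

lemma ex_L_pos:
  assumes "cmod (char Q s) \<noteq> 1"
  shows "\<exists>w. 0 < L w"
proof (rule ccontr)
  assume no: "\<nexists>w. 0 < L w"
  have "AE x in Q. (if \<bar>x\<bar> \<le> real k then x\<^sup>2 else 0) = 0" for k
  proof (subst integral_nonneg_eq_0_iff_AE[symmetric])
    show "(\<integral>x. (if \<bar>x\<bar> \<le> real k then x\<^sup>2 else 0) \<partial>Q) = 0"
      using no L_nonneg[of "real k"] by (auto simp: truncated_second_moment_def not_less intro: antisym)
  qed (use integrable_truncated_square in auto)
  then have "AE x in Q. \<forall>k. (if \<bar>x\<bar> \<le> real k then x\<^sup>2 else 0) = 0" by (simp add: AE_all_countable)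
  then have "AE x in Q. x = 0"
  proof eventually_elim
    case (elim x)
    obtain k where "\<bar>x\<bar> \<le> real k" using real_arch_simple by blast
    then show ?case using elim[rule_format, of k] by simp
  qed
  then have "AE x in Q. iexp (s * x) = 1" by eventually_elim simp
  then have "char Q s = (CLINT x|Q. 1)" unfolding char_def by (intro integral_cong_AE) auto
  then show False using assms prob_space by simp
qed

text \<open>The conclusion drawn from weak convergence of the normed sums, as a statement about the law of a single
  observation.  It determines how the tails of the law compare with the norming constants.\<close>

context
  fixes w :: real and a :: "nat \<Rightarrow> real"
  assumes w: "0 < L w" and a: "\<And>n. 0 < a n"
    and lim: "\<And>T \<delta>. 0 \<le> T \<Longrightarrow> 0 < \<delta> \<Longrightarrow>
      \<forall>\<^sub>F n in sequentially. \<forall>t. \<bar>t\<bar> \<le> T \<longrightarrow> \<bar>cmod (char Q (t / a n)) ^ n - exp (- (t\<^sup>2 / 2))\<bar> < \<delta>"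
begin

lemma norm_char_deficit_bounded:
  assumes T: "0 \<le> T"
  shows "\<exists>C. \<forall>\<^sub>F n in sequentially. \<forall>t\<in>{0..T}. real n * (1 - (cmod (char Q (t / a n)))\<^sup>2) \<le> C"
proof -
  define c where "c = exp (- (T\<^sup>2 / 2)) / 2"
  have c: "0 < c" by (simp add: c_def)
  have "\<forall>\<^sub>F n in sequentially. \<forall>t\<in>{0..T}. real n * (1 - (cmod (char Q (t / a n)))\<^sup>2) \<le> - ln (c\<^sup>2)"
    using lim[OF T c]
  proof eventually_elim
    case (elim n)
    show ?case
    proof
      fix t assume t: "t \<in> {0..T}"
      have "t\<^sup>2 \<le> T\<^sup>2" using t by (intro power_mono) auto
      then have "2 * c \<le> exp (- (t\<^sup>2 / 2))" by (simp add: c_def)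
      moreover have "\<bar>cmod (char Q (t / a n)) ^ n - exp (- (t\<^sup>2 / 2))\<bar> < c" using elim t by auto
      ultimately have "c \<le> cmod (char Q (t / a n)) ^ n" by linarith
      then have "c\<^sup>2 \<le> (cmod (char Q (t / a n)) ^ n)\<^sup>2" using c by (intro power_mono) auto
      then have "c\<^sup>2 \<le> ((cmod (char Q (t / a n)))\<^sup>2) ^ n" by (simp add: power_mult[symmetric] mult.commute)
      then show "real n * (1 - (cmod (char Q (t / a n)))\<^sup>2) \<le> - ln (c\<^sup>2)"
        using c cmod_char_le_1[of "t / a n"] by (intro power_ge_imp_deficit_le) (auto simp: abs_square_le_1)
    qed
  qed
  then show ?thesis ..
qed

lemma ex_cos_deficit_le_norm_char_deficit:
  "\<exists>s\<^sub>0>0. \<forall>s. 0 < s \<and> s < s\<^sub>0 \<longrightarrow> 0 < cos_deficit s \<and> cos_deficit s \<le> 1 - (cmod (char Q s))\<^sup>2"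
proof -
  have "\<forall>\<^sub>F s in at_right 0. 1 < (1 - (cmod (char Q s))\<^sup>2) / cos_deficit s"
    using norm_char_deficit_ratio[OF w] by (intro order_tendstoD(1)) auto
  moreover have "\<forall>\<^sub>F s in at_right 0. 0 < cos_deficit s"
    using sine_part_negligible[OF w, of 1] by (auto elim: eventually_mono)
  ultimately have "\<forall>\<^sub>F s in at_right 0. 0 < cos_deficit s \<and> cos_deficit s \<le> 1 - (cmod (char Q s))\<^sup>2"
    by eventually_elim (simp add: less_divide_eq)
  then show ?thesis unfolding eventually_at_right_field by auto
qed

text \<open>If \<open>a n \<le> Z\<close> for arbitrarily large \<open>n\<close>, then at a fixed small \<open>s\<close> the product \<open>n (1 - \<bar>\<phi> s\<bar>\<^sup>2)\<close> would be
  bounded for these \<open>n\<close>, which forces the modulus to be one; but it is below one near zero.\<close>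

lemma norming_at_top: "filterlim a at_top sequentially"
  unfolding filterlim_at_top
proof
  fix Z :: real
  obtain s\<^sub>0 where s\<^sub>0: "0 < s\<^sub>0" "\<And>s. 0 < s \<Longrightarrow> s < s\<^sub>0 \<Longrightarrow> 0 < cos_deficit s \<and> cos_deficit s \<le> 1 - (cmod (char Q s))\<^sup>2"
    using ex_cos_deficit_le_norm_char_deficit by blast
  define s where "s = min (s\<^sub>0 / 2) (1 / max Z 1)"
  have s: "0 < s" "s < s\<^sub>0" "s * max Z 1 \<le> 1"
  proof -
    show "0 < s" "s < s\<^sub>0" using s\<^sub>0(1) by (auto simp: s_def min_def)
    have "s * max Z 1 \<le> 1 / max Z 1 * max Z 1" unfolding s_def by (intro mult_right_mono) auto
    moreover have "max Z 1 \<noteq> 0" by (simp add: max_def)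
    ultimately show "s * max Z 1 \<le> 1" by simp
  qed
  define \<kappa> where "\<kappa> = 1 - (cmod (char Q s))\<^sup>2"
  have \<kappa>: "0 < \<kappa>" using s\<^sub>0(2)[OF s(1,2)] by (simp add: \<kappa>_def)
  obtain C where C: "\<forall>\<^sub>F n in sequentially. \<forall>t\<in>{0..1}. real n * (1 - (cmod (char Q (t / a n)))\<^sup>2) \<le> C"
    using norm_char_deficit_bounded[of 1] by auto
  have "\<forall>\<^sub>F n in sequentially. C / \<kappa> < real n"
    using filterlim_real_sequentially by (auto simp: filterlim_at_top_dense)
  with C show "\<forall>\<^sub>F n in sequentially. Z \<le> a n"
  proof eventually_elim
    case (elim n)
    show ?case
    proof (rule ccontr)
      assume "\<not> Z \<le> a n"
      then have "s * a n \<le> s * max Z 1" using s by (intro mult_left_mono) auto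
      then have "s * a n \<le> 1" using s(3) by (rule order_trans)
      then have "s * a n \<in> {0..1}" using s(1) a[of n] by simp
      then have "real n * (1 - (cmod (char Q (s * a n / a n)))\<^sup>2) \<le> C" using elim(1) by blast
      then have "real n * \<kappa> \<le> C" using a[of n] by (simp add: \<kappa>_def)
      then show False using elim(2) \<kappa> by (simp add: field_simps)
    qed
  qed
qed

lemma cos_deficit_bounded:
  assumes T: "0 \<le> T"
  shows "\<exists>C. \<forall>\<^sub>F n in sequentially. \<forall>t\<in>{0..T}. real n * cos_deficit (t / a n) \<le> C"
proof -
  obtain C where C: "\<forall>\<^sub>F n in sequentially. \<forall>t\<in>{0..T}. real n * (1 - (cmod (char Q (t / a n)))\<^sup>2) \<le> C"
    using norm_char_deficit_bounded[OF T] by auto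
  obtain s\<^sub>0 where s\<^sub>0: "0 < s\<^sub>0" "\<And>s. 0 < s \<Longrightarrow> s < s\<^sub>0 \<Longrightarrow> 0 < cos_deficit s \<and> cos_deficit s \<le> 1 - (cmod (char Q s))\<^sup>2"
    using ex_cos_deficit_le_norm_char_deficit by blast
  have "\<forall>\<^sub>F n in sequentially. T / s\<^sub>0 < a n"
    using norming_at_top by (auto simp: filterlim_at_top_dense)
  with C have "\<forall>\<^sub>F n in sequentially. \<forall>t\<in>{0..T}. real n * cos_deficit (t / a n) \<le> C"
  proof eventually_elim
    case (elim n)
    show ?case
    proof
      fix t assume t: "t \<in> {0..T}"
      have "cos_deficit (t / a n) \<le> 1 - (cmod (char Q (t / a n)))\<^sup>2"
      proof (cases "t = 0")
        case True
        then show ?thesis by (simp add: cos_deficit_def char_zero)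
      next
        case False
        have "t < s\<^sub>0 * a n" using elim(2) t s\<^sub>0(1) by (simp add: field_simps)
        then show ?thesis using False t a[of n] s\<^sub>0(2)[of "t / a n"] by (simp add: pos_divide_less_eq)
      qed
      then have "real n * cos_deficit (t / a n) \<le> real n * (1 - (cmod (char Q (t / a n)))\<^sup>2)"
        by (intro mult_left_mono) auto
      also have "\<dots> \<le> C" using elim(1) t by blast
      finally show "real n * cos_deficit (t / a n) \<le> C" .
    qed
  qed
  then show ?thesis ..
qed

text \<open>The limit \<open>\<bar>\<phi>\<bar> ^ (2 n) \<rightarrow> exp (- t\<^sup>2)\<close> gives \<open>n (1 - \<bar>\<phi>\<bar>\<^sup>2) \<rightarrow> t\<^sup>2\<close>, and the deficit is asymptotically half of
  \<open>1 - \<bar>\<phi>\<bar>\<^sup>2\<close>.\<close>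

lemma cos_deficit_limit:
  assumes t: "0 \<le> t"
  shows "(\<lambda>n. real n * cos_deficit (t / a n)) \<longlonglongrightarrow> t\<^sup>2 / 2"
proof (cases "t = 0")
  case True
  then show ?thesis by (simp add: cos_deficit_def)
next
  case False
  with t have t: "0 < t" by simp
  have "(\<lambda>n. t / a n) \<longlonglongrightarrow> 0"
    by (intro real_tendsto_divide_at_top[OF tendsto_const] norming_at_top)
  then have flt: "filterlim (\<lambda>n. t / a n) (at_right 0) sequentially"
    using t a by (intro filterlim_at_withinI always_eventually allI) (auto simp: less_imp_neq[THEN not_sym])
  have ratio: "(\<lambda>n. (1 - (cmod (char Q (t / a n)))\<^sup>2) / cos_deficit (t / a n)) \<longlonglongrightarrow> 2"
    by (rule filterlim_compose[OF norm_char_deficit_ratio[OF w] flt])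
  have "(\<lambda>n. cmod (char Q (t / a n)) ^ n) \<longlonglongrightarrow> exp (- (t\<^sup>2 / 2))"
  proof (rule tendstoI)
    fix e :: real assume "0 < e"
    from lim[OF less_imp_le[OF t] this]
    show "\<forall>\<^sub>F n in sequentially. dist (cmod (char Q (t / a n)) ^ n) (exp (- (t\<^sup>2 / 2))) < e"
      by eventually_elim (use t in \<open>auto simp: dist_real_def\<close>)
  qed
  then have "(\<lambda>n. (cmod (char Q (t / a n)) ^ n)\<^sup>2) \<longlonglongrightarrow> (exp (- (t\<^sup>2 / 2)))\<^sup>2" by (rule tendsto_power)
  moreover have "(exp (- (t\<^sup>2 / 2)))\<^sup>2 = exp (- t\<^sup>2)" by (simp add: exp_double[symmetric] power2_eq_square flip: exp_add)
  moreover have "(cmod (char Q (t / a n)) ^ n)\<^sup>2 = ((cmod (char Q (t / a n)))\<^sup>2) ^ n" for n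
    by (simp add: power_mult[symmetric] mult.commute)
  ultimately have "(\<lambda>n. ((cmod (char Q (t / a n)))\<^sup>2) ^ n) \<longlonglongrightarrow> exp (- t\<^sup>2)" by simp
  then have "(\<lambda>n. real n * (1 - (cmod (char Q (t / a n)))\<^sup>2)) \<longlonglongrightarrow> t\<^sup>2"
    using cmod_char_le_1 by (intro tendsto_root_power_exp) (auto simp: abs_square_le_1)
  then have "(\<lambda>n. real n * (1 - (cmod (char Q (t / a n)))\<^sup>2) / ((1 - (cmod (char Q (t / a n)))\<^sup>2) / cos_deficit (t / a n))) \<longlonglongrightarrow> t\<^sup>2 / 2"
    by (intro tendsto_divide ratio) auto
  moreover have "\<forall>\<^sub>F n in sequentially. real n * (1 - (cmod (char Q (t / a n)))\<^sup>2) / ((1 - (cmod (char Q (t / a n)))\<^sup>2) / cos_deficit (t / a n))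
      = real n * cos_deficit (t / a n)"
  proof -
    have "\<forall>\<^sub>F n in sequentially. 1 < (1 - (cmod (char Q (t / a n)))\<^sup>2) / cos_deficit (t / a n)"
      using ratio by (intro order_tendstoD(1)) auto
    then show ?thesis
    proof eventually_elim
      case (elim n)
      then have "1 - (cmod (char Q (t / a n)))\<^sup>2 \<noteq> 0" "cos_deficit (t / a n) \<noteq> 0" by auto
      then show ?case by simp
    qed
  qed
  ultimately show ?thesis by (rule Lim_transform_eventually)
qed

text \<open>The limit \<open>t\<^sup>2/2\<close> is annihilated by the combination \<open>4 g (t) - g (2 t)\<close>.  The integral over \<open>t\<close> needs
  dominated convergence, for which the deficits are bounded uniformly in \<open>t\<close>.\<close>

lemma tail_prob_limit: "(\<lambda>n. real n * tail_prob (2 / 3 * a n)) \<longlonglongrightarrow> 0"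
proof -
  define k where "k n t = real n * ((4 * cos_deficit (t / a n) - cos_deficit (2 * t / a n)) / 2)" for n t
  obtain C where "\<forall>\<^sub>F n in sequentially. \<forall>t\<in>{0..6}. real n * cos_deficit (t / a n) \<le> C"
    using cos_deficit_bounded[of 6] by auto
  then obtain N where N: "\<And>n t. N \<le> n \<Longrightarrow> t \<in> {0..6} \<Longrightarrow> real n * cos_deficit (t / a n) \<le> C"
    unfolding eventually_sequentially by meson
  have k0: "(\<lambda>n. k n t) \<longlonglongrightarrow> 0" if "0 \<le> t" for t
  proof -
    have "(\<lambda>n. (4 * (real n * cos_deficit (t / a n)) - real n * cos_deficit (2 * t / a n)) / 2)
        \<longlonglongrightarrow> (4 * (t\<^sup>2 / 2) - (2 * t)\<^sup>2 / 2) / 2"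
      using that by (intro tendsto_intros cos_deficit_limit) auto
    then show ?thesis by (simp add: k_def algebra_simps power_mult_distrib)
  qed
  have kC: "k n t \<le> 2 * C" if "N \<le> n" "t \<in> {0..6}" for n t
  proof -
    have "k n t \<le> 2 * (real n * cos_deficit (t / a n))"
      using mult_nonneg_nonneg[OF of_nat_0_le_iff cos_deficit_nonneg, of n "2 * t / a n"]
      by (simp add: k_def algebra_simps)
    then show ?thesis using N[OF that] by simp
  qed
  have "(\<lambda>n. \<integral>\<^sup>+t. ennreal (k (n + N) t) * indicator {0..6} t \<partial>lborel) \<longlonglongrightarrow> (\<integral>\<^sup>+t. 0 \<partial>(lborel :: real measure))"
  proof (rule nn_integral_dominated_convergence[where w = "\<lambda>t :: real. ennreal (2 * C) * indicator {0..6} t"])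
    show "(\<lambda>t. ennreal (k (n + N) t) * indicator {0..6} t) \<in> borel_measurable lborel" for n
      unfolding k_def by measurable
    show "AE t in lborel. ennreal (k (n + N) t) * indicator {0..6} t \<le> ennreal (2 * C) * indicator {0..6} t" for n
      using kC by (intro AE_I2) (auto simp: indicator_def intro!: ennreal_leI)
    show "(\<integral>\<^sup>+t. ennreal (2 * C) * indicator {0..6 :: real} t \<partial>lborel) < \<infinity>"
      by (subst nn_integral_cmult_indicator) (auto simp: ennreal_mult_less_top)
    show "AE t in lborel. (\<lambda>n. ennreal (k (n + N) t) * indicator {0..6} t) \<longlonglongrightarrow> 0"
    proof (rule AE_I2)
      fix t :: real
      show "(\<lambda>n. ennreal (k (n + N) t) * indicator {0..6} t) \<longlonglongrightarrow> 0"
      proof (cases "t \<in> {0..6}")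
        case True
        then have "(\<lambda>n. ennreal (k (n + N) t)) \<longlonglongrightarrow> ennreal 0"
          by (intro tendsto_ennrealI LIMSEQ_ignore_initial_segment k0) auto
        then show ?thesis using True by simp
      qed simp
    qed
  qed auto
  then have lim0: "(\<lambda>n. \<integral>\<^sup>+t. ennreal (k (n + N) t) * indicator {0..6} t \<partial>lborel) \<longlonglongrightarrow> 0" by simp
  have le: "ennreal (real n * tail_prob (2 / 3 * a n)) \<le> (\<integral>\<^sup>+t. ennreal (k n t) * indicator {0..6} t \<partial>lborel)" for n
  proof -
    have tp: "0 \<le> tail_prob v" for v unfolding tail_prob_def by (rule integral_nonneg_AE) auto
    have "ennreal (real n * tail_prob (2 / 3 * a n)) \<le> ennreal (real n) * (5 * ennreal (tail_prob (2 / 3 * a n)))"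
    proof -
      have "ennreal (real n * tail_prob (2 / 3 * a n)) \<le> ennreal (real n * (5 * tail_prob (2 / 3 * a n)))"
        using tp[of "2 / 3 * a n"] by (intro ennreal_leI mult_left_mono) auto
      then show ?thesis using tp by (simp add: ennreal_mult)
    qed
    also have "\<dots> \<le> ennreal (real n) *
        (\<integral>\<^sup>+t. ennreal ((4 * cos_deficit (t / a n) - cos_deficit (2 * t / a n)) / 2) * indicator {0..6} t \<partial>lborel)"
      by (intro mult_left_mono tail_prob_le_cos_deficit_integral a) auto
    also have "\<dots> = (\<integral>\<^sup>+t. ennreal (real n) *
        (ennreal ((4 * cos_deficit (t / a n) - cos_deficit (2 * t / a n)) / 2) * indicator {0..6} t) \<partial>lborel)"
      by (rule nn_integral_cmult[symmetric]) measurable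
    also have "\<dots> = (\<integral>\<^sup>+t. ennreal (k n t) * indicator {0..6} t \<partial>lborel)"
    proof (rule nn_integral_cong)
      fix t
      have "0 \<le> (4 * cos_deficit (t / a n) - cos_deficit (2 * t / a n)) / 2"
        using cos_deficit_double_le[of "t / a n"] by simp
      then show "ennreal (real n) * (ennreal ((4 * cos_deficit (t / a n) - cos_deficit (2 * t / a n)) / 2) * indicator {0..6} t)
          = ennreal (k n t) * indicator {0..6} t"
        unfolding k_def by (simp only: ennreal_mult of_nat_0_le_iff mult.assoc)
    qed
    finally show ?thesis .
  qed
  have "(\<lambda>n. ennreal (real (n + N) * tail_prob (2 / 3 * a (n + N)))) \<longlonglongrightarrow> 0"
    by (rule tendsto_sandwich[OF _ always_eventually[OF allI[OF le]] tendsto_const lim0]) simp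
  then have "(\<lambda>n. ennreal (real n * tail_prob (2 / 3 * a n))) \<longlonglongrightarrow> ennreal 0" by (simp add: LIMSEQ_offset)
  moreover have "0 \<le> tail_prob v" for v unfolding tail_prob_def by (rule integral_nonneg_AE) auto
  ultimately show ?thesis by (subst (asm) tendsto_ennreal_iff) auto
qed

text \<open>For large \<open>v\<close> take \<open>n\<close> close to \<open>v\<^sup>2 / U v\<close>.  At the level \<open>2/3 a n\<close> the value of \<open>n U u / u\<^sup>2\<close> is asymptotically
  at least 9/4, whereas at \<open>v\<close> it is below 2; by monotonicity \<open>v \<ge> 2/3 a n\<close>, and the tail bound at \<open>2/3 a n\<close>
  carries over to \<open>v\<close>.\<close>

lemma tail_prob_negligible:
  assumes \<delta>: "0 < \<delta>"
  shows "\<exists>v\<^sub>1>0. \<forall>v\<ge>v\<^sub>1. v\<^sup>2 * tail_prob v \<le> \<delta> * U v"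
proof -
  have "\<forall>\<^sub>F n in sequentially. real n * tail_prob (2 / 3 * a n) < \<delta>"
    using tail_prob_limit \<delta> by (intro order_tendstoD(2)) auto
  moreover have "\<forall>\<^sub>F n in sequentially. 4 < real n * cos_deficit (3 / a n)"
    using cos_deficit_limit[of 3] by (intro order_tendstoD(1)) auto
  ultimately have "\<forall>\<^sub>F n in sequentially. real n * tail_prob (2 / 3 * a n) < \<delta> \<and> 4 < real n * cos_deficit (3 / a n)"
    by eventually_elim simp
  then obtain N where N: "\<And>n. N \<le> n \<Longrightarrow> real n * tail_prob (2 / 3 * a n) < \<delta>"
    "\<And>n. N \<le> n \<Longrightarrow> 4 < real n * cos_deficit (3 / a n)" by (auto simp: eventually_sequentially)
  define q where "q v = U v / v\<^sup>2" for v
  define m where "m = (\<integral>x. \<bar>x\<bar> \<partial>Q)"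
  have m: "0 \<le> m" unfolding m_def by (rule integral_nonneg_AE) auto
  define v\<^sub>1 where "v\<^sub>1 = max 1 (max w (m * (real N + 1)))"
  have "v\<^sup>2 * tail_prob v \<le> \<delta> * U v" if v: "v\<^sub>1 \<le> v" for v
  proof -
    have v': "1 \<le> v" "w \<le> v" "m * (real N + 1) \<le> v" using v by (auto simp: v\<^sub>1_def)
    have tp: "0 \<le> tail_prob v" unfolding tail_prob_def by (rule integral_nonneg_AE) auto
    have "0 < U v" using U_eq[of v] L_mono[OF v'(2)] w v' tp by (simp add: add_pos_nonneg)
    then have q: "0 < q v" using v' by (simp add: q_def)
    have "q v \<le> m / v" using U_ratio_le[of v] v' by (simp add: q_def m_def)
    also have "\<dots> \<le> 1 / (real N + 1)" using v' by (simp add: field_simps)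
    finally have qN: "q v \<le> 1 / (real N + 1)" .
    define n where "n = nat \<lceil>1 / q v\<rceil>"
    have "real n = of_int \<lceil>1 / q v\<rceil>" using q by (simp add: n_def)
    then have n: "1 / q v \<le> real n" "real n < 1 / q v + 1" by linarith+
    have "real N + 1 \<le> 1 / q v" using qN q by (simp add: field_simps)
    then have Nn: "N \<le> n" using n by linarith
    have "1 / (real N + 1) \<le> 1" by simp
    then have q1: "q v \<le> 1" using qN by linarith
    have "real n * q v < (1 / q v + 1) * q v" using n q by (intro mult_strict_right_mono) auto
    also have "\<dots> = 1 + q v" using q by (simp add: field_simps)
    finally have nq: "real n * q v < 2" using q1 by linarith
    have "2 / 3 * a n \<le> v"
    proof (rule ccontr)
      assume "\<not> 2 / 3 * a n \<le> v"
      then have "q (2 / 3 * a n) \<le> q v" unfolding q_def using v' by (intro U_ratio_antimono) auto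
      then have "real n * q (2 / 3 * a n) \<le> real n * q v" by (intro mult_left_mono) auto
      moreover have "cos_deficit (3 / a n) \<le> 2 * q (2 / 3 * a n)"
        using cos_deficit_le[of "2 / 3 * a n"] a[of n] by (simp add: q_def)
      then have "real n * cos_deficit (3 / a n) \<le> real n * (2 * q (2 / 3 * a n))" by (intro mult_left_mono) auto
      ultimately show False using N(2)[OF Nn] nq by linarith
    qed
    then have "tail_prob v \<le> tail_prob (2 / 3 * a n)" by (rule tail_prob_antimono)
    then have "real n * tail_prob v \<le> real n * tail_prob (2 / 3 * a n)" by (intro mult_left_mono) auto
    then have "real n * tail_prob v \<le> \<delta>" using N(1)[OF Nn] by linarith
    moreover have "1 / q v * tail_prob v \<le> real n * tail_prob v" using n tp by (intro mult_right_mono) auto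
    ultimately have "1 / q v * tail_prob v \<le> \<delta>" by linarith
    then have "tail_prob v \<le> \<delta> * q v" using q by (simp add: pos_divide_le_eq)
    then have "v\<^sup>2 * tail_prob v \<le> v\<^sup>2 * (\<delta> * q v)" by (intro mult_left_mono) auto
    also have "\<dots> = \<delta> * U v" using v' by (simp add: q_def)
    finally show ?thesis .
  qed
  then show ?thesis by (intro exI[of _ v\<^sub>1]) (auto simp: v\<^sub>1_def)
qed

lemma uniformly_small_tails_singleton: "uniformly_small_tails {Q}"
  unfolding uniformly_small_tails_def
proof (intro conjI allI impI)
  show "\<forall>Q\<in>{Q}. centred_law Q" using centred_law_axioms by simp
  show "\<exists>c>0. \<exists>w. \<forall>Q\<in>{Q}. c \<le> truncated_second_moment Q w" using w by auto
  fix \<epsilon> :: real assume \<epsilon>: "0 < \<epsilon>"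
  define \<delta> where "\<delta> = min (1 / 6) (\<epsilon> / 16)"
  have \<delta>: "0 < \<delta>" "\<delta> \<le> 1 / 6" "16 * \<delta> \<le> \<epsilon>" using \<epsilon> by (auto simp: \<delta>_def)
  obtain v\<^sub>1 where v\<^sub>1: "0 < v\<^sub>1" "\<And>v. v\<^sub>1 \<le> v \<Longrightarrow> v\<^sup>2 * tail_prob v \<le> \<delta> * U v"
    using tail_prob_negligible[OF \<delta>(1)] by blast
  have "v * J v \<le> \<epsilon> * L v" if "v\<^sub>1 \<le> v" for v
    using J_le_of_tail_prob[OF v\<^sub>1(1) \<delta>(1,2) v\<^sub>1(2) that] mult_right_mono[OF \<delta>(3) L_nonneg[of v]] by linarith
  then show "\<exists>v\<^sub>0>0. \<forall>Q\<in>{Q}. \<forall>v\<ge>v\<^sub>0. v * tail_first_moment Q v \<le> \<epsilon> * truncated_second_moment Q v"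
    using v\<^sub>1(1) by auto
qed

end

end

lemma centred_law_shift_scale:
  assumes P: "real_distribution P" "integrable P (\<lambda>x. x)" and \<mu>: "(\<integral>x. x \<partial>P) = \<mu>"
  shows "centred_law (distr P borel (\<lambda>x. (x - \<mu>) / c))"
proof -
  interpret P: real_distribution P by (rule P(1))
  have int: "integrable P (\<lambda>x. (x - \<mu>) / c)" using P(2) by auto
  have "(\<integral>x. (x - \<mu>) / c \<partial>P) = (\<integral>x. x - \<mu> \<partial>P) / c" by (rule integral_divide_zero)
  also have "(\<integral>x. x - \<mu> \<partial>P) = \<mu> - (\<integral>x. \<mu> \<partial>P)"
    unfolding \<mu>[symmetric] by (rule Bochner_Integration.integral_diff[OF P(2)]) simp
  also have "(\<integral>x. \<mu> \<partial>P) = \<mu>" using P.prob_space by (simp only: lebesgue_integral_const scaleR_one)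
  finally have zero: "(\<integral>x. (x - \<mu>) / c \<partial>P) = 0" by simp
  interpret Q: real_distribution "distr P borel (\<lambda>x. (x - \<mu>) / c)"
    by (rule P.real_distribution_distr) simp
  show ?thesis
  proof
    show "integrable (distr P borel (\<lambda>x. (x - \<mu>) / c)) (\<lambda>x. x)"
      using int by (subst integrable_distr_eq) auto
    show "(\<integral>x. x \<partial>distr P borel (\<lambda>x. (x - \<mu>) / c)) = 0"
      using zero by (subst integral_distr) auto
  qed
qed

text \<open>Taking the modulus removes the centring constants.\<close>

lemma norm_char_iid_sum:
  assumes iid: "iid_with_law M X P"
  shows "cmod (char (distr M borel (\<lambda>\<omega>. ((\<Sum>i<n. X i \<omega>) - b) / a)) t)
    = cmod (char (distr P borel (\<lambda>x. x - \<mu>)) (t / a)) ^ n"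
proof -
  interpret prob_space M using iid by (simp add: iid_with_law_def)
  have ind: "indep_vars (\<lambda>_. borel) X UNIV" and law: "\<And>i. distr M borel (X i) = P"
    using iid by (auto simp: iid_with_law_def)
  have [measurable]: "X i \<in> borel_measurable M" for i using ind by (auto simp: indep_vars_def)
  have Pb: "sets P = sets borel" using law[of 0] by (metis sets_distr)
  note [measurable_cong] = Pb
  define Y where "Y i \<omega> = (X i \<omega> - \<mu>) / a" for i \<omega>
  define S where "S \<omega> = (\<Sum>i<n. Y i \<omega>)" for \<omega>
  define d where "d = (real n * \<mu> - b) / a"
  have [measurable]: "S \<in> borel_measurable M" by (simp add: S_def[abs_def] Y_def[abs_def])
  have "((\<Sum>i<n. X i \<omega>) - b) / a = S \<omega> + d" for \<omega>
    by (simp add: S_def Y_def d_def sum_divide_distrib[symmetric] sum_subtractf add_divide_distrib[symmetric])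
  then have "char (distr M borel (\<lambda>\<omega>. ((\<Sum>i<n. X i \<omega>) - b) / a)) t = (CLINT \<omega>|M. iexp (t * (S \<omega> + d)))"
    unfolding char_def by (subst integral_distr) auto
  also have "\<dots> = (CLINT \<omega>|M. iexp (t * d) * iexp (t * S \<omega>))"
    by (simp add: exp_add[symmetric] algebra_simps)
  also have "\<dots> = iexp (t * d) * char (distr M borel S) t"
    unfolding char_def by (subst integral_distr) auto
  finally have "cmod (char (distr M borel (\<lambda>\<omega>. ((\<Sum>i<n. X i \<omega>) - b) / a)) t) = cmod (char (distr M borel S) t)"
    by (simp add: norm_mult)
  also have "char (distr M borel S) t = (\<Prod>i<n. char (distr M borel (Y i)) t)"
    unfolding S_def[abs_def]
  proof (rule char_distr_sum)
    have "indep_vars (\<lambda>_. borel) X {..<n}" by (rule indep_vars_subset[OF ind]) simp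
    then have "indep_vars (\<lambda>_. borel) (\<lambda>i. (\<lambda>x. (x - \<mu>) / a) \<circ> X i) {..<n}" by (rule indep_vars_compose) simp
    then show "indep_vars (\<lambda>_. borel) Y {..<n}" by (simp add: comp_def Y_def[abs_def])
  qed
  also have "\<dots> = (\<Prod>i<n. char (distr P borel (\<lambda>x. x - \<mu>)) (t / a))"
  proof (rule prod.cong[OF refl])
    fix i
    have "char (distr M borel (Y i)) t = (CLINT \<omega>|M. iexp (t * ((X i \<omega> - \<mu>) / a)))"
      unfolding char_def Y_def[abs_def] by (subst integral_distr) auto
    also have "\<dots> = (CLINT x|distr M borel (X i). iexp (t * ((x - \<mu>) / a)))"
      by (subst integral_distr) auto
    also have "\<dots> = (CLINT x|P. iexp (t / a * (x - \<mu>)))"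
      unfolding law by simp
    also have "\<dots> = char (distr P borel (\<lambda>x. x - \<mu>)) (t / a)"
      unfolding char_def by (subst integral_distr) auto
    finally show "char (distr M borel (Y i)) t = char (distr P borel (\<lambda>x. x - \<mu>)) (t / a)" .
  qed
  finally show ?thesis by (simp add: norm_power)
qed

text \<open>A degenerate law is excluded because its characteristic function has modulus one, which contradicts
  the Gaussian limit at \<open>t = 1\<close>.\<close>

theorem DAN_imp_small_tails:
  assumes "P \<in> DAN \<mu>"
  shows "uniformly_small_tails {distr P borel (\<lambda>x. x - \<mu>)}"
proof -
  let ?\<Pi> = "\<Pi>\<^sub>M i\<in>(UNIV :: nat set). P"
  obtain a b :: "nat \<Rightarrow> real" where P: "real_distribution P" "integrable P (\<lambda>x. x)" "(\<integral>x. x \<partial>P) = \<mu>"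
    and a: "\<And>n. 0 < a n"
    and weak: "weak_conv_m (\<lambda>n. distr ?\<Pi> borel (\<lambda>x. ((\<Sum>i<n. x i) - b n) / a n)) std_normal_distribution"
    using assms unfolding DAN_def by blast
  let ?Q = "distr P borel (\<lambda>x. x - \<mu>)"
  interpret Q: centred_law ?Q using centred_law_shift_scale[OF P, of 1] by simp
  note iid = iid_with_law_canonical[OF P(1)]
  interpret \<Pi>: prob_space ?\<Pi> using iid by (simp add: iid_with_law_def)
  let ?\<mu> = "\<lambda>n. distr ?\<Pi> borel (\<lambda>x. ((\<Sum>i<n. x i) - b n) / a n)"
  have meas: "(\<lambda>x. x i) \<in> borel_measurable ?\<Pi>" for i
    using iid by (auto simp: iid_with_law_def \<Pi>.indep_vars_def)
  have rd: "real_distribution (?\<mu> n)" for n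
    using meas by (intro \<Pi>.real_distribution_distr) auto
  have chr: "cmod (char (?\<mu> n) t) = cmod (char ?Q (t / a n)) ^ n" for n t
    using norm_char_iid_sum[OF iid, of n "b n" "a n" t \<mu>] by simp
  have lim: "\<forall>\<^sub>F n in sequentially. \<forall>t. \<bar>t\<bar> \<le> T \<longrightarrow> \<bar>cmod (char ?Q (t / a n)) ^ n - exp (- (t\<^sup>2 / 2))\<bar> < \<delta>"
    if "0 \<le> T" "0 < \<delta>" for T \<delta>
    using weak_conv_imp_char_uniform[OF rd real_dist_normal_dist weak that(2,1)]
  proof eventually_elim
    case (elim n)
    show ?case
    proof (intro allI impI)
      fix t assume "\<bar>t\<bar> \<le> T"
      then have "cmod (char (?\<mu> n) t - char std_normal_distribution t) < \<delta>" using elim by blast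
      moreover have "\<bar>cmod (char (?\<mu> n) t) - cmod (char std_normal_distribution t)\<bar>
          \<le> cmod (char (?\<mu> n) t - char std_normal_distribution t)" by (rule norm_triangle_ineq3)
      moreover have "cmod (char std_normal_distribution t) = exp (- (t\<^sup>2 / 2))"
        by (simp add: char_std_normal_distribution)
      ultimately show "\<bar>cmod (char ?Q (t / a n)) ^ n - exp (- (t\<^sup>2 / 2))\<bar> < \<delta>" unfolding chr by linarith
    qed
  qed
  have "\<exists>s. cmod (char ?Q s) \<noteq> 1"
  proof (rule ccontr)
    assume "\<nexists>s. cmod (char ?Q s) \<noteq> 1"
    then have one: "cmod (char ?Q s) = 1" for s by blast
    have "0 < 1 - exp (- (1 / 2) :: real)" by simp
    from lim[OF zero_le_one this] obtain n where
      "\<forall>t. \<bar>t\<bar> \<le> 1 \<longrightarrow> \<bar>cmod (char ?Q (t / a n)) ^ n - exp (- (t\<^sup>2 / 2))\<bar> < 1 - exp (- (1 / 2))"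
      by (auto simp: eventually_sequentially)
    then have "\<bar>1 - exp (- (1 / 2) :: real)\<bar> < 1 - exp (- (1 / 2))" unfolding one by (auto dest: spec[of _ 1])
    then show False by simp
  qed
  then obtain w where "0 < truncated_second_moment ?Q w" using Q.ex_L_pos by blast
  then show ?thesis using a lim by (rule Q.uniformly_small_tails_singleton)
qed

section \<open>Laws with bounded skew\<close>

text \<open>Beyond \<open>v\<close> one has \<open>\<bar>x\<bar> \<le> \<bar>x\<bar>\<^sup>3 / v\<^sup>2\<close> and \<open>x\<^sup>2 \<le> \<bar>x\<bar>\<^sup>3 / v\<close>.\<close>

lemma (in centred_law) tail_bounds_of_third_moment:
  assumes sq: "integrable Q (\<lambda>x. x\<^sup>2)" "(\<integral>x. x\<^sup>2 \<partial>Q) = 1"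
    and third: "(\<integral>\<^sup>+x. ennreal (\<bar>x\<bar> ^ 3) \<partial>Q) \<le> ennreal K" and K: "0 \<le> K" and v: "0 < v"
  shows "J v \<le> K / v\<^sup>2" "1 - L v \<le> K / v"
proof -
  have int3: "integrable Q (\<lambda>x. \<bar>x\<bar> ^ 3)"
  proof (rule integrableI_bounded)
    have "(\<integral>\<^sup>+x. ennreal (norm (\<bar>x\<bar> ^ 3)) \<partial>Q) \<le> ennreal K" using third by (simp add: power_abs)
    also have "\<dots> < \<infinity>" by simp
    finally show "(\<integral>\<^sup>+x. ennreal (norm (\<bar>x\<bar> ^ 3)) \<partial>Q) < \<infinity>" .
  qed simp
  have "ennreal (\<integral>x. \<bar>x\<bar> ^ 3 \<partial>Q) = (\<integral>\<^sup>+x. ennreal (\<bar>x\<bar> ^ 3) \<partial>Q)"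
    by (rule nn_integral_eq_integral[OF int3, symmetric]) simp
  then have "ennreal (\<integral>x. \<bar>x\<bar> ^ 3 \<partial>Q) \<le> ennreal K" using third by simp
  then have le: "(\<integral>x. \<bar>x\<bar> ^ 3 \<partial>Q) \<le> K" using K by (simp only: ennreal_le_iff)
  have "J v \<le> (\<integral>x. \<bar>x\<bar> ^ 3 / v\<^sup>2 \<partial>Q)"
    unfolding tail_first_moment_def
  proof (rule integral_mono[OF integrable_tail_abs])
    fix x :: real
    show "(if \<bar>x\<bar> \<le> v then 0 else \<bar>x\<bar>) \<le> \<bar>x\<bar> ^ 3 / v\<^sup>2"
    proof (cases "\<bar>x\<bar> \<le> v")
      case False
      then have "v\<^sup>2 * \<bar>x\<bar> \<le> \<bar>x\<bar>\<^sup>2 * \<bar>x\<bar>" using v by (intro mult_right_mono power_mono) auto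
      also have "\<dots> = \<bar>x\<bar> ^ 3" by (simp only: power2_eq_square power3_eq_cube)
      finally have "\<bar>x\<bar> \<le> \<bar>x\<bar> ^ 3 / v\<^sup>2" using v by (simp add: pos_le_divide_eq mult.commute)
      then show ?thesis using False by simp
    qed (use v in simp)
  qed (use int3 in auto)
  also have "\<dots> = (\<integral>x. \<bar>x\<bar> ^ 3 \<partial>Q) / v\<^sup>2" by (rule integral_divide_zero)
  also have "\<dots> \<le> K / v\<^sup>2" using le by (intro divide_right_mono) auto
  finally show "J v \<le> K / v\<^sup>2" .
  have "1 - L v = (\<integral>x. x\<^sup>2 - (if \<bar>x\<bar> \<le> v then x\<^sup>2 else 0) \<partial>Q)"
    unfolding truncated_second_moment_def sq(2)[symmetric]
    by (rule Bochner_Integration.integral_diff[OF sq(1) integrable_truncated_square, symmetric])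
  also have "\<dots> \<le> (\<integral>x. \<bar>x\<bar> ^ 3 / v \<partial>Q)"
  proof (rule integral_mono)
    show "integrable Q (\<lambda>x. x\<^sup>2 - (if \<bar>x\<bar> \<le> v then x\<^sup>2 else 0))"
      by (intro Bochner_Integration.integrable_diff sq(1) integrable_truncated_square)
    show "integrable Q (\<lambda>x. \<bar>x\<bar> ^ 3 / v)" using int3 by auto
    fix x :: real
    show "x\<^sup>2 - (if \<bar>x\<bar> \<le> v then x\<^sup>2 else 0) \<le> \<bar>x\<bar> ^ 3 / v"
    proof (cases "\<bar>x\<bar> \<le> v")
      case False
      then have "v * \<bar>x\<bar>\<^sup>2 \<le> \<bar>x\<bar> * \<bar>x\<bar>\<^sup>2" by (intro mult_right_mono) auto
      also have "\<dots> = \<bar>x\<bar> ^ 3" by (simp only: power2_eq_square power3_eq_cube mult.assoc)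
      finally have "\<bar>x\<bar>\<^sup>2 \<le> \<bar>x\<bar> ^ 3 / v" using v by (simp only: pos_le_divide_eq mult.commute)
      then show ?thesis using False by simp
    qed (use v in simp)
  qed
  also have "\<dots> = (\<integral>x. \<bar>x\<bar> ^ 3 \<partial>Q) / v" by (rule integral_divide_zero)
  also have "\<dots> \<le> K / v" using le v by (intro divide_right_mono) auto
  finally show "1 - L v \<le> K / v" .
qed

lemma uniformly_small_tails_of_third_moment:
  assumes \<Q>: "\<And>Q. Q \<in> \<Q> \<Longrightarrow> centred_law Q \<and> integrable Q (\<lambda>x. x\<^sup>2) \<and> (\<integral>x. x\<^sup>2 \<partial>Q) = 1 \<and>
      (\<integral>\<^sup>+x. ennreal (\<bar>x\<bar> ^ 3) \<partial>Q) \<le> ennreal K"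
    and K: "0 \<le> K"
  shows "uniformly_small_tails \<Q>"
  unfolding uniformly_small_tails_def
proof (intro conjI allI impI)
  show "\<forall>Q\<in>\<Q>. centred_law Q" using \<Q> by blast
  have half: "1 / 2 \<le> truncated_second_moment Q v" if "Q \<in> \<Q>" "2 * K + 1 \<le> v" for Q v
  proof -
    interpret centred_law Q using \<Q>[OF that(1)] by blast
    have "1 - L v \<le> K / v" using \<Q>[OF that(1)] K that(2) by (intro tail_bounds_of_third_moment) auto
    moreover have "K / v \<le> 1 / 2" using K that(2) by (simp add: field_simps)
    ultimately show ?thesis by linarith
  qed
  then show "\<exists>c>0. \<exists>w. \<forall>Q\<in>\<Q>. c \<le> truncated_second_moment Q w"
    by (intro exI[of _ "1 / 2"] conjI exI[of _ "2 * K + 1"]) auto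
  fix \<epsilon> :: real assume \<epsilon>: "0 < \<epsilon>"
  define v\<^sub>0 where "v\<^sub>0 = 2 * K + 1 + 2 * K / \<epsilon>"
  have v\<^sub>0: "0 < v\<^sub>0" "2 * K + 1 \<le> v\<^sub>0" "2 * K / \<epsilon> \<le> v\<^sub>0" using K \<epsilon> by (auto simp: v\<^sub>0_def add_pos_nonneg)
  have "v * tail_first_moment Q v \<le> \<epsilon> * truncated_second_moment Q v" if "Q \<in> \<Q>" "v\<^sub>0 \<le> v" for Q v
  proof -
    interpret centred_law Q using \<Q>[OF that(1)] by blast
    have v: "0 < v" using that(2) v\<^sub>0 by linarith
    have "J v \<le> K / v\<^sup>2" using \<Q>[OF that(1)] K v by (intro tail_bounds_of_third_moment) auto
    then have "v * J v \<le> v * (K / v\<^sup>2)" using v by (intro mult_left_mono) auto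
    also have "\<dots> = K / v" using v by (simp add: power2_eq_square)
    also have "\<dots> \<le> \<epsilon> * (1 / 2)"
    proof -
      have "2 * K / \<epsilon> \<le> v" using that(2) v\<^sub>0 by linarith
      then show ?thesis using v \<epsilon> by (simp add: field_simps)
    qed
    also have "\<dots> \<le> \<epsilon> * L v" using half[OF that(1), of v] that(2) v\<^sub>0 \<epsilon> by (intro mult_left_mono) auto
    finally show ?thesis .
  qed
  then show "\<exists>v\<^sub>0>0. \<forall>Q\<in>\<Q>. \<forall>v\<ge>v\<^sub>0. v * tail_first_moment Q v \<le> \<epsilon> * truncated_second_moment Q v"
    using v\<^sub>0(1) by blast
qed

lemma bounded_skew_imp_small_tails:
  assumes sub: "\<P> \<subseteq> DAN \<mu>" and skew: "uniformly_bounded_skew \<P>"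
  shows "uniformly_small_tails ((\<lambda>P. distr P borel (\<lambda>x. (x - \<mu>) / sqrt (prob_space.variance P (\<lambda>x. x)))) ` \<P>)"
proof -
  define \<sigma> where "\<sigma> P = sqrt (prob_space.variance P (\<lambda>x. x))" for P :: "real measure"
  define S where "S = (SUP P\<in>\<P>. (\<integral>\<^sup>+x. ennreal (\<bar>x - (\<integral>y. y \<partial>P)\<bar> ^ 3) \<partial>P) / ennreal (\<sigma> P ^ 3))"
  have S: "S < \<infinity>" using skew by (simp add: uniformly_bounded_skew_def S_def \<sigma>_def)
  define K where "K = enn2real S"
  have SK: "S = ennreal K" using S by (simp add: K_def)
  show ?thesis
  proof (rule uniformly_small_tails_of_third_moment)
    show "0 \<le> K" by (simp add: K_def)
    fix Q assume "Q \<in> (\<lambda>P. distr P borel (\<lambda>x. (x - \<mu>) / sqrt (prob_space.variance P (\<lambda>x. x)))) ` \<P>"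
    then obtain P where P: "P \<in> \<P>" and Q: "Q = distr P borel (\<lambda>x. (x - \<mu>) / \<sigma> P)" by (auto simp: \<sigma>_def)
    have rd: "real_distribution P" and int: "integrable P (\<lambda>x. x)" and mean: "(\<integral>x. x \<partial>P) = \<mu>"
      using sub P by (auto simp: DAN_def)
    interpret P: real_distribution P by (rule rd)
    have int2: "integrable P (\<lambda>x. x\<^sup>2)" and var: "0 < P.variance (\<lambda>x. x)"
      using skew P by (auto simp: uniformly_bounded_skew_def)
    have \<sigma>: "0 < \<sigma> P" "(\<sigma> P)\<^sup>2 = (\<integral>x. (x - \<mu>)\<^sup>2 \<partial>P)" using var by (simp_all add: \<sigma>_def mean)
    have intc: "integrable P (\<lambda>x. (x - \<mu>)\<^sup>2)"
    proof -
      have "integrable P (\<lambda>x. x\<^sup>2 - 2 * \<mu> * x + \<mu>\<^sup>2)" using int int2 by auto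
      moreover have "(\<lambda>x. (x - \<mu>)\<^sup>2) = (\<lambda>x. x\<^sup>2 - 2 * \<mu> * x + \<mu>\<^sup>2)" by (simp add: power2_eq_square algebra_simps)
      ultimately show ?thesis by simp
    qed
    have "integrable Q (\<lambda>x. x\<^sup>2)"
      unfolding Q using intc by (subst integrable_distr_eq) (auto simp: power_divide)
    moreover have "(\<integral>x. x\<^sup>2 \<partial>Q) = 1"
    proof -
      have "(\<integral>x. x\<^sup>2 \<partial>Q) = (\<integral>x. (x - \<mu>)\<^sup>2 / (\<sigma> P)\<^sup>2 \<partial>P)"
        unfolding Q by (subst integral_distr) (auto simp: power_divide)
      also have "\<dots> = (\<integral>x. (x - \<mu>)\<^sup>2 \<partial>P) / (\<sigma> P)\<^sup>2" by (rule integral_divide_zero)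
      also have "\<dots> = 1" unfolding \<sigma>(2)[symmetric] using \<sigma>(1) by simp
      finally show ?thesis .
    qed
    moreover have "(\<integral>\<^sup>+x. ennreal (\<bar>x\<bar> ^ 3) \<partial>Q) \<le> ennreal K"
    proof -
      have "(\<integral>\<^sup>+x. ennreal (\<bar>x\<bar> ^ 3) \<partial>Q) = (\<integral>\<^sup>+x. ennreal (\<bar>(x - \<mu>) / \<sigma> P\<bar> ^ 3) \<partial>P)"
        unfolding Q by (subst nn_integral_distr) auto
      also have "\<dots> = (\<integral>\<^sup>+x. ennreal (\<bar>x - \<mu>\<bar> ^ 3) / ennreal (\<sigma> P ^ 3) \<partial>P)"
        using \<sigma>(1) by (intro nn_integral_cong) (simp add: divide_ennreal power_divide)
      also have "\<dots> = (\<integral>\<^sup>+x. ennreal (\<bar>x - \<mu>\<bar> ^ 3) \<partial>P) / ennreal (\<sigma> P ^ 3)" by (rule nn_integral_divide) simp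
      also have "\<dots> \<le> S" unfolding S_def mean[symmetric] using P by (rule SUP_upper)
      finally show ?thesis by (simp add: SK)
    qed
    moreover have "centred_law Q" unfolding Q by (rule centred_law_shift_scale[OF rd int mean])
    ultimately show "centred_law Q \<and> integrable Q (\<lambda>x. x\<^sup>2) \<and> (\<integral>x. x\<^sup>2 \<partial>Q) = 1 \<and>
      (\<integral>\<^sup>+x. ennreal (\<bar>x\<bar> ^ 3) \<partial>Q) \<le> ennreal K" by blast
  qed
qed

section \<open>Post-hoc risk of the interval\<close>

text \<open>The decomposition of the sum of squares about \<open>\<mu>\<close> into its parts within the sample and between sample
  mean and \<open>\<mu>\<close>; it links the Studentised and the self-normalised sum.\<close>

lemma sum_squares_about:
  "(\<Sum>i<n. (X i \<omega> - \<mu>)\<^sup>2) = real n * ((sample_sd X n \<omega>)\<^sup>2 + (sample_mean X n \<omega> - \<mu>)\<^sup>2)"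
proof (cases "n = 0")
  case False
  let ?m = "sample_mean X n \<omega>"
  have sum: "(\<Sum>i<n. X i \<omega>) = real n * ?m" using False by (simp add: sample_mean_def)
  have sd: "real n * (sample_sd X n \<omega>)\<^sup>2 = (\<Sum>i<n. (X i \<omega> - ?m)\<^sup>2)"
    using False by (simp add: sample_sd_def sum_nonneg)
  have "(\<Sum>i<n. (X i \<omega> - \<mu>)\<^sup>2) = (\<Sum>i<n. (X i \<omega> - ?m)\<^sup>2 + (2 * (?m - \<mu>) * X i \<omega> + (\<mu>\<^sup>2 - ?m\<^sup>2)))"
    by (intro sum.cong) (auto simp: power2_eq_square algebra_simps)
  also have "\<dots> = (\<Sum>i<n. (X i \<omega> - ?m)\<^sup>2) + (2 * (?m - \<mu>) * (real n * ?m) + real n * (\<mu>\<^sup>2 - ?m\<^sup>2))"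
    by (simp add: sum.distrib sum_distrib_left[symmetric] sum)
  also have "\<dots> = real n * (sample_sd X n \<omega>)\<^sup>2 + real n * (?m - \<mu>)\<^sup>2"
    unfolding sd by (simp add: power2_eq_square algebra_simps)
  finally show ?thesis by (simp add: distrib_left)
qed simp

text \<open>Write \<open>c = A \<surd>n\<close>.  For \<open>c > 0\<close>, missing \<open>\<mu>\<close> means \<open>A s / \<surd>(1 - A\<^sup>2) \<le> \<bar>D\<bar>\<close> for the deviation \<open>D\<close> of the
  sample mean; squaring and collecting terms gives \<open>A\<^sup>2 (s\<^sup>2 + D\<^sup>2) \<le> D\<^sup>2\<close>, that is \<open>c V \<le> \<bar>S\<bar>\<close>.  By the
  definition of \<open>A\<close>, \<open>1/\<alpha> = exp (l c - l\<^sup>2/2) / 2\<close>.  For \<open>c \<le> 0\<close> the bound is immediate, and for \<open>V = 0\<close> it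
  follows from \<open>\<bar>c\<bar> < \<surd>n\<close>, the condition under which the interval is not the whole line.\<close>

lemma inverse_level_le:
  assumes l: "0 < l" and \<alpha>: "0 < \<alpha>" and \<sigma>: "0 < \<sigma>" and miss: "\<mu> \<notin> H_IWR X l n \<alpha> \<omega>"
  shows "1 / \<alpha> \<le> exp (- (l\<^sup>2 / 2)) / 2 * self_normalised_exp l n (\<lambda>i. (X i \<omega> - \<mu>) / \<sigma>)"
proof -
  let ?x = "\<lambda>i. (X i \<omega> - \<mu>) / \<sigma>"
  define V where "V = root_sum_squares n ?x"
  define c where "c = ln (2 / \<alpha>) / l + l / 2"
  define A where "A = A_IWR n \<alpha> l"
  define D where "D = sample_mean X n \<omega> - \<mu>"
  define s where "s = sample_sd X n \<omega>"
  have n: "c\<^sup>2 < real n" and miss': "W_IWR X l n \<alpha> \<omega> \<le> \<bar>D\<bar>"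
    using miss by (auto simp: H_IWR_def c_def D_def split: if_splits)
  have npos: "0 < real n" using n zero_le_power2[of c] by linarith
  have "\<bar>c\<bar> < sqrt (real n)" using n real_sqrt_less_mono[of "c\<^sup>2" "real n"] by simp
  have A: "A = c / sqrt (real n)" using l by (simp add: A_def A_IWR_def c_def field_simps power2_eq_square)
  have lc: "ln (2 / \<alpha>) = l * c - l\<^sup>2 / 2" using l by (simp add: c_def field_simps power2_eq_square)
  have "1 / \<alpha> = exp (ln (2 / \<alpha>)) / 2" using \<alpha> by simp
  also have "exp (ln (2 / \<alpha>)) = exp (- (l\<^sup>2 / 2)) * exp (l * c)"
    unfolding lc exp_add[symmetric] by (rule arg_cong[where f = exp]) simp
  also have "\<dots> / 2 = exp (- (l\<^sup>2 / 2)) / 2 * exp (l * c)" by (rule times_divide_eq_left[symmetric])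
  also have "\<dots> \<le> exp (- (l\<^sup>2 / 2)) / 2 * self_normalised_exp l n ?x"
  proof (rule mult_left_mono)
    show "exp (l * c) \<le> self_normalised_exp l n ?x"
    proof (cases "V = 0")
      case True
      then show ?thesis using \<open>\<bar>c\<bar> < sqrt (real n)\<close> l by (simp add: self_normalised_exp_def V_def)
    next
      case False
      then have Vpos: "0 < V" using root_sum_squares_nonneg[of n ?x] by (simp add: V_def)
      have "c \<le> \<bar>\<Sum>i<n. ?x i\<bar> / V"
      proof (cases "c \<le> 0")
        case True
        then show ?thesis using Vpos by (intro order_trans[OF True]) simp
      next
        case False
        have A2: "A\<^sup>2 = c\<^sup>2 / real n" by (simp add: A power_divide)
        then have "A\<^sup>2 < 1" using n npos by simp
        then have R: "0 < sqrt (1 - A\<^sup>2)" by simp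
        have "0 < A" using False npos by (simp add: A)
        have "0 \<le> s" by (simp add: s_def sample_sd_def sum_nonneg)
        have "A * s / sqrt (1 - A\<^sup>2) \<le> \<bar>D\<bar>" using miss' by (simp add: W_IWR_def A_def s_def)
        then have "A * s \<le> \<bar>D\<bar> * sqrt (1 - A\<^sup>2)" using R by (simp only: pos_divide_le_eq)
        then have "(A * s)\<^sup>2 \<le> (\<bar>D\<bar> * sqrt (1 - A\<^sup>2))\<^sup>2" using \<open>0 < A\<close> \<open>0 \<le> s\<close> by (intro power_mono) auto
        also have "\<dots> = D\<^sup>2 * (1 - A\<^sup>2)" using \<open>A\<^sup>2 < 1\<close> by (simp add: power_mult_distrib)
        finally have AD: "A\<^sup>2 * (s\<^sup>2 + D\<^sup>2) \<le> D\<^sup>2" by (simp add: power_mult_distrib algebra_simps)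
        have V2: "(V * \<sigma>)\<^sup>2 = real n * (s\<^sup>2 + D\<^sup>2)"
        proof -
          have "V\<^sup>2 = (\<Sum>i<n. (X i \<omega> - \<mu>)\<^sup>2) / \<sigma>\<^sup>2"
            unfolding V_def root_sum_squares_sq by (simp add: power_divide sum_divide_distrib)
          then show ?thesis using \<sigma> by (simp add: power_mult_distrib sum_squares_about s_def D_def)
        qed
        have SD: "(\<Sum>i<n. ?x i) * \<sigma> = real n * D"
        proof -
          have "(\<Sum>i<n. ?x i) = (\<Sum>i<n. X i \<omega> - \<mu>) / \<sigma>" by (rule sum_divide_distrib[symmetric])
          then have "(\<Sum>i<n. ?x i) * \<sigma> = (\<Sum>i<n. X i \<omega>) - real n * \<mu>" using \<sigma> by (simp add: sum_subtractf)
          then show ?thesis using npos by (simp add: D_def sample_mean_def right_diff_distrib)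
        qed
        have "(c * (V * \<sigma>))\<^sup>2 = (real n)\<^sup>2 * (A\<^sup>2 * (s\<^sup>2 + D\<^sup>2))"
          unfolding power_mult_distrib[of c] V2 A2 using npos by (simp add: power2_eq_square)
        also have "\<dots> \<le> (real n)\<^sup>2 * D\<^sup>2" using AD by (intro mult_left_mono) auto
        also have "\<dots> = ((\<Sum>i<n. ?x i) * \<sigma>)\<^sup>2" unfolding SD by (simp add: power_mult_distrib)
        finally have "\<bar>c * (V * \<sigma>)\<bar> \<le> \<bar>(\<Sum>i<n. ?x i) * \<sigma>\<bar>" by (simp only: abs_le_square_iff)
        then have "(c * V) * \<sigma> \<le> \<bar>\<Sum>i<n. ?x i\<bar> * \<sigma>"
          using \<sigma> False Vpos by (simp add: abs_mult mult.assoc)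
        then have "c * V \<le> \<bar>\<Sum>i<n. ?x i\<bar>" using \<sigma> by (simp only: mult_le_cancel_right_pos)
        then show ?thesis using Vpos by (simp only: pos_le_divide_eq)
      qed
      then have "l * c \<le> l * (\<bar>\<Sum>i<n. ?x i\<bar> / V)" using l by (intro mult_left_mono) auto
      then show ?thesis using False by (simp add: self_normalised_exp_def V_def)
    qed
  qed simp
  finally show ?thesis .
qed

lemma iid_shift_scale:
  assumes iid: "iid_with_law M X P"
  shows "iid_with_law M (\<lambda>i \<omega>. (X i \<omega> - \<mu>) / c) (distr P borel (\<lambda>x. (x - \<mu>) / c))"
proof -
  interpret prob_space M using iid by (simp add: iid_with_law_def)
  have ind: "indep_vars (\<lambda>_. borel) X UNIV" and law: "\<And>i. distr M borel (X i) = P"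
    using iid by (auto simp: iid_with_law_def)
  have [measurable]: "X i \<in> borel_measurable M" for i using ind by (auto simp: indep_vars_def)
  have "indep_vars (\<lambda>_. borel) (\<lambda>i. (\<lambda>x. (x - \<mu>) / c) \<circ> X i) UNIV"
    using ind by (rule indep_vars_compose) simp
  then have "indep_vars (\<lambda>_. borel) (\<lambda>i \<omega>. (X i \<omega> - \<mu>) / c) UNIV" by (simp add: comp_def)
  moreover have "distr M borel (\<lambda>\<omega>. (X i \<omega> - \<mu>) / c) = distr P borel (\<lambda>x. (x - \<mu>) / c)" for i
    unfolding law[of i, symmetric] by (subst distr_distr) (auto simp: comp_def)
  ultimately show ?thesis using prob_space_axioms by (simp add: iid_with_law_def)
qed

lemma posthoc_risk_le:
  assumes l: "0 < l" and \<sigma>: "0 < \<sigma>" and X: "\<And>i. X i \<in> borel_measurable M" and B: "0 \<le> B"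
    and le: "(\<integral>\<^sup>+\<omega>. ennreal (self_normalised_exp l n (\<lambda>i. (X i \<omega> - \<mu>) / \<sigma>)) \<partial>M) \<le> ennreal B"
  shows "posthoc_risk M (H_IWR X l n) \<mu> \<le> ennreal (exp (- (l\<^sup>2 / 2)) / 2 * B)"
proof -
  note [measurable] = X
  let ?F = "\<lambda>\<omega>. self_normalised_exp l n (\<lambda>i. (X i \<omega> - \<mu>) / \<sigma>)"
  have "posthoc_risk M (H_IWR X l n) \<mu> \<le> (\<integral>\<^sup>+\<omega>. ennreal (exp (- (l\<^sup>2 / 2)) / 2 * ?F \<omega>) \<partial>M)"
    unfolding posthoc_risk_def
  proof (intro nn_integral_mono SUP_least)
    fix \<omega> \<alpha> assume "\<alpha> \<in> {0 :: real<..}"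
    then have \<alpha>: "0 < \<alpha>" by simp
    show "ennreal (of_bool (\<mu> \<notin> H_IWR X l n \<alpha> \<omega>) / \<alpha>) \<le> ennreal (exp (- (l\<^sup>2 / 2)) / 2 * ?F \<omega>)"
      using inverse_level_le[OF l \<alpha> \<sigma>, of \<mu> X n \<omega>] by (cases "\<mu> \<notin> H_IWR X l n \<alpha> \<omega>") (auto intro: ennreal_leI)
  qed
  also have "\<dots> \<le> ennreal (exp (- (l\<^sup>2 / 2)) / 2 * B)"
  proof (intro nn_integral_cmult_le le)
    show "?F \<in> borel_measurable M" unfolding self_normalised_exp_def root_sum_squares_def by measurable
  qed simp
  finally show ?thesis .
qed

text \<open>The interval depends on the observations only through \<open>S / V\<close>, which is invariant under rescaling; hence
  each law may be scaled by its own \<open>\<sigma> P\<close> before the small-tail condition is imposed.\<close>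

lemma eventually_posthoc_risk_le:
  fixes M :: "real measure \<Rightarrow> 'w measure" and X :: "nat \<Rightarrow> 'w \<Rightarrow> real"
  assumes iid: "\<And>P. P \<in> \<P> \<Longrightarrow> iid_with_law (M P) X P" and l: "0 < l"
    and \<sigma>: "\<And>P. P \<in> \<P> \<Longrightarrow> 0 < \<sigma> P"
    and tails: "uniformly_small_tails ((\<lambda>P. distr P borel (\<lambda>x. (x - \<mu>) / \<sigma> P)) ` \<P>)" and \<eta>: "0 < \<eta>"
  shows "\<forall>\<^sub>F n in sequentially. \<forall>P\<in>\<P>. posthoc_risk (M P) (H_IWR X l n) \<mu> \<le> 1 + ennreal \<eta>"
proof -
  have "0 < 2 * exp (l\<^sup>2 / 2) * \<eta>" using \<eta> by simp
  from self_normalised_exp_limit_le[OF tails l this, where ?'w = 'w] show ?thesis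
  proof eventually_elim
    case (elim n)
    show ?case
    proof
      fix P assume P: "P \<in> \<P>"
      have X: "X i \<in> borel_measurable (M P)" for i
        using iid[OF P] by (auto simp: iid_with_law_def prob_space.indep_vars_def)
      have "(\<integral>\<^sup>+\<omega>. ennreal (self_normalised_exp l n (\<lambda>i. (X i \<omega> - \<mu>) / \<sigma> P)) \<partial>M P)
          \<le> ennreal (2 * exp (l\<^sup>2 / 2) + 2 * exp (l\<^sup>2 / 2) * \<eta>)"
        using elim P iid_shift_scale[OF iid[OF P], of \<mu> "\<sigma> P"] by blast
      then have "posthoc_risk (M P) (H_IWR X l n) \<mu>
          \<le> ennreal (exp (- (l\<^sup>2 / 2)) / 2 * (2 * exp (l\<^sup>2 / 2) + 2 * exp (l\<^sup>2 / 2) * \<eta>))"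
        using \<eta> by (intro posthoc_risk_le[OF l \<sigma>[OF P] X]) auto
      also have "exp (- (l\<^sup>2 / 2)) / 2 * (2 * exp (l\<^sup>2 / 2) + 2 * exp (l\<^sup>2 / 2) * \<eta>) = 1 + \<eta>"
        by (simp add: exp_minus field_simps)
      also have "ennreal (1 + \<eta>) = 1 + ennreal \<eta>" using \<eta> by simp
      finally show "posthoc_risk (M P) (H_IWR X l n) \<mu> \<le> 1 + ennreal \<eta>" .
    qed
  qed
qed

theorem theorem3p2:
  fixes \<mu> l :: real
    and M :: "real measure \<Rightarrow> 'w measure"
    and X :: "nat \<Rightarrow> 'w \<Rightarrow> real"
  assumes "\<And>P. P \<in> DAN \<mu> \<Longrightarrow> iid_with_law (M P) X P"
    and "l > 0"
  shows "asymp_posthoc_ci M (DAN \<mu>) (H_IWR X l) \<mu> \<and>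
    (\<forall>\<P> \<subseteq> DAN \<mu>. uniformly_bounded_skew \<P> \<longrightarrow>
       uniform_asymp_posthoc_ci M \<P> (H_IWR X l) \<mu>)"
proof (intro conjI allI impI)
  show "asymp_posthoc_ci M (DAN \<mu>) (H_IWR X l) \<mu>"
    unfolding asymp_posthoc_ci_def
  proof (rule SUP_least)
    fix P assume P: "P \<in> DAN \<mu>"
    show "limsup (\<lambda>n. posthoc_risk (M P) (H_IWR X l n) \<mu>) \<le> 1"
    proof (rule ennreal_le_epsilon)
      fix \<eta> :: real assume \<eta>: "0 < \<eta>"
      have "\<forall>\<^sub>F n in sequentially. \<forall>P\<in>{P}. posthoc_risk (M P) (H_IWR X l n) \<mu> \<le> 1 + ennreal \<eta>"
        using assms P DAN_imp_small_tails[OF P] \<eta>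
        by (intro eventually_posthoc_risk_le[where \<sigma> = "\<lambda>_. 1"]) auto
      then show "limsup (\<lambda>n. posthoc_risk (M P) (H_IWR X l n) \<mu>) \<le> 1 + ennreal \<eta>"
        by (intro Limsup_bounded) simp
    qed
  qed
next
  fix \<P> assume sub: "\<P> \<subseteq> DAN \<mu>" and skew: "uniformly_bounded_skew \<P>"
  show "uniform_asymp_posthoc_ci M \<P> (H_IWR X l) \<mu>"
    unfolding uniform_asymp_posthoc_ci_def
  proof (rule ennreal_le_epsilon)
    fix \<eta> :: real assume \<eta>: "0 < \<eta>"
    have "\<forall>\<^sub>F n in sequentially. \<forall>P\<in>\<P>. posthoc_risk (M P) (H_IWR X l n) \<mu> \<le> 1 + ennreal \<eta>"
    proof (rule eventually_posthoc_risk_le[OF _ assms(2) _ bounded_skew_imp_small_tails[OF sub skew] \<eta>])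
      show "iid_with_law (M P) X P" if "P \<in> \<P>" for P using assms(1) sub that by blast
      show "0 < sqrt (prob_space.variance P (\<lambda>x. x))" if "P \<in> \<P>" for P
        using skew that by (simp add: uniformly_bounded_skew_def)
    qed
    then have "\<forall>\<^sub>F n in sequentially. (SUP P\<in>\<P>. posthoc_risk (M P) (H_IWR X l n) \<mu>) \<le> 1 + ennreal \<eta>"
      by eventually_elim (auto intro: SUP_least)
    then show "limsup (\<lambda>n. SUP P\<in>\<P>. posthoc_risk (M P) (H_IWR X l n) \<mu>) \<le> 1 + ennreal \<eta>"
      by (rule Limsup_bounded)
  qed
qed

end
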